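(* Let $n\in\mathbb{N}$ and let $V:\mathbb{R}^n\to\mathbb{R}$ be continuous and bounded below. Suppose that, as a multiplication operator with domain $D(V)=\{f\in L^2(\mathbb{R}^n): Vf\in L^2(\mathbb{R}^n)\}$, $V$ is relatively $(-\Delta)$-bounded with relative bound strictly less than one, so that $H=-\Delta+V$ is self-adjoint on the domain $H^2(\mathbb{R}^n)\subseteq D(V)$. Let $\psi$ be an eigenfunction of $H$ with associated eigenvalue $E\in\mathbb{R}$, and suppose $\psi\in L^\infty(\mathbb{R}^n)$. Let $\rho_E(x)$ be the Agmon distance of $x$ to the origin associated with $V$ and $E$, and assume that $$\lim_{|x|\to\infty}\rho_E(x)=\infty .$$ Let $\phi\in C^1([0,+\infty))$ be an increasing function with $\phi\ge 1$, $$\lim_{t\to+\infty}\phi(t)=\infty,\qquad 0<\sup_{t\in[0,\infty)}\left|\frac{\phi'(t)}{\phi(t)}\right|<\infty,\qquad \lim_{t\to\infty}\frac{\phi'(t)}{\phi(t)}=0 .$$ Then for each $0<\epsilon<1$ and $\delta>0$ for which $$\chi_{\{V\le E+\delta\}}\,\phi\big((1-\epsilon)\rho_E\big)\in L^2(\mathbb{R}^n),$$ there exists a constant $0<\tilde c_{\epsilon,\delta}<\infty$ such that $$\int_{\mathbb{R}^n}\phi\big((1-\epsilon)\rho_E(x)\big)^2\,|\psi(x)|^2\,\mathrm{d}^n x\le \tilde c_{\epsilon,\delta}.$$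
   Context: $-\Delta$ is the self-adjoint Laplacian on $L^2(\mathbb{R}^n)$ with domain $H^2(\mathbb{R}^n)$. For continuous $V:\mathbb{R}^n\to\mathbb{R}$ and $E\in\mathbb{R}$, the Agmon metric is the pseudo-metric $$\rho_E(x,y):=\inf_{\gamma\in P_{x,y}}\int_0^1 (V(\gamma(t))-E)_+^{1/2}\,|\dot\gamma(t)|\,\mathrm{d}t,$$ where $P_{x,y}$ is the set of absolutely continuous paths $\gamma:[0,1]\to\mathbb{R}^n$ with $\gamma(0)=x$, $\gamma(1)=y$, and $(V-E)_+:=\max\{V-E,0\}$. The Agmon distance to the origin is $\rho_E(x):=\rho_E(x,0)$. $\chi_A$ denotes the characteristic function of a set $A$, and $\{V\le E+\delta\}=\{x\in\mathbb{R}^n: V(x)\le E+\delta\}$. "Increasing" means $s\le t$ implies $\phi(s)\le\phi(t)$ (not necessarily strictly). *)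

theory Defs
  imports "HOL-Analysis.Analysis"
begin

text \<open>
  Elements of $L^2$ are represented by Lebesgue measurable functions; operators act on such
  representatives, and equality in $L^2$ is equality almost everywhere.
\<close>

definition L2 :: "('a::euclidean_space \<Rightarrow> 'b::{banach, second_countable_topology}) set" where
  "L2 = {f \<in> borel_measurable lebesgue. integrable lebesgue (\<lambda>x. (norm (f x))\<^sup>2)}"

definition L2_norm :: "('a::euclidean_space \<Rightarrow> 'b::{banach, second_countable_topology}) \<Rightarrow> real" where
  "L2_norm f = sqrt (LINT x|lebesgue. (norm (f x))\<^sup>2)"

definition Linfty :: "('a::euclidean_space \<Rightarrow> 'b::{banach, second_countable_topology}) set" where
  "Linfty = {f \<in> borel_measurable lebesgue. \<exists>C. AE x in lebesgue. norm (f x) \<le> C}"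


subsection \<open>Weak derivatives, Sobolev spaces and the Laplacian\<close>

definition pderiv_at :: "'n \<Rightarrow> (real ^ 'n \<Rightarrow> real) \<Rightarrow> real ^ 'n \<Rightarrow> real" where
  "pderiv_at i f x = deriv (\<lambda>t. f (x + t *\<^sub>R axis i 1)) 0"

primrec C_k :: "nat \<Rightarrow> (real ^ 'n \<Rightarrow> real) \<Rightarrow> bool" where
  "C_k 0 f \<longleftrightarrow> continuous_on UNIV f"
| "C_k (Suc k) f \<longleftrightarrow> continuous_on UNIV f \<and>
     (\<forall>i. (\<forall>x. (\<lambda>t. f (x + t *\<^sub>R axis i 1)) differentiable (at 0)) \<and> C_k k (pderiv_at i f))"

definition test_function :: "(real ^ 'n \<Rightarrow> real) \<Rightarrow> bool" where
  "test_function \<eta> \<longleftrightarrow> (\<forall>k. C_k k \<eta>) \<and> compact (closure {x. \<eta> x \<noteq> 0})"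

definition locally_integrable :: "(real ^ 'n \<Rightarrow> complex) \<Rightarrow> bool" where
  "locally_integrable f \<longleftrightarrow> (\<forall>K. compact K \<longrightarrow> set_integrable lebesgue K f)"

definition has_weak_pderiv :: "(real ^ 'n \<Rightarrow> complex) \<Rightarrow> 'n \<Rightarrow> (real ^ 'n \<Rightarrow> complex) \<Rightarrow> bool" where
  "has_weak_pderiv f i g \<longleftrightarrow> locally_integrable f \<and> locally_integrable g \<and>
     (\<forall>\<eta>. test_function \<eta> \<longrightarrow>
        (LINT x|lebesgue. pderiv_at i \<eta> x *\<^sub>R f x) = - (LINT x|lebesgue. \<eta> x *\<^sub>R g x))"

text \<open>Weak derivatives are unique almost everywhere, so the choice is immaterial.\<close>

definition weak_pderiv :: "'n \<Rightarrow> (real ^ 'n \<Rightarrow> complex) \<Rightarrow> real ^ 'n \<Rightarrow> complex" where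
  "weak_pderiv i f = (SOME g. has_weak_pderiv f i g)"

primrec sobolev_H :: "nat \<Rightarrow> (real ^ 'n \<Rightarrow> complex) set" where
  "sobolev_H 0 = L2"
| "sobolev_H (Suc k) = {f \<in> L2. \<forall>i. \<exists>g \<in> sobolev_H k. has_weak_pderiv f i g}"

definition laplacian :: "(real ^ 'n \<Rightarrow> complex) \<Rightarrow> real ^ 'n \<Rightarrow> complex" where
  "laplacian f x = (\<Sum>i\<in>UNIV. weak_pderiv i (weak_pderiv i f) x)"


subsection \<open>Schroedinger operators\<close>

definition mult_op :: "(real ^ 'n \<Rightarrow> real) \<Rightarrow> (real ^ 'n \<Rightarrow> complex) \<Rightarrow> real ^ 'n \<Rightarrow> complex" where
  "mult_op V f x = complex_of_real (V x) * f x"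

definition mult_dom :: "(real ^ 'n \<Rightarrow> real) \<Rightarrow> (real ^ 'n \<Rightarrow> complex) set" where
  "mult_dom V = {f \<in> L2. mult_op V f \<in> L2}"

definition schroedinger :: "(real ^ 'n \<Rightarrow> real) \<Rightarrow> (real ^ 'n \<Rightarrow> complex) \<Rightarrow> real ^ 'n \<Rightarrow> complex" where
  "schroedinger V f x = - laplacian f x + mult_op V f x"

text \<open>
  An operator is given by its domain and its action there. The set below collects the constants
  $a$ admissible in $\|Bf\| \le a\|Af\| + b\|f\|$; the relative bound is their infimum.
\<close>

definition rel_bounds ::
    "(real ^ 'n \<Rightarrow> complex) set \<Rightarrow> ((real ^ 'n \<Rightarrow> complex) \<Rightarrow> (real ^ 'n \<Rightarrow> complex))
     \<Rightarrow> ((real ^ 'n \<Rightarrow> complex) \<Rightarrow> (real ^ 'n \<Rightarrow> complex)) \<Rightarrow> real set" where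
  "rel_bounds D A B =
     {a. a \<ge> 0 \<and> (\<exists>b\<ge>0. \<forall>f\<in>D. L2_norm (B f) \<le> a * L2_norm (A f) + b * L2_norm f)}"

definition relatively_bounded ::
    "(real ^ 'n \<Rightarrow> complex) set \<Rightarrow> ((real ^ 'n \<Rightarrow> complex) \<Rightarrow> (real ^ 'n \<Rightarrow> complex))
     \<Rightarrow> (real ^ 'n \<Rightarrow> complex) set \<Rightarrow> ((real ^ 'n \<Rightarrow> complex) \<Rightarrow> (real ^ 'n \<Rightarrow> complex)) \<Rightarrow> bool" where
  "relatively_bounded D\<^sub>A A D\<^sub>B B \<longleftrightarrow> D\<^sub>A \<subseteq> D\<^sub>B \<and> rel_bounds D\<^sub>A A B \<noteq> {}"

definition relative_bound ::
    "(real ^ 'n \<Rightarrow> complex) set \<Rightarrow> ((real ^ 'n \<Rightarrow> complex) \<Rightarrow> (real ^ 'n \<Rightarrow> complex))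
     \<Rightarrow> ((real ^ 'n \<Rightarrow> complex) \<Rightarrow> (real ^ 'n \<Rightarrow> complex)) \<Rightarrow> real" where
  "relative_bound D A B = Inf (rel_bounds D A B)"

definition eigenfunction ::
    "(real ^ 'n \<Rightarrow> complex) set \<Rightarrow> ((real ^ 'n \<Rightarrow> complex) \<Rightarrow> (real ^ 'n \<Rightarrow> complex))
     \<Rightarrow> complex \<Rightarrow> (real ^ 'n \<Rightarrow> complex) \<Rightarrow> bool" where
  "eigenfunction D T z \<psi> \<longleftrightarrow> \<psi> \<in> D \<and> \<not> (AE x in lebesgue. \<psi> x = 0) \<and>
     (AE x in lebesgue. T \<psi> x = z * \<psi> x)"


subsection \<open>The Agmon metric\<close>

text \<open>
  The intervals in \<open>\<D>\<close> are compact and non-overlapping, with endpoints \<open>Inf k\<close> and \<open>Sup k\<close>.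
\<close>

definition abs_continuous_on :: "real set \<Rightarrow> (real \<Rightarrow> 'a::real_normed_vector) \<Rightarrow> bool" where
  "abs_continuous_on S f \<longleftrightarrow>
     (\<forall>e>0. \<exists>d>0. \<forall>\<D>. \<D> division_of \<Union>\<D> \<and> \<Union>\<D> \<subseteq> S \<and> (\<Sum>k\<in>\<D>. Sup k - Inf k) < d \<longrightarrow>
        (\<Sum>k\<in>\<D>. norm (f (Sup k) - f (Inf k))) < e)"

definition ac_paths :: "real ^ 'n \<Rightarrow> real ^ 'n \<Rightarrow> (real \<Rightarrow> real ^ 'n) set" where
  "ac_paths x y = {\<gamma>. abs_continuous_on {0..1} \<gamma> \<and> \<gamma> 0 = x \<and> \<gamma> 1 = y}"

text \<open>
  For continuous \<open>V\<close> the integrand is integrable along every absolutely continuous path, and the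
  null set on which the path is not differentiable is irrelevant.
\<close>

definition agmon_length :: "(real ^ 'n \<Rightarrow> real) \<Rightarrow> real \<Rightarrow> (real \<Rightarrow> real ^ 'n) \<Rightarrow> real" where
  "agmon_length V E \<gamma> =
     (LINT t:{0..1}|lebesgue. sqrt (max (V (\<gamma> t) - E) 0) * norm (vector_derivative \<gamma> (at t within {0..1})))"

definition agmon_metric :: "(real ^ 'n \<Rightarrow> real) \<Rightarrow> real \<Rightarrow> real ^ 'n \<Rightarrow> real ^ 'n \<Rightarrow> real" where
  "agmon_metric V E x y = (INF \<gamma>\<in>ac_paths x y. agmon_length V E \<gamma>)"

definition agmon_distance :: "(real ^ 'n \<Rightarrow> real) \<Rightarrow> real \<Rightarrow> real ^ 'n \<Rightarrow> real" where
  "agmon_distance V E x = agmon_metric V E x 0"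

end

theory Submission
  imports Defs
begin

text \<open>
  Agmon's argument. For real $u$ (the real or imaginary part of $\psi$) and a compactly supported
  Lipschitz weight $g$, testing the eigenvalue equation with $g^2 u$ gives
  $\int (V-E)\,g^2 u^2 \le \int |\nabla g|^2 u^2$. We take $g = \min(f, (k-|x|)_+)$ with
  $f = \phi((1-\epsilon)\rho_E)$. As $\rho_E$ has local Lipschitz constant
  $(V-E)_+^{1/2}$ and $|\phi'| \le \kappa\phi + M$ with $\kappa$ arbitrarily small, the right-hand
  side is at most a small multiple of $\int (V-E)_+ g^2 u^2$ plus a constant independent of $k$, so it
  can be absorbed on $\{V > E+\delta\}$; on $\{V \le E+\delta\}$ the integral of $f^2u^2$ is finite by
  hypothesis. Then $k \to \infty$.

  The energy inequality is obtained from second difference quotients of $u$, which converge weakly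
  to the weak second derivatives; so only difference quotients of $g$ occur, and no almost everywhere
  differentiability of Lipschitz functions is needed.
\<close>

subsection \<open>Smooth functions and test functions\<close>

text \<open>The function g^2 u is only bounded, measurable and compactly supported, whereas weak
  derivatives are defined by pairing with smooth functions. Extending the pairing to such g^2 u is
  the main analytic burden, and it uses that u is bounded. Boundedness enters again on {V \<le> E +
  \<delta>}, where the hypothesis concerns the weight alone. That the constant does not depend on k
  rests on two facts. The cone (k - |x|)_+ has slope 1 for every k, so cutting off costs a multiple
  of the integral of u^2. The additive constant M is multiplied by at most a multiple of (1 + (V -
  E)_+) u^2, whose integral is finite because \<psi> and V \<psi> both lie in L2. For the absorption
  it matters that the slope of g is governed by \<kappa> g and not by \<kappa> f: the integral of (V
  - E)_+ g^2 u^2 is finite, while nothing is known beforehand about the one with f. The Lipschitz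
  bound for \<rho>_E comes from prefixing a straight segment to an arbitrary path.\<close>

lemma C_k_imp_continuous: "C_k k f \<Longrightarrow> continuous_on UNIV f"
  by (cases k) auto

lemma C_k_Suc_imp_C_k: "C_k (Suc k) f \<Longrightarrow> C_k k f"
proof (induction k arbitrary: f)
  case (Suc k)
  show ?case
    unfolding C_k.simps(2)[of k]
    using Suc.IH Suc.prems unfolding C_k.simps(2)[of "Suc k"] by blast
qed simp

lemma pderiv_at_eqI:
  "((\<lambda>t. f (x + t *\<^sub>R axis i 1)) has_real_derivative d) (at 0) \<Longrightarrow> pderiv_at i f x = d"
  unfolding pderiv_at_def by (rule DERIV_imp_deriv)

lemma C_k_Suc_DERIV0:
  assumes "C_k (Suc k) f"
  shows "((\<lambda>t. f (x + t *\<^sub>R axis i 1)) has_real_derivative pderiv_at i f x) (at 0)"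
  using assms unfolding pderiv_at_def by (simp add: DERIV_deriv_iff_real_differentiable)

lemma C_k_SucI:
  assumes "continuous_on UNIV f"
    and "\<And>i x. ((\<lambda>t. f (x + t *\<^sub>R axis i 1)) has_real_derivative D i x) (at 0)"
    and "\<And>i. C_k k (D i)"
  shows "C_k (Suc k) f"
proof -
  have "pderiv_at i f = D i" for i
    using assms(2) by (intro ext pderiv_at_eqI)
  then show ?thesis
    using assms by (auto simp: real_differentiable_def)
qed

lemma C_k_const: "C_k k (\<lambda>_. c)"
proof (induction k arbitrary: c)
  case (Suc k)
  show ?case
    by (rule C_k_SucI[where D = "\<lambda>_ _. 0"]) (auto intro: Suc)
qed simp

lemma C_k_add: "C_k k f \<Longrightarrow> C_k k g \<Longrightarrow> C_k k (\<lambda>x. f x + g x)"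
proof (induction k arbitrary: f g)
  case (Suc k)
  show ?case
  proof (rule C_k_SucI[where D = "\<lambda>i x. pderiv_at i f x + pderiv_at i g x"])
    show "C_k k (\<lambda>x. pderiv_at i f x + pderiv_at i g x)" for i
      using Suc by simp
  qed (use Suc.prems in \<open>auto intro!: continuous_intros DERIV_add C_k_Suc_DERIV0\<close>)
qed (auto intro: continuous_intros)

lemma C_k_mult: "C_k k f \<Longrightarrow> C_k k g \<Longrightarrow> C_k k (\<lambda>x. f x * g x)"
proof (induction k arbitrary: f g)
  case (Suc k)
  show ?case
  proof (rule C_k_SucI[where D = "\<lambda>i x. pderiv_at i f x * g x + pderiv_at i g x * f x"])
    have "C_k k f" "C_k k g"
      using Suc.prems C_k_Suc_imp_C_k by blast+
    then show "C_k k (\<lambda>x. pderiv_at i f x * g x + pderiv_at i g x * f x)" for i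
      using Suc by (intro C_k_add) auto
  next
    fix i x
    from DERIV_mult[OF C_k_Suc_DERIV0[OF Suc.prems(1)] C_k_Suc_DERIV0[OF Suc.prems(2)], where x2=x and x1=x and i2=i and i1=i]
    show "((\<lambda>t. f (x + t *\<^sub>R axis i 1) * g (x + t *\<^sub>R axis i 1)) has_real_derivative
        pderiv_at i f x * g x + pderiv_at i g x * f x) (at 0)"
      by simp
  qed (use Suc.prems in \<open>auto intro!: continuous_intros\<close>)
qed (auto intro: continuous_intros)

lemma C_k_bounded_linear:
  assumes "bounded_linear f"
  shows "C_k k f"
proof (cases k)
  case (Suc m)
  interpret bounded_linear f by fact
  have "((\<lambda>t. f (x + t *\<^sub>R axis i 1)) has_real_derivative f (axis i 1)) (at 0)" for i x
    by (simp add: add scaleR) (auto intro!: derivative_eq_intros)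
  then show ?thesis
    unfolding Suc
    by (intro C_k_SucI[where D = "\<lambda>i _. f (axis i 1)"] C_k_const)
      (auto intro: linear_continuous_on assms)
qed (auto intro: linear_continuous_on assms)

lemma C_k_real_polynomial_function: "real_polynomial_function p \<Longrightarrow> C_k k p"
  by (induction p rule: real_polynomial_function.induct)
    (auto intro: C_k_bounded_linear C_k_const C_k_add C_k_mult)

text \<open>\<open>F\<close> is a chain in which each function is the derivative of its predecessor.
  Indexing by \<open>m\<close> closes the induction on \<open>k\<close>: a partial derivative of
  \<open>F m\<close> after \<open>q\<close> is \<open>F (Suc m)\<close> after \<open>q\<close> times
  a partial derivative of \<open>q\<close>.\<close>

lemma C_k_compose:
  assumes F: "\<And>m s. (F m has_real_derivative F (Suc m) s) (at s)"
    and q: "\<And>k. C_k k q"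
  shows "C_k k (\<lambda>x. F m (q x))"
proof (induction k arbitrary: m)
  case 0
  have "continuous_on UNIV (F m)"
    using F by (intro DERIV_continuous_on) (auto intro: has_field_derivative_at_within)
  moreover have "continuous_on UNIV q"
    using q C_k_imp_continuous by blast
  ultimately show ?case
    using continuous_on_compose2[of UNIV "F m" UNIV q] by simp
next
  case (Suc k)
  show ?case
  proof (rule C_k_SucI[where D = "\<lambda>i x. F (Suc m) (q x) * pderiv_at i q x"])
    show "continuous_on UNIV (\<lambda>x. F m (q x))"
      using Suc C_k_imp_continuous by blast
    show "((\<lambda>t. F m (q (x + t *\<^sub>R axis i 1))) has_real_derivative
        F (Suc m) (q x) * pderiv_at i q x) (at 0)" for i x
      using DERIV_chain2[where f = "F m" and g = "\<lambda>t. q (x + t *\<^sub>R axis i 1)" and x = 0,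
          OF F C_k_Suc_DERIV0[OF q]] by simp
    have "C_k (Suc k) q" by (rule q)
    then show "C_k k (\<lambda>x. F (Suc m) (q x) * pderiv_at i q x)" for i
      by (intro C_k_mult Suc) auto
  qed
qed

lemma pderiv_at_shift: "pderiv_at i (\<lambda>x. f (x + a)) = (\<lambda>x. pderiv_at i f (x + a))"
  by (simp add: fun_eq_iff pderiv_at_def add_ac)

lemma C_k_shift: "C_k k f \<Longrightarrow> C_k k (\<lambda>x. f (x + a))"
proof (induction k arbitrary: f)
  case 0
  then show ?case
    using continuous_on_compose2[of UNIV f UNIV "\<lambda>x. x + a"] by (simp add: continuous_intros)
next
  case (Suc k)
  show ?case
  proof (rule C_k_SucI[where D = "\<lambda>i x. pderiv_at i f (x + a)"])
    show "continuous_on UNIV (\<lambda>x. f (x + a))"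
      using continuous_on_compose2[of UNIV f UNIV "\<lambda>x. x + a"] Suc.prems
      by (simp add: continuous_intros)
    show "((\<lambda>t. f (x + t *\<^sub>R axis i 1 + a)) has_real_derivative pderiv_at i f (x + a)) (at 0)" for i x
      using C_k_Suc_DERIV0[OF Suc.prems, of "x + a"] by (simp add: add_ac)
  qed (use Suc in auto)
qed

lemma test_functionI:
  assumes "\<And>k. C_k k f" "\<And>x. f x \<noteq> 0 \<Longrightarrow> x \<in> K" "compact K"
  shows "test_function f"
proof -
  have "closure {x. f x \<noteq> 0} \<subseteq> K"
    using assms by (intro closure_minimal) (auto intro: compact_imp_closed)
  then show ?thesis
    unfolding test_function_def using assms closed_closure compact_closure
    by (meson bounded_subset compact_imp_bounded subset_trans closure_subset)
qed

lemma test_function_shift: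
  assumes "test_function \<eta>"
  shows "test_function (\<lambda>x. \<eta> (x + a))"
proof (rule test_functionI)
  show "C_k k (\<lambda>x. \<eta> (x + a))" for k
    using assms by (auto simp: test_function_def intro: C_k_shift)
  show "compact ((\<lambda>x. x - a) ` closure {x. \<eta> x \<noteq> 0})"
    using assms by (auto simp: test_function_def intro!: compact_continuous_image continuous_intros)
  show "x \<in> (\<lambda>x. x - a) ` closure {x. \<eta> x \<noteq> 0}" if "\<eta> (x + a) \<noteq> 0" for x
    using that subsetD[OF closure_subset[of "{x. \<eta> x \<noteq> 0}"], of "x + a"]
    by (intro image_eqI[of _ _ "x + a"]) auto
qed

lemma test_function_diff:
  assumes "test_function \<eta>" "test_function \<zeta>"
  shows "test_function (\<lambda>x. \<eta> x - \<zeta> x)"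
proof (rule test_functionI)
  show "C_k k (\<lambda>x. \<eta> x - \<zeta> x)" for k
    using C_k_add[of k \<eta> "\<lambda>x. (-1) * \<zeta> x"] C_k_mult[of k "\<lambda>_. -1" \<zeta>] C_k_const assms
    by (auto simp: test_function_def)
  show "compact (closure {x. \<eta> x \<noteq> 0} \<union> closure {x. \<zeta> x \<noteq> 0})"
    using assms by (auto simp: test_function_def)
  show "x \<in> closure {x. \<eta> x \<noteq> 0} \<union> closure {x. \<zeta> x \<noteq> 0}" if "\<eta> x - \<zeta> x \<noteq> 0" for x
    using that closure_subset[of "{x. \<eta> x \<noteq> 0}"] closure_subset[of "{x. \<zeta> x \<noteq> 0}"] by fastforce
qed

text \<open>Off the closed support, which has open complement, \<eta> vanishes near the point along
  the coordinate line, so the derivative is 0 there and the old support still serves.\<close>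

lemma test_function_pderiv_at:
  assumes "test_function \<eta>"
  shows "test_function (pderiv_at i \<eta>)"
proof (rule test_functionI)
  show "C_k k (pderiv_at i \<eta>)" for k
    using assms C_k.simps(2)[of k \<eta>] by (auto simp: test_function_def)
  show "compact (closure {x. \<eta> x \<noteq> 0})"
    using assms by (simp add: test_function_def)
  show "x \<in> closure {x. \<eta> x \<noteq> 0}" if "pderiv_at i \<eta> x \<noteq> 0" for x
  proof (rule ccontr)
    assume x: "x \<notin> closure {x. \<eta> x \<noteq> 0}"
    have "((\<lambda>t. x + t *\<^sub>R axis i 1) \<longlongrightarrow> x + 0 *\<^sub>R axis i 1) (nhds (0::real))"
      by (intro tendsto_intros filterlim_ident)
    then have "\<forall>\<^sub>F t::real in nhds 0. x + t *\<^sub>R axis i 1 \<in> - closure {x. \<eta> x \<noteq> 0}"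
      by (rule topological_tendstoD) (use x in auto)
    then have "\<forall>\<^sub>F t in nhds (0::real). \<eta> (x + t *\<^sub>R axis i 1) = 0"
      proof eventually_elim
      case (elim t)
      then show ?case
        using subsetD[OF closure_subset[of "{x. \<eta> x \<noteq> 0}"], of "x + t *\<^sub>R axis i 1"] by auto
    qed
    then have "((\<lambda>t. \<eta> (x + t *\<^sub>R axis i 1)) has_real_derivative 0) (at 0)"
      by (subst DERIV_cong_ev[OF refl _ refl]) auto
    then show False
      using that pderiv_at_eqI by blast
  qed
qed

lemma test_function_DERIV:
  assumes "test_function \<eta>"
  shows "((\<lambda>t. \<eta> (x + t *\<^sub>R axis i 1)) has_real_derivative pderiv_at i \<eta> (x + s *\<^sub>R axis i 1)) (at s)"
proof -
  have "C_k (Suc 0) \<eta>"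
    using assms unfolding test_function_def by blast
  from C_k_Suc_DERIV0[OF this, of "x + s *\<^sub>R axis i 1" i]
  have "((\<lambda>t. \<eta> (x + (s + t) *\<^sub>R axis i 1)) has_real_derivative pderiv_at i \<eta> (x + s *\<^sub>R axis i 1)) (at 0)"
    by (simp add: algebra_simps)
  then show ?thesis
    using DERIV_shift[of "\<lambda>t. \<eta> (x + t *\<^sub>R axis i 1)" _ 0 s] by (simp add: add_ac)
qed

lemma test_function_continuous: "test_function \<eta> \<Longrightarrow> continuous_on UNIV \<eta>"
  unfolding test_function_def using C_k_imp_continuous by blast

lemma test_function_bounded:
  assumes "test_function \<eta>"
  obtains B where "B \<ge> 0" "\<And>x. \<bar>\<eta> x\<bar> \<le> B"
proof -
  define S where "S = closure {x. \<eta> x \<noteq> 0}"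
  have "compact (\<eta> ` S)"
    using assms test_function_continuous[OF assms] unfolding S_def
    by (intro compact_continuous_image) (auto simp: test_function_def intro: continuous_on_subset)
  then obtain B where B: "\<And>x. x \<in> S \<Longrightarrow> \<bar>\<eta> x\<bar> \<le> B"
    using compact_imp_bounded bounded_iff by (metis imageI real_norm_def)
  have "\<bar>\<eta> x\<bar> \<le> max B 0" for x
    using B[of x] closure_subset[of "{x. \<eta> x \<noteq> 0}"] unfolding S_def by (cases "\<eta> x = 0") auto
  then show ?thesis
    using that[of "max B 0"] by auto
qed

section \<open>The smooth bump and approximation by test functions\<close>

text \<open>Carrying an arbitrary polynomial in 1/s makes the family closed under differentiation;
  \<open>flat 1\<close> is the classical smooth function that is 0 on the negative
  half-line.\<close>

definition flat :: "real poly \<Rightarrow> real \<Rightarrow> real" where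
  "flat p s = (if s > 0 then poly p (1 / s) * exp (- (1 / s)) else 0)"

lemma poly_mult_exp_minus_tendsto_0:
  "((\<lambda>y::real. poly p y * exp (- y)) \<longlongrightarrow> 0) at_top"
proof -
  have "((\<lambda>y::real. \<Sum>i\<le>degree p. coeff p i * (y ^ i / exp y)) \<longlongrightarrow> (\<Sum>i\<le>degree p. coeff p i * 0)) at_top"
    by (intro tendsto_intros tendsto_power_div_exp_0)
  then show ?thesis
    by (simp add: poly_altdef sum_distrib_left exp_minus divide_inverse mult_ac)
qed

text \<open>With y = 1/s, both the inner derivative of p(y) and that of exp (- y) bring a factor
  y^2, with opposite signs; hence the polynomial y^2 (p - p'). At 0 the exponential beats every
  polynomial.\<close>

lemma DERIV_flat:
  "(flat p has_real_derivative flat (monom 1 2 * (p - pderiv p)) s) (at s)"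
proof -
  consider "s > 0" | "s < 0" | "s = 0" by linarith
  then show ?thesis
  proof cases
    case 1
    have "((\<lambda>s. poly p (1 / s) * exp (- (1 / s))) has_real_derivative
        flat (monom 1 2 * (p - pderiv p)) s) (at s)"
      using 1 by (auto intro!: derivative_eq_intros DERIV_chain2[OF poly_DERIV]
          simp: flat_def poly_monom field_simps power2_eq_square)
    moreover have "\<forall>\<^sub>F t in nhds s. t > 0"
      using 1 eventually_nhds_in_open[of "{0<..}" s] by auto
    then have "\<forall>\<^sub>F t in nhds s. flat p t = poly p (1 / t) * exp (- (1 / t))"
      by eventually_elim (simp add: flat_def)
    ultimately show ?thesis
      by (subst DERIV_cong_ev[OF refl _ refl])
  next
    case 2
    have "\<forall>\<^sub>F t in nhds s. t < 0"
      using 2 eventually_nhds_in_open[of "{..<0}" s] by auto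
    then have "\<forall>\<^sub>F t in nhds s. flat p t = 0"
      by eventually_elim (simp add: flat_def)
    then show ?thesis
      using 2 by (subst DERIV_cong_ev[OF refl _ refl]) (auto simp: flat_def)
  next
    case 3
    \<comment> \<open>\<open>pCons 0 p\<close> is y p(y): the extra factor y = 1/t is the
      denominator of the difference quotient at 0.\<close>
    have "((\<lambda>t. poly (pCons 0 p) (inverse t) * exp (- inverse t)) \<longlongrightarrow> 0) (at_right 0)"
      using filterlim_compose[OF poly_mult_exp_minus_tendsto_0 filterlim_inverse_at_top_right] .
    moreover have "\<forall>\<^sub>F t in at_right 0. poly (pCons 0 p) (inverse t) * exp (- inverse t) = flat p t / t"
      using eventually_at_right_less[of 0]
      by eventually_elim (simp add: flat_def field_simps)
    ultimately have r: "((\<lambda>t. flat p t / t) \<longlongrightarrow> 0) (at_right 0)"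
      by (rule Lim_transform_eventually)
    have "\<forall>\<^sub>F t in at_left 0. 0 = flat p t / t"
      using eventually_at_left_real[of "-1" "0::real"] by (auto simp: flat_def elim: eventually_mono)
    then have l: "((\<lambda>t. flat p t / t) \<longlongrightarrow> 0) (at_left 0)"
      by (rule Lim_transform_eventually[OF tendsto_const])
    show ?thesis
      using 3 filterlim_split_at[OF l r] by (simp add: has_field_derivative_iff flat_def)
  qed
qed

lemma flat_1_bounds: "0 \<le> flat 1 s" "flat 1 s \<le> 1" "flat 1 s > 0 \<longleftrightarrow> s > 0"
  by (auto simp: flat_def)

lemma C_k_bump: "C_k k (\<lambda>x::real ^ 'n. flat 1 (r - x \<bullet> x))"
proof -
  \<comment> \<open>\<open>P m\<close> is the polynomial belonging to the m-th derivative of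
    \<open>flat 1\<close>.\<close>
  define P where "P m = ((\<lambda>p::real poly. monom 1 2 * (p - pderiv p)) ^^ m) 1" for m
  have F: "(flat (P m) has_real_derivative flat (P (Suc m)) s) (at s)" for m s
    using DERIV_flat[of "P m" s] by (simp add: P_def)
  have "real_polynomial_function (\<lambda>x::real ^ 'n. r - (\<Sum>i\<in>Basis. (x \<bullet> i) * (x \<bullet> i)))"
    by (intro real_polynomial_function_diff real_polynomial_function_sum
        real_polynomial_function.intros bounded_linear_inner_left finite_Basis)
  moreover have "(\<lambda>x::real ^ 'n. r - x \<bullet> x) = (\<lambda>x. r - (\<Sum>i\<in>Basis. (x \<bullet> i) * (x \<bullet> i)))"
    by (intro ext arg_cong[where f = "\<lambda>s. r - s"] euclidean_inner)
  ultimately have q: "C_k k (\<lambda>x::real ^ 'n. r - x \<bullet> x)" for k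
    using C_k_real_polynomial_function by metis
  show ?thesis
    using C_k_compose[where F = "\<lambda>m. flat (P m)" and m = 0, OF F q] by (simp add: P_def)
qed

text \<open>Divide by a bump b, approximate the quotient by a polynomial p, and multiply back. The
  product p b is smooth with compact support, and since b \<le> 1 the error does not grow.\<close>

lemma test_function_approx_continuous:
  fixes G :: "real ^ 'n \<Rightarrow> real"
  assumes G: "continuous_on UNIV G" "\<And>x. G x \<noteq> 0 \<Longrightarrow> norm x \<le> R" and "R \<ge> 0" "e > 0"
  obtains \<eta> where "test_function \<eta>" "\<And>x. \<bar>\<eta> x - G x\<bar> < e" "\<And>x. \<eta> x \<noteq> 0 \<Longrightarrow> norm x \<le> R + 1"
proof -
  define b :: "real ^ 'n \<Rightarrow> real" where "b x = flat 1 ((R + 1)\<^sup>2 - x \<bullet> x)" for x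
  have b: "b x \<ge> 0" "b x \<le> 1" for x
    by (auto simp: b_def flat_1_bounds)
  have bpos: "b x > 0 \<longleftrightarrow> norm x < R + 1" for x
  proof -
    have "(norm x)\<^sup>2 < (R + 1)\<^sup>2 \<longleftrightarrow> norm x < R + 1"
      using \<open>R \<ge> 0\<close> by (auto intro: power2_less_imp_less power_strict_mono)
    then show ?thesis
      using flat_1_bounds(3)[of "(R + 1)\<^sup>2 - x \<bullet> x"] by (simp add: b_def dot_square_norm)
  qed
  have "continuous_on UNIV b"
    using C_k_bump[of 0 "(R + 1)\<^sup>2"] by (simp add: b_def[abs_def])
  then have "continuous_on (ball 0 (R + 1)) (\<lambda>x. G x / b x)"
    using G(1) bpos
    by (intro continuous_on_divide) (force intro: continuous_on_subset[OF _ subset_UNIV])+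
  \<comment> \<open>Here G = 0, so the quotient is 0 even where b vanishes, because division by zero
    gives 0. This region and the open ball where b > 0 cover the closed ball of radius R +
    1.\<close>
  moreover have "continuous_on (- cball 0 R) (\<lambda>x. G x / b x)"
  proof (rule continuous_on_eq[of _ "\<lambda>_. 0"])
    show "0 = G x / b x" if "x \<in> - cball 0 R" for x
      using that G(2)[of x] by (cases "G x = 0") auto
  qed simp
  ultimately have "continuous_on (ball 0 (R + 1) \<union> - cball 0 R) (\<lambda>x. G x / b x)"
    by (intro continuous_on_open_Un) auto
  then have "continuous_on (cball 0 (R + 1)) (\<lambda>x. G x / b x)"
    by (rule continuous_on_subset) auto
  from Stone_Weierstrass_real_polynomial_function[OF compact_cball this \<open>e > 0\<close>]
  obtain p where p: "real_polynomial_function p"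
    "\<And>x. x \<in> cball 0 (R + 1) \<Longrightarrow> \<bar>G x / b x - p x\<bar> < e" by blast
  show ?thesis
  proof (rule that[of "\<lambda>x. p x * b x"])
    show *: "norm x \<le> R + 1" if "p x * b x \<noteq> 0" for x
      using that b[of x] bpos[of x] by auto
    then show "test_function (\<lambda>x. p x * b x)"
      using p(1) by (intro test_functionI[where K = "cball 0 (R + 1)"] C_k_mult)
        (auto simp: b_def[abs_def] C_k_bump C_k_real_polynomial_function)
    show "\<bar>p x * b x - G x\<bar> < e" for x
    proof (cases "norm x < R + 1")
      case True
      have "\<bar>p x * b x - G x\<bar> = b x * \<bar>G x / b x - p x\<bar>"
        using bpos[of x] True b[of x] by (simp add: abs_mult_pos' field_simps abs_minus_commute)
      also have "\<dots> \<le> 1 * \<bar>G x / b x - p x\<bar>"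
        using b by (intro mult_right_mono) auto
      also have "\<dots> < e"
        using p(2)[of x] True by auto
      finally show ?thesis .
    next
      case False
      then have "b x = 0" "G x = 0"
        using b[of x] bpos[of x] G(2)[of x] by auto
      then show ?thesis
        using \<open>e > 0\<close> by simp
    qed
  qed
qed

text \<open>A measurable G is an almost everywhere limit of continuous functions. Truncating these
  at height B and near radius R, then smoothing with error 1/(n+1), keeps a common bound and a
  common support, as dominated convergence will require. Each of the two modifications costs 1 in
  the radius.\<close>

lemma test_function_approx_bounded:
  fixes G :: "real ^ 'n \<Rightarrow> real"
  assumes G[measurable]: "G \<in> borel_measurable lebesgue" and bd: "AE x in lebesgue. \<bar>G x\<bar> \<le> B"
    and supp: "\<And>x. G x \<noteq> 0 \<Longrightarrow> norm x \<le> R" and "B \<ge> 0" "R \<ge> 0"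
  obtains \<eta> :: "nat \<Rightarrow> real ^ 'n \<Rightarrow> real" where "\<And>m. test_function (\<eta> m)" "\<And>m x. \<bar>\<eta> m x\<bar> \<le> B + 1"
    "\<And>m x. \<eta> m x \<noteq> 0 \<Longrightarrow> norm x \<le> R + 2" "AE x in lebesgue. (\<lambda>m. \<eta> m x) \<longlonglongrightarrow> G x"
proof -
  have "G measurable_on UNIV"
    using lebesgue_measurable_imp_measurable_on[of G UNIV] by simp
  then obtain N g where N: "negligible N" and g: "\<And>n. continuous_on UNIV (g n)"
    and lim: "\<And>x. x \<notin> N \<Longrightarrow> (\<lambda>n. g n x) \<longlonglongrightarrow> G x"
    unfolding measurable_on_def by auto
  define c :: "real ^ 'n \<Rightarrow> real" where "c x = max 0 (min 1 (R + 1 - norm x))" for x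
  define h where "h n x = c x * max (- B) (min B (g n x))" for n x
  have h: "continuous_on UNIV (h n)" "\<And>x. h n x \<noteq> 0 \<Longrightarrow> norm x \<le> R + 1" for n
    using g by (auto simp: h_def[abs_def] c_def intro!: continuous_intros split: if_splits)
  have "\<bar>h n x\<bar> \<le> 1 * B" for n x
    unfolding h_def abs_mult using \<open>B \<ge> 0\<close> by (intro mult_mono) (auto simp: c_def)
  then have hB: "\<bar>h n x\<bar> \<le> B" for n x by simp
  have "\<exists>\<eta>. test_function \<eta> \<and> (\<forall>x. \<bar>\<eta> x - h n x\<bar> < inverse (real (Suc n))) \<and> (\<forall>x. \<eta> x \<noteq> 0 \<longrightarrow> norm x \<le> R + 2)" for n
  proof -
    have "R + 1 \<ge> 0" "inverse (real (Suc n)) > 0"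
      using \<open>R \<ge> 0\<close> by simp_all
    from test_function_approx_continuous[OF h(1)[of n] h(2)[of n] this]
    obtain \<eta> where "test_function \<eta>" "\<And>x. \<bar>\<eta> x - h n x\<bar> < inverse (real (Suc n))"
      "\<And>x. \<eta> x \<noteq> 0 \<Longrightarrow> norm x \<le> R + 1 + 1" by blast
    then show ?thesis
      by (intro exI[of _ \<eta>]) (auto simp: add.assoc)
  qed
  then obtain \<eta> where \<eta>: "\<And>n. test_function (\<eta> n)" "\<And>n x. \<bar>\<eta> n x - h n x\<bar> < inverse (real (Suc n))"
    "\<And>n x. \<eta> n x \<noteq> 0 \<Longrightarrow> norm x \<le> R + 2" by metis
  show ?thesis
  proof (rule that[of \<eta>])
    show "\<bar>\<eta> n x\<bar> \<le> B + 1" for n x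
    proof -
      have "inverse (real (Suc n)) \<le> 1"
        by (simp add: inverse_eq_divide)
      then show ?thesis
        using \<eta>(2)[of n x] hB[of n x] by linarith
    qed
    have "AE x in lebesgue. x \<notin> N"
      using N by (auto simp: negligible_iff_null_sets intro: AE_not_in)
    with bd show "AE x in lebesgue. (\<lambda>m. \<eta> m x) \<longlonglongrightarrow> G x"
    proof eventually_elim
      case (elim x)
      have "(\<lambda>n. h n x) \<longlonglongrightarrow> c x * max (- B) (min B (G x))"
        unfolding h_def using lim[of x] elim by (intro tendsto_intros) auto
      moreover have "c x * max (- B) (min B (G x)) = G x"
      proof (cases "G x = 0")
        case False
        then have "c x = 1" using supp[of x] by (auto simp: c_def)
        then show ?thesis using elim by auto
      qed (use \<open>B \<ge> 0\<close> in auto)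
      moreover have "(\<lambda>n. \<eta> n x - h n x) \<longlonglongrightarrow> 0"
        using \<eta>(2)[of _ x] by (intro Lim_null_comparison[OF _ LIMSEQ_inverse_real_of_nat])
          (auto intro!: always_eventually less_imp_le simp del: of_nat_Suc)
      ultimately show ?case
        using tendsto_add[of "\<lambda>n. \<eta> n x - h n x" 0 sequentially "\<lambda>n. h n x"] by simp
    qed
  qed (use \<eta> in auto)
qed

subsection \<open>Second difference quotients and weak derivatives\<close>

lemma lebesgue_distr_shift:
  fixes a :: "'a::euclidean_space"
  shows "distr lebesgue lebesgue (\<lambda>x. x + a) = lebesgue"
    and lebesgue_measurable_shift: "(\<lambda>x. x + a) \<in> lebesgue \<rightarrow>\<^sub>M lebesgue"
  using lebesgue_affine_euclidean[of "\<lambda>_. 1" a] lebesgue_affine_measurable[of "\<lambda>_. 1" a]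
  by (simp_all add: euclidean_representation density_1 add.commute flip: one_ennreal_def)

lemma borel_measurable_lebesgue_shift:
  fixes a :: "'a::euclidean_space"
  shows "f \<in> borel_measurable lebesgue \<Longrightarrow> (\<lambda>x. f (x + a)) \<in> borel_measurable lebesgue"
  using measurable_compose[OF lebesgue_measurable_shift] .

lemma
  fixes f :: "'a::euclidean_space \<Rightarrow> real"
  assumes "f \<in> borel_measurable lebesgue"
  shows integrable_lebesgue_shift: "integrable lebesgue (\<lambda>x. f (x + a)) \<longleftrightarrow> integrable lebesgue f"
    and integral_lebesgue_shift: "(LINT x|lebesgue. f (x + a)) = (LINT x|lebesgue. f x)"
  using integrable_distr_eq[OF lebesgue_measurable_shift assms, of a]
    integral_distr[OF lebesgue_measurable_shift assms, of a]
  by (simp_all add: lebesgue_distr_shift)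

lemma L2_real_iff:
  fixes u :: "'a::euclidean_space \<Rightarrow> real"
  shows "u \<in> L2 \<longleftrightarrow> u \<in> borel_measurable lebesgue \<and> integrable lebesgue (\<lambda>x. (u x)\<^sup>2)"
  by (simp add: L2_def)

lemma L2_shift:
  fixes u :: "'a::euclidean_space \<Rightarrow> real"
  shows "u \<in> L2 \<Longrightarrow> (\<lambda>x. u (x + a)) \<in> L2"
  using integrable_lebesgue_shift[of "\<lambda>x. (u x)\<^sup>2" a]
  by (auto simp: L2_real_iff borel_measurable_lebesgue_shift)

text \<open>Young's inequality. The free weight c does the work of Cauchy-Schwarz: a large c makes
  the share of b negligible, after which a can be chosen small.\<close>

lemma mult_le_weighted_squares:
  fixes a b :: real
  assumes "c > 0"
  shows "\<bar>a * b\<bar> \<le> (c * a\<^sup>2 + b\<^sup>2 / c) / 2"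
proof -
  have "0 \<le> (c * \<bar>a\<bar> - \<bar>b\<bar>)\<^sup>2 / c"
    using assms by simp
  also have "\<dots> = c * a\<^sup>2 - 2 * \<bar>a * b\<bar> + b\<^sup>2 / c"
    using assms by (simp add: power2_diff power_mult_distrib abs_mult field_simps power2_eq_square)
  finally show ?thesis by simp
qed

lemma
  fixes f g :: "'a::euclidean_space \<Rightarrow> real"
  assumes "f \<in> L2" "g \<in> L2"
  shows integrable_L2_mult: "integrable lebesgue (\<lambda>x. f x * g x)"
    and integral_L2_mult_le: "c > 0 \<Longrightarrow> \<bar>LINT x|lebesgue. f x * g x\<bar> \<le>
      (c * (LINT x|lebesgue. (f x)\<^sup>2) + (LINT x|lebesgue. (g x)\<^sup>2) / c) / 2"
proof -
  have [measurable]: "f \<in> borel_measurable lebesgue" "g \<in> borel_measurable lebesgue"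
    and i: "integrable lebesgue (\<lambda>x. (f x)\<^sup>2)" "integrable lebesgue (\<lambda>x. (g x)\<^sup>2)"
    using assms by (auto simp: L2_real_iff)
  have b: "\<bar>f x * g x\<bar> \<le> ((f x)\<^sup>2 + (g x)\<^sup>2) / 2" for x
    using mult_le_weighted_squares[of 1 "f x" "g x"] by simp
  show I: "integrable lebesgue (\<lambda>x. f x * g x)"
    by (rule Bochner_Integration.integrable_bound[where f = "\<lambda>x. ((f x)\<^sup>2 + (g x)\<^sup>2) / 2"])
      (use i b in \<open>auto intro!: always_eventually\<close>)
  assume "c > 0"
  have "\<bar>LINT x|lebesgue. f x * g x\<bar> \<le> (LINT x|lebesgue. \<bar>f x * g x\<bar>)"
    by (rule integral_abs_bound)
  also have "\<dots> \<le> (LINT x|lebesgue. (c * (f x)\<^sup>2 + (g x)\<^sup>2 / c) / 2)"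
    using i I mult_le_weighted_squares[OF \<open>c > 0\<close>] by (intro integral_mono) auto
  also have "\<dots> = (c * (LINT x|lebesgue. (f x)\<^sup>2) + (LINT x|lebesgue. (g x)\<^sup>2) / c) / 2"
    using i by simp
  finally show "\<bar>LINT x|lebesgue. f x * g x\<bar> \<le> \<dots>" .
qed

lemma L2_bounded_support:
  fixes f :: "'a::euclidean_space \<Rightarrow> real"
  assumes [measurable]: "f \<in> borel_measurable lebesgue" and "AE x in lebesgue. \<bar>f x\<bar> \<le> B"
    and "\<And>x. f x \<noteq> 0 \<Longrightarrow> norm x \<le> R"
  shows "f \<in> L2"
proof -
  have "integrable lebesgue (\<lambda>x. indicator (cball 0 R) x * B\<^sup>2)"
    by (intro integrable_mult_left lmeasurable_iff_integrable[THEN iffD1] lmeasurable_cball)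
  then have "integrable lebesgue (\<lambda>x. (f x)\<^sup>2)"
  proof (rule Bochner_Integration.integrable_bound)
    show "AE x in lebesgue. norm ((f x)\<^sup>2) \<le> norm (indicator (cball 0 R) x * B\<^sup>2)"
      using assms(2)
    proof eventually_elim
      case (elim x)
      then have "(f x)\<^sup>2 \<le> B\<^sup>2"
        by (metis abs_ge_zero power2_abs power_mono)
      then show ?case
        using assms(3)[of x] by (cases "f x = 0") (auto simp: indicator_def)
    qed
  qed auto
  then show ?thesis by (simp add: L2_real_iff)
qed

lemma L2_indicator_cball: "(indicator (cball a R) :: 'a::euclidean_space \<Rightarrow> real) \<in> L2"
  by (rule L2_bounded_support[where B = 1 and R = "norm a + R"])
    (auto simp: indicator_def dist_norm norm_minus_commute split: if_splits
      intro!: borel_measurable_indicator fmeasurableD norm_triangle_sub[where y = a, THEN order_trans])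

lemma test_function_measurable: "test_function \<eta> \<Longrightarrow> \<eta> \<in> borel_measurable lebesgue"
  by (intro measurable_completion) (simp add: borel_measurable_continuous_onI test_function_continuous)

lemma test_function_support:
  assumes "test_function \<eta>"
  obtains R where "R \<ge> 0" "\<And>x. \<eta> x \<noteq> 0 \<Longrightarrow> norm x \<le> R"
proof -
  have "bounded (closure {x. \<eta> x \<noteq> 0})"
    using assms compact_imp_bounded by (auto simp: test_function_def)
  then obtain R where R: "\<And>x. x \<in> closure {x. \<eta> x \<noteq> 0} \<Longrightarrow> norm x \<le> R"
    by (auto simp: bounded_iff)
  show ?thesis
  proof (rule that[of "max R 0"])
    show "norm x \<le> max R 0" if "\<eta> x \<noteq> 0" for x
      using R[of x] subsetD[OF closure_subset[of "{x. \<eta> x \<noteq> 0}"], of x] that by auto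
  qed simp
qed

lemma test_function_L2: "test_function \<eta> \<Longrightarrow> \<eta> \<in> L2"
  by (metis AE_I2 L2_bounded_support test_function_bounded test_function_measurable
      test_function_support)

text \<open>The translation sits on \<eta>, so u need only be square-integrable. Difference
  quotients of \<eta> are bounded by the supremum of its partial derivative and live on a fixed
  ball, where u is integrable; dominated convergence applies.\<close>

lemma DERIV_integral_test_function_shift:
  fixes u :: "real ^ 'n \<Rightarrow> real"
  assumes \<eta>: "test_function \<eta>" and u: "u \<in> L2"
  shows "((\<lambda>s. LINT x|lebesgue. \<eta> (x + s *\<^sub>R axis i 1) * u x) has_real_derivative
    (LINT x|lebesgue. pderiv_at i \<eta> (x + s *\<^sub>R axis i 1) * u x)) (at s)"
proof -
  let ?e = "axis i 1 :: real ^ 'n"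
  let ?F = "\<lambda>s. LINT x|lebesgue. \<eta> (x + s *\<^sub>R ?e) * u x"
  have [measurable]: "u \<in> borel_measurable lebesgue"
    using u by (simp add: L2_real_iff)
  have \<eta>s: "test_function (\<lambda>x. \<eta> (x + s *\<^sub>R ?e))" for s
    by (rule test_function_shift[OF \<eta>])
  have [measurable]: "(\<lambda>x. \<eta> (x + s *\<^sub>R ?e)) \<in> borel_measurable lebesgue"
    "(\<lambda>x. pderiv_at i \<eta> (x + s *\<^sub>R ?e)) \<in> borel_measurable lebesgue" for s
    by (intro test_function_measurable test_function_shift test_function_pderiv_at \<eta>)+
  obtain R where R: "R \<ge> 0" "\<And>x. \<eta> x \<noteq> 0 \<Longrightarrow> norm x \<le> R"
    using test_function_support[OF \<eta>] by blast
  obtain B where B: "B \<ge> 0" "\<And>x. \<bar>pderiv_at i \<eta> x\<bar> \<le> B"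
    using test_function_bounded[OF test_function_pderiv_at[OF \<eta>]] by blast
  have lip: "\<bar>\<eta> (x + t *\<^sub>R ?e) - \<eta> (x + s *\<^sub>R ?e)\<bar> \<le> B * \<bar>t - s\<bar>" for x t s
    using field_differentiable_bound[where S = UNIV and f = "\<lambda>t. \<eta> (x + t *\<^sub>R ?e)"
        and f' = "\<lambda>t. pderiv_at i \<eta> (x + t *\<^sub>R ?e)" and B = B and x = t and y = s]
      test_function_DERIV[OF \<eta>] B by auto
  show ?thesis
    unfolding DERIV_def tendsto_at_iff_sequentially
  proof (intro allI impI)
    fix X :: "nat \<Rightarrow> real"
    assume X0: "\<forall>n. X n \<in> UNIV - {0}" and X: "X \<longlonglongrightarrow> 0"
    obtain M where M: "\<And>n. \<bar>X n\<bar> \<le> M"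
      using convergent_imp_Bseq[of X] X by (auto simp: Bseq_def convergent_def)
    \<comment> \<open>R covers the support of \<eta>, \<bar>s\<bar> the base translation and M all
      increments \<open>X n\<close>. Outside this ball both translated points miss the
      support.\<close>
    define C where "C = cball (0 :: real ^ 'n) (R + \<bar>s\<bar> + M)"
    let ?q = "\<lambda>n x. (\<eta> (x + (s + X n) *\<^sub>R ?e) - \<eta> (x + s *\<^sub>R ?e)) / X n * u x"
    have "(\<lambda>n. LINT x|lebesgue. ?q n x) \<longlonglongrightarrow> (LINT x|lebesgue. pderiv_at i \<eta> (x + s *\<^sub>R ?e) * u x)"
    proof (rule integral_dominated_convergence[where w = "\<lambda>x. B * \<bar>indicator C x * u x\<bar>"])
      show "integrable lebesgue (\<lambda>x. B * \<bar>indicator C x * u x\<bar>)"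
        unfolding C_def by (intro integrable_mult_right integrable_abs integrable_L2_mult L2_indicator_cball u)
      show "AE x in lebesgue. (\<lambda>n. ?q n x) \<longlonglongrightarrow> pderiv_at i \<eta> (x + s *\<^sub>R ?e) * u x"
      proof (intro always_eventually allI tendsto_intros)
        fix x
        have "((\<lambda>r. (\<eta> (x + (s + r) *\<^sub>R ?e) - \<eta> (x + s *\<^sub>R ?e)) / r) \<longlongrightarrow>
            pderiv_at i \<eta> (x + s *\<^sub>R ?e)) (at 0)"
          using test_function_DERIV[OF \<eta>, of x i s] unfolding DERIV_def .
        then show "(\<lambda>n. (\<eta> (x + (s + X n) *\<^sub>R ?e) - \<eta> (x + s *\<^sub>R ?e)) / X n) \<longlonglongrightarrow>
            pderiv_at i \<eta> (x + s *\<^sub>R ?e)"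
          using X0 X unfolding tendsto_at_iff_sequentially by (auto simp: o_def)
      qed
      show "AE x in lebesgue. norm (?q n x) \<le> B * \<bar>indicator C x * u x\<bar>" for n
      proof (intro always_eventually allI)
        fix x
        have q: "\<bar>(\<eta> (x + (s + X n) *\<^sub>R ?e) - \<eta> (x + s *\<^sub>R ?e)) / X n\<bar> \<le> B * indicator C x"
        proof (cases "x \<in> C")
          case True
          then show ?thesis
            using lip[of x "s + X n" s] X0 by (simp add: pos_divide_le_eq)
        next
          case False
          have "norm x > R + \<bar>s\<bar> + M"
            using False by (simp add: C_def)
          moreover have "norm x \<le> norm (x + t *\<^sub>R ?e) + \<bar>t\<bar>" for t
            using norm_triangle_ineq4[of "x + t *\<^sub>R ?e" "t *\<^sub>R ?e"] by simp
          from this[of s] this[of "s + X n"]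
          have "norm x \<le> norm (x + s *\<^sub>R ?e) + \<bar>s\<bar>"
            "norm x \<le> norm (x + (s + X n) *\<^sub>R ?e) + \<bar>s\<bar> + M"
            using M[of n] by linarith+
          ultimately have "\<not> norm (x + s *\<^sub>R ?e) \<le> R" "\<not> norm (x + (s + X n) *\<^sub>R ?e) \<le> R"
            using M[of n] by linarith+
          then show ?thesis
            using R(2) False by (metis abs_zero diff_self div_0 indicator_simps(2) mult_zero_right order_refl)
        qed
        have "norm (?q n x) \<le> (B * indicator C x) * \<bar>u x\<bar>"
          unfolding real_norm_def abs_mult[of _ "u x"] by (intro mult_right_mono q) auto
        then show "norm (?q n x) \<le> B * \<bar>indicator C x * u x\<bar>"
          by (simp add: abs_mult mult.assoc)
      qed
    qed measurable
    moreover have "(LINT x|lebesgue. ?q n x) = (?F (s + X n) - ?F s) / X n" for n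
    proof -
      have "(LINT x|lebesgue. ?q n x) =
          (LINT x|lebesgue. (\<eta> (x + (s + X n) *\<^sub>R ?e) * u x - \<eta> (x + s *\<^sub>R ?e) * u x) / X n)"
        by (simp add: algebra_simps diff_divide_distrib)
      also have "\<dots> = (?F (s + X n) - ?F s) / X n"
        using integrable_L2_mult[OF test_function_L2[OF \<eta>s] u] by simp
      finally show ?thesis .
    qed
    ultimately show "((\<lambda>h. (?F (s + h) - ?F s) / h) \<circ> X) \<longlonglongrightarrow>
        (LINT x|lebesgue. pderiv_at i \<eta> (x + s *\<^sub>R ?e) * u x)"
      by (simp only: o_def)
  qed
qed

section \<open>Weak convergence of second difference quotients\<close>

definition second_diff :: "'a::euclidean_space \<Rightarrow> ('a \<Rightarrow> real) \<Rightarrow> 'a \<Rightarrow> real" where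
  "second_diff d u x = u (x + d) - 2 * u x + u (x - d)"

lemma second_diff_L2:
  assumes "u \<in> L2"
  shows "second_diff d u \<in> L2"
proof -
  have "(\<lambda>x. u (x + d)) \<in> L2" "(\<lambda>x. u (x - d)) \<in> L2"
    using L2_shift[OF assms, of d] L2_shift[OF assms, of "- d"] by simp_all
  then have [measurable]: "u \<in> borel_measurable lebesgue" "(\<lambda>x. u (x + d)) \<in> borel_measurable lebesgue"
      "(\<lambda>x. u (x - d)) \<in> borel_measurable lebesgue"
    and i: "integrable lebesgue (\<lambda>x. (u x)\<^sup>2)" "integrable lebesgue (\<lambda>x. (u (x + d))\<^sup>2)"
      "integrable lebesgue (\<lambda>x. (u (x - d))\<^sup>2)"
    using assms by (simp_all add: L2_real_iff)
  \<comment> \<open>This is (p + q + r)^2 \<le> 3 (p^2 + q^2 + r^2) with p = a, q = -2b, r = c; the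
    three squares supplied are the pairwise differences.\<close>
  have b: "(a - 2 * b + c)\<^sup>2 \<le> 3 * a\<^sup>2 + 12 * b\<^sup>2 + 3 * c\<^sup>2" for a b c :: real
    using zero_le_power2[of "a + 2 * b"] zero_le_power2[of "a - c"] zero_le_power2[of "2 * b + c"]
    by (simp add: power2_eq_square algebra_simps)
  have "integrable lebesgue (\<lambda>x. (u (x + d) - 2 * u x + u (x - d))\<^sup>2)"
    by (rule Bochner_Integration.integrable_bound
        [where f = "\<lambda>x. 3 * (u (x + d))\<^sup>2 + 12 * (u x)\<^sup>2 + 3 * (u (x - d))\<^sup>2"])
      (use i b in \<open>auto intro!: always_eventually\<close>)
  then show ?thesis
    by (simp add: L2_real_iff second_diff_def[abs_def])
qed

text \<open>The identity after both integrations by parts, so that no first weak derivative of u has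
  to be carried along.\<close>

definition has_weak_pderiv2 :: "(real ^ 'n \<Rightarrow> real) \<Rightarrow> 'n \<Rightarrow> (real ^ 'n \<Rightarrow> real) \<Rightarrow> bool" where
  "has_weak_pderiv2 u i h \<longleftrightarrow> (\<forall>\<eta>. test_function \<eta> \<longrightarrow>
     (LINT x|lebesgue. pderiv_at i (pderiv_at i \<eta>) x * u x) = (LINT x|lebesgue. \<eta> x * h x))"

text \<open>Lagrange's form of Taylor's formula, once for F and once for its reflection; the
  first-order terms cancel in the sum. Keeping two intermediate points avoids any intermediate value
  argument for F''.\<close>

lemma taylor_second_diff:
  fixes F F' F'' :: "real \<Rightarrow> real"
  assumes F: "\<And>s. (F has_real_derivative F' s) (at s)" "\<And>s. (F' has_real_derivative F'' s) (at s)"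
    and "t > 0"
  obtains \<xi> \<zeta> where "\<bar>\<xi>\<bar> \<le> t" "\<bar>\<zeta>\<bar> \<le> t" "F t - 2 * F 0 + F (- t) = t\<^sup>2 * ((F'' \<xi> + F'' \<zeta>) / 2)"
proof -
  have T: "\<exists>\<xi>. \<bar>\<xi>\<bar> \<le> t \<and> G t = G 0 + G' 0 * t + G'' \<xi> / 2 * t\<^sup>2"
    if "\<And>s. (G has_real_derivative G' s) (at s)" "\<And>s. (G' has_real_derivative G'' s) (at s)"
    for G G' G'' :: "real \<Rightarrow> real"
  proof -
    define diff where "diff m = (if m = 0 then G else if m = 1 then G' else G'')" for m :: nat
    have "\<exists>s. 0 < s \<and> s \<le> t \<and> G t = (\<Sum>m<2. diff m 0 / fact m * t ^ m) + diff 2 s / fact 2 * t ^ 2"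
      by (rule Maclaurin2[OF \<open>t > 0\<close>]) (use that in \<open>auto simp: diff_def less_2_cases_iff\<close>)
    then obtain s where "0 < s" "s \<le> t"
      "G t = (\<Sum>m<2. diff m 0 / fact m * t ^ m) + diff 2 s / fact 2 * t ^ 2" by blast
    then show ?thesis
      by (intro exI[of _ s]) (auto simp: diff_def numeral_2_eq_2)
  qed
  obtain \<xi> where \<xi>: "\<bar>\<xi>\<bar> \<le> t" "F t = F 0 + F' 0 * t + F'' \<xi> / 2 * t\<^sup>2"
    using T[OF F] by blast
  have "((\<lambda>s. F (- s)) has_real_derivative - F' (- s)) (at s)"
    "((\<lambda>s. - F' (- s)) has_real_derivative F'' (- s)) (at s)" for s
  proof -
    have m: "(uminus has_real_derivative - 1) (at s)"
      by (auto intro!: derivative_eq_intros)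
    show "((\<lambda>s. F (- s)) has_real_derivative - F' (- s)) (at s)"
      "((\<lambda>s. - F' (- s)) has_real_derivative F'' (- s)) (at s)"
      using DERIV_chain2[OF F(1) m] DERIV_minus[OF DERIV_chain2[OF F(2) m]] by simp_all
  qed
  from T[OF this] obtain \<zeta> where \<zeta>: "\<bar>\<zeta>\<bar> \<le> t" "F (- t) = F 0 - F' 0 * t + F'' (- \<zeta>) / 2 * t\<^sup>2"
    by auto
  show ?thesis
    by (rule that[of \<xi> "- \<zeta>"]) (use \<xi> \<zeta> in \<open>auto simp: algebra_simps\<close>)
qed

text \<open>Let F(s) be the integral of \<eta>(x + s e) u(x). Translation invariance turns the left
  side into the second difference of F over t^2. Translates of test functions are test functions, so
  F'' is the pairing of the translated \<eta> with h, and Taylor's formula gives the mean of two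
  such values.\<close>

lemma weak_second_diff:
  fixes u h :: "real ^ 'n \<Rightarrow> real"
  assumes u: "u \<in> L2" and h: "has_weak_pderiv2 u i h" and \<eta>: "test_function \<eta>" and "t > 0"
  obtains \<xi> \<zeta> where "\<bar>\<xi>\<bar> \<le> t" "\<bar>\<zeta>\<bar> \<le> t"
    "(LINT x|lebesgue. \<eta> x * (second_diff (t *\<^sub>R axis i 1) u x / t\<^sup>2)) =
      ((LINT x|lebesgue. \<eta> (x + \<xi> *\<^sub>R axis i 1) * h x) + (LINT x|lebesgue. \<eta> (x + \<zeta> *\<^sub>R axis i 1) * h x)) / 2"
proof -
  let ?e = "axis i 1 :: real ^ 'n"
  let ?F = "\<lambda>\<eta> s. LINT x|lebesgue. \<eta> (x + s *\<^sub>R ?e) * u x"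
  have [measurable]: "u \<in> borel_measurable lebesgue" "\<eta> \<in> borel_measurable lebesgue"
    using u test_function_measurable[OF \<eta>] by (simp_all add: L2_real_iff)
  have shift: "?F \<eta> s = (LINT x|lebesgue. \<eta> x * u (x - s *\<^sub>R ?e))" for s
  proof -
    have "(\<lambda>x. \<eta> (x + s *\<^sub>R ?e) * u x) \<in> borel_measurable lebesgue"
      using borel_measurable_lebesgue_shift[of \<eta>] by simp
    from integral_lebesgue_shift[OF this, of "- s *\<^sub>R ?e"] show ?thesis by simp
  qed
  have F'': "?F (pderiv_at i (pderiv_at i \<eta>)) s = (LINT x|lebesgue. \<eta> (x + s *\<^sub>R ?e) * h x)" for s
    using h test_function_shift[OF \<eta>, of "s *\<^sub>R ?e"] by (auto simp: has_weak_pderiv2_def pderiv_at_shift)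
  obtain \<xi> \<zeta> where \<xi>: "\<bar>\<xi>\<bar> \<le> t" "\<bar>\<zeta>\<bar> \<le> t" and
    eq: "?F \<eta> t - 2 * ?F \<eta> 0 + ?F \<eta> (- t) =
      t\<^sup>2 * ((?F (pderiv_at i (pderiv_at i \<eta>)) \<xi> + ?F (pderiv_at i (pderiv_at i \<eta>)) \<zeta>) / 2)"
    by (rule taylor_second_diff[OF DERIV_integral_test_function_shift[OF \<eta> u]
          DERIV_integral_test_function_shift[OF test_function_pderiv_at[OF \<eta>] u] \<open>t > 0\<close>])
  have i: "integrable lebesgue (\<lambda>x. \<eta> x * u (x + a))" for a
    by (intro integrable_L2_mult test_function_L2 \<eta> L2_shift u)
  have "(LINT x|lebesgue. \<eta> x * (second_diff (t *\<^sub>R ?e) u x / t\<^sup>2)) =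
      (LINT x|lebesgue. (\<eta> x * u (x + t *\<^sub>R ?e) - 2 * (\<eta> x * u (x + 0)) + \<eta> x * u (x + - (t *\<^sub>R ?e))) / t\<^sup>2)"
    by (simp add: second_diff_def algebra_simps)
  also have "\<dots> = ((LINT x|lebesgue. \<eta> x * u (x + t *\<^sub>R ?e)) - 2 * (LINT x|lebesgue. \<eta> x * u (x + 0))
      + (LINT x|lebesgue. \<eta> x * u (x + - (t *\<^sub>R ?e)))) / t\<^sup>2"
    using i[of 0] i[of "t *\<^sub>R ?e"] i[of "- (t *\<^sub>R ?e)"] by simp
  also have "\<dots> = (?F \<eta> t - 2 * ?F \<eta> 0 + ?F \<eta> (- t)) / t\<^sup>2"
    unfolding shift by simp
  also have "\<dots> = ((LINT x|lebesgue. \<eta> (x + \<xi> *\<^sub>R ?e) * h x) + (LINT x|lebesgue. \<eta> (x + \<zeta> *\<^sub>R ?e) * h x)) / 2"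
    unfolding eq F'' using \<open>t > 0\<close> by simp
  finally show ?thesis
    using that \<xi> by blast
qed

text \<open>The bound is independent of t because translation preserves the L2 norm of \<eta>. This
  uniformity lets the convergence pass from test functions to their limits.\<close>

lemma weak_second_diff_bound:
  fixes u h :: "real ^ 'n \<Rightarrow> real"
  assumes u: "u \<in> L2" "h \<in> L2" and h: "has_weak_pderiv2 u i h" and \<eta>: "test_function \<eta>" and "t > 0" "c > 0"
  shows "\<bar>LINT x|lebesgue. \<eta> x * (second_diff (t *\<^sub>R axis i 1) u x / t\<^sup>2)\<bar> \<le>
    (c * (LINT x|lebesgue. (\<eta> x)\<^sup>2) + (LINT x|lebesgue. (h x)\<^sup>2) / c) / 2"
proof -
  let ?b = "(c * (LINT x|lebesgue. (\<eta> x)\<^sup>2) + (LINT x|lebesgue. (h x)\<^sup>2) / c) / 2"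
  have b: "\<bar>LINT x|lebesgue. \<eta> (x + a) * h x\<bar> \<le> ?b" for a
    using integral_L2_mult_le[OF L2_shift[OF test_function_L2[OF \<eta>], of a] u(2) \<open>c > 0\<close>]
      integral_lebesgue_shift[of "\<lambda>x. (\<eta> x)\<^sup>2" a] test_function_measurable[OF \<eta>]
    by simp
  have mid: "\<bar>(p + q) / 2\<bar> \<le> r" if "\<bar>p\<bar> \<le> r" "\<bar>q\<bar> \<le> r" for p q r :: real
    using that by (auto simp: abs_le_iff)
  obtain \<xi> \<zeta> where
    "(LINT x|lebesgue. \<eta> x * (second_diff (t *\<^sub>R axis i 1) u x / t\<^sup>2)) =
      ((LINT x|lebesgue. \<eta> (x + \<xi> *\<^sub>R axis i 1) * h x) + (LINT x|lebesgue. \<eta> (x + \<zeta> *\<^sub>R axis i 1) * h x)) / 2"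
    using weak_second_diff[OF u(1) h \<eta> \<open>t > 0\<close>] by blast
  then show ?thesis
    by (simp only: mid[OF b b])
qed

text \<open>Both intermediate points are at most t in size, and the pairing of a translated \<eta>
  with h is continuous in the translation.\<close>

lemma weak_second_diff_tendsto_test:
  fixes u h :: "real ^ 'n \<Rightarrow> real"
  assumes u: "u \<in> L2" "h \<in> L2" and h: "has_weak_pderiv2 u i h" and \<eta>: "test_function \<eta>"
  shows "((\<lambda>t. LINT x|lebesgue. \<eta> x * (second_diff (t *\<^sub>R axis i 1) u x / t\<^sup>2)) \<longlongrightarrow>
    (LINT x|lebesgue. \<eta> x * h x)) (at_right 0)"
proof (rule tendstoI)
  fix e :: real assume "e > 0"
  let ?F = "\<lambda>s. LINT x|lebesgue. \<eta> (x + s *\<^sub>R axis i 1) * h x"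
  have "isCont ?F 0"
    using DERIV_integral_test_function_shift[OF \<eta> u(2)] by (rule DERIV_isCont)
  then obtain d where d: "d > 0" "\<And>s. dist s 0 < d \<Longrightarrow> dist (?F s) (?F 0) < e"
    unfolding continuous_at_eps_delta using \<open>e > 0\<close> by blast
  have "\<forall>\<^sub>F t in at_right 0. 0 < t \<and> t < d"
    using d(1) eventually_at_right_real[of 0 d] by (auto elim: eventually_mono)
  then show "\<forall>\<^sub>F t in at_right 0. dist (LINT x|lebesgue. \<eta> x * (second_diff (t *\<^sub>R axis i 1) u x / t\<^sup>2))
      (LINT x|lebesgue. \<eta> x * h x) < e"
  proof eventually_elim
    case (elim t)
    then obtain \<xi> \<zeta> where "\<bar>\<xi>\<bar> \<le> t" "\<bar>\<zeta>\<bar> \<le> t"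
      "(LINT x|lebesgue. \<eta> x * (second_diff (t *\<^sub>R axis i 1) u x / t\<^sup>2)) = (?F \<xi> + ?F \<zeta>) / 2"
      using weak_second_diff[OF u(1) h \<eta>, of t] by blast
    moreover from this have "\<bar>?F \<xi> - ?F 0\<bar> < e" "\<bar>?F \<zeta> - ?F 0\<bar> < e"
      using d(2)[of \<xi>] d(2)[of \<zeta>] elim by (simp_all add: dist_real_def)
    ultimately show ?case
      by (simp add: dist_real_def field_simps)
  qed
qed

lemma integral_tendsto_bounded_support:
  fixes w :: "'a::euclidean_space \<Rightarrow> real"
  assumes [measurable]: "\<And>m. g m \<in> borel_measurable lebesgue" "G \<in> borel_measurable lebesgue"
    "w \<in> borel_measurable lebesgue"
    and b: "\<And>m x. \<bar>g m x\<bar> \<le> B" "\<And>m x. g m x \<noteq> 0 \<Longrightarrow> norm x \<le> R"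
    and lim: "AE x in lebesgue. (\<lambda>m. g m x) \<longlonglongrightarrow> G x"
    and w: "set_integrable lebesgue (cball 0 R) w"
  shows "(\<lambda>m. LINT x|lebesgue. g m x * w x) \<longlonglongrightarrow> (LINT x|lebesgue. G x * w x)"
proof (rule integral_dominated_convergence[where w = "\<lambda>x. B * \<bar>indicator (cball 0 R) x * w x\<bar>"])
  show "integrable lebesgue (\<lambda>x. B * \<bar>indicator (cball 0 R) x * w x\<bar>)"
    using w by (intro integrable_mult_right integrable_abs) (simp add: set_integrable_def)
  show "AE x in lebesgue. (\<lambda>m. g m x * w x) \<longlonglongrightarrow> G x * w x"
    using lim by eventually_elim (intro tendsto_intros)
  show "AE x in lebesgue. norm (g m x * w x) \<le> B * \<bar>indicator (cball 0 R) x * w x\<bar>" for m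
  proof (intro always_eventually allI)
    fix x
    show "norm (g m x * w x) \<le> B * \<bar>indicator (cball 0 R) x * w x\<bar>"
      using b(1)[of m x] b(2)[of m x]
      by (cases "g m x = 0") (auto simp: abs_mult intro!: mult_right_mono
        mult_nonneg_nonneg order_trans[OF abs_ge_zero])
  qed
qed measurable

text \<open>A three-term estimate: replace G by a test function \<eta>_m close to it in L2, in the
  pairing with h and in that with the difference quotient, and use the convergence for \<eta>_m. The
  second replacement must be uniform in t.\<close>

lemma weak_second_diff_tendsto:
  fixes u h G :: "real ^ 'n \<Rightarrow> real"
  assumes u: "u \<in> L2" "h \<in> L2" and h: "has_weak_pderiv2 u i h"
    and G[measurable]: "G \<in> borel_measurable lebesgue" and bd: "AE x in lebesgue. \<bar>G x\<bar> \<le> B"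
    and supp: "\<And>x. G x \<noteq> 0 \<Longrightarrow> norm x \<le> R" and BR: "B \<ge> 0" "R \<ge> 0"
  shows "((\<lambda>t. LINT x|lebesgue. G x * (second_diff (t *\<^sub>R axis i 1) u x / t\<^sup>2)) \<longlongrightarrow>
    (LINT x|lebesgue. G x * h x)) (at_right 0)"
proof (rule tendstoI)
  fix e' :: real assume "e' > 0"
  define e where "e = e' / 3"
  have "e > 0" using \<open>e' > 0\<close> by (simp add: e_def)
  let ?D = "\<lambda>t x. second_diff (t *\<^sub>R axis i 1) u x / t\<^sup>2"
  have [measurable]: "h \<in> borel_measurable lebesgue"
    using u by (simp add: L2_real_iff)
  have D: "?D t \<in> L2" for t
  proof -
    have "second_diff (t *\<^sub>R axis i 1) u \<in> L2" by (rule second_diff_L2[OF u(1)])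
    then show ?thesis by (auto simp: L2_real_iff power_divide)
  qed
  then have [measurable]: "?D t \<in> borel_measurable lebesgue" for t
    by (simp add: L2_real_iff)
  have GL2: "G \<in> L2"
    using L2_bounded_support[OF G bd supp] .
  obtain \<eta> :: "nat \<Rightarrow> real ^ 'n \<Rightarrow> real" where \<eta>: "\<And>m. test_function (\<eta> m)" "\<And>m x. \<bar>\<eta> m x\<bar> \<le> B + 1"
    "\<And>m x. \<eta> m x \<noteq> 0 \<Longrightarrow> norm x \<le> R + 2" and lim: "AE x in lebesgue. (\<lambda>m. \<eta> m x) \<longlonglongrightarrow> G x"
    by (rule test_function_approx_bounded[OF G bd _ BR]) (rule supp that, assumption+)+
  have [measurable]: "\<eta> m \<in> borel_measurable lebesgue" for m
    using \<eta>(1) by (rule test_function_measurable)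
  have L2: "\<eta> m \<in> L2" for m
    using \<eta>(1) by (rule test_function_L2)
  have si: "set_integrable lebesgue (cball 0 r) w" if "w \<in> L2" for w :: "real ^ 'n \<Rightarrow> real" and r
    unfolding set_integrable_def real_scaleR_def by (intro integrable_L2_mult L2_indicator_cball that)
  \<comment> \<open>Used with f = G to choose m, and with f = \<eta>_m to let l grow; the bound B +
    1 and the radius R + 2 are chosen to admit both.\<close>
  have sq: "(\<lambda>l. LINT x|lebesgue. (\<eta> l x - f x)\<^sup>2) \<longlonglongrightarrow> (LINT x|lebesgue. (G x - f x)\<^sup>2)"
    if f[measurable]: "f \<in> borel_measurable lebesgue" and fb: "AE x in lebesgue. \<bar>f x\<bar> \<le> B + 1"
      "\<And>x. f x \<noteq> 0 \<Longrightarrow> norm x \<le> R + 2" for f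
  proof (rule integral_dominated_convergence[where w = "\<lambda>x. indicator (cball 0 (R + 2)) x * (2 * B + 2)\<^sup>2"])
    show "integrable lebesgue (\<lambda>x. indicator (cball 0 (R + 2)) x * (2 * B + 2)\<^sup>2)"
      by (intro integrable_mult_left lmeasurable_iff_integrable[THEN iffD1] lmeasurable_cball)
    show "AE x in lebesgue. (\<lambda>l. (\<eta> l x - f x)\<^sup>2) \<longlonglongrightarrow> (G x - f x)\<^sup>2"
      using lim by eventually_elim (intro tendsto_intros)
    show "AE x in lebesgue. norm ((\<eta> l x - f x)\<^sup>2) \<le> indicator (cball 0 (R + 2)) x * (2 * B + 2)\<^sup>2" for l
      using fb(1)
    proof eventually_elim
      case (elim x)
      have "\<bar>\<eta> l x - f x\<bar> \<le> 2 * B + 2"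
        using elim \<eta>(2)[of l x] by linarith
      then have "(\<eta> l x - f x)\<^sup>2 \<le> (2 * B + 2)\<^sup>2"
        by (metis abs_ge_zero power2_abs power_mono)
      then show ?case
        using fb(2)[of x] \<eta>(3)[of l x]
        by (cases "norm x \<le> R + 2"; cases "f x = 0"; cases "\<eta> l x = 0") (auto simp: indicator_def)
    qed
  qed measurable
  \<comment> \<open>With this weight the share of h in Young's inequality is at most e, whatever its
    norm; the added 1 keeps c positive when h = 0.\<close>
  define c where "c = ((LINT x|lebesgue. (h x)\<^sup>2) + 1) / e"
  have H: "(b + 1) / e > 0 \<and> b / ((b + 1) / e) \<le> e" if "b \<ge> 0" for b
    using that \<open>e > 0\<close> by (auto simp: field_simps add_nonneg_pos)
  have "(LINT x|lebesgue. (h x)\<^sup>2) \<ge> 0" by simp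
  from H[OF this] have "c > 0" and cH: "(LINT x|lebesgue. (h x)\<^sup>2) / c \<le> e"
    unfolding c_def by blast+
  have sq0: "(\<lambda>m. LINT x|lebesgue. (\<eta> m x - G x)\<^sup>2) \<longlonglongrightarrow> 0"
  proof -
    have "AE x in lebesgue. \<bar>G x\<bar> \<le> B + 1"
      using bd by eventually_elim simp
    moreover have "norm x \<le> R + 2" if "G x \<noteq> 0" for x
      using supp[OF that] by simp
    ultimately show ?thesis
      using sq[OF G] by simp
  qed
  then have "\<forall>\<^sub>F m in sequentially. (LINT x|lebesgue. (\<eta> m x - G x)\<^sup>2) < e / c"
    by (rule order_tendstoD) (use \<open>c > 0\<close> \<open>e > 0\<close> in simp)
  then obtain m where "(LINT x|lebesgue. (\<eta> m x - G x)\<^sup>2) < e / c"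
    by (auto simp: eventually_sequentially)
  then have m: "c * (LINT x|lebesgue. (G x - \<eta> m x)\<^sup>2) < e"
    using \<open>c > 0\<close> by (simp add: power2_commute[of "G _"] field_simps)
  have half: "x \<le> e" if "x \<le> (p + q) / 2" "p < e" "q \<le> e" for x p q :: real
    using that by simp
  have split: "(LINT x|lebesgue. (f x - \<eta> m x) * w x) = (LINT x|lebesgue. f x * w x) - (LINT x|lebesgue. \<eta> m x * w x)"
    if "w \<in> L2" "f \<in> L2" for w f :: "real ^ 'n \<Rightarrow> real"
    using integrable_L2_mult[OF that(2,1)] integrable_L2_mult[OF L2 that(1)] by (simp add: left_diff_distrib)
  have "\<bar>LINT x|lebesgue. (G x - \<eta> m x) * h x\<bar> \<le> (c * (LINT x|lebesgue. (G x - \<eta> m x)\<^sup>2) + (LINT x|lebesgue. (h x)\<^sup>2) / c) / 2"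
  proof (rule integral_L2_mult_le[OF _ u(2) \<open>c > 0\<close>])
    have "AE x in lebesgue. \<bar>G x - \<eta> m x\<bar> \<le> 2 * B + 1"
      using bd by eventually_elim (use \<eta>(2)[of m] in \<open>smt (verit)\<close>)
    then show "(\<lambda>x. G x - \<eta> m x) \<in> L2"
      by (rule L2_bounded_support[rotated, where R = "R + 2"]) (use supp \<eta>(3)[of m] in \<open>force+\<close>)
  qed
  then have 1: "\<bar>(LINT x|lebesgue. G x * h x) - (LINT x|lebesgue. \<eta> m x * h x)\<bar> \<le> e"
    unfolding split[OF u(2) GL2] by (rule half[OF _ m cH])
  \<comment> \<open>G - \<eta>_m is not smooth, so the t-independent bound is applied to the test
    functions \<eta>_l - \<eta>_m, and l tends to infinity with t fixed.\<close>
  have 2: "\<bar>(LINT x|lebesgue. G x * ?D t x) - (LINT x|lebesgue. \<eta> m x * ?D t x)\<bar> \<le> e" if "t > 0" for t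
  proof -
    have "(\<lambda>l. LINT x|lebesgue. \<eta> l x * ?D t x) \<longlonglongrightarrow> (LINT x|lebesgue. G x * ?D t x)"
    proof (rule integral_tendsto_bounded_support[where R = "R + 2" and B = "B + 1"])
      show "?D t \<in> borel_measurable lebesgue"
        using D by (simp add: L2_real_iff)
      show "set_integrable lebesgue (cball 0 (R + 2)) (?D t)"
        by (rule si[OF D])
    qed (use \<eta> lim in auto)
    then have l1: "(\<lambda>l. \<bar>(LINT x|lebesgue. \<eta> l x * ?D t x) - (LINT x|lebesgue. \<eta> m x * ?D t x)\<bar>) \<longlonglongrightarrow>
        \<bar>(LINT x|lebesgue. G x * ?D t x) - (LINT x|lebesgue. \<eta> m x * ?D t x)\<bar>"
      by (intro tendsto_intros)
    have l2: "(\<lambda>l. (c * (LINT x|lebesgue. (\<eta> l x - \<eta> m x)\<^sup>2) + (LINT x|lebesgue. (h x)\<^sup>2) / c) / 2) \<longlonglongrightarrow>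
        (c * (LINT x|lebesgue. (G x - \<eta> m x)\<^sup>2) + (LINT x|lebesgue. (h x)\<^sup>2) / c) / 2"
      using \<open>c > 0\<close> by (intro tendsto_intros sq) (use \<eta> in auto)
    have l3: "\<bar>(LINT x|lebesgue. \<eta> l x * ?D t x) - (LINT x|lebesgue. \<eta> m x * ?D t x)\<bar> \<le>
        (c * (LINT x|lebesgue. (\<eta> l x - \<eta> m x)\<^sup>2) + (LINT x|lebesgue. (h x)\<^sup>2) / c) / 2" for l
      using weak_second_diff_bound[OF u h test_function_diff[OF \<eta>(1) \<eta>(1)] \<open>t > 0\<close> \<open>c > 0\<close>, of l m]
      unfolding split[OF D L2] .
    have "\<bar>(LINT x|lebesgue. G x * ?D t x) - (LINT x|lebesgue. \<eta> m x * ?D t x)\<bar> \<le>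
        (c * (LINT x|lebesgue. (G x - \<eta> m x)\<^sup>2) + (LINT x|lebesgue. (h x)\<^sup>2) / c) / 2"
      using LIMSEQ_le[OF l1 l2] l3 by blast
    then show ?thesis by (rule half[OF _ m cH])
  qed
  have "\<forall>\<^sub>F t in at_right 0. dist (LINT x|lebesgue. \<eta> m x * ?D t x) (LINT x|lebesgue. \<eta> m x * h x) < e"
    using weak_second_diff_tendsto_test[OF u h \<eta>(1)] \<open>e > 0\<close> by (rule tendstoD)
  then show "\<forall>\<^sub>F t in at_right 0. dist (LINT x|lebesgue. G x * ?D t x) (LINT x|lebesgue. G x * h x) < e'"
    using eventually_at_right_less[of 0]
  proof eventually_elim
    case (elim t)
    then show ?case
      using 1 2[of t] unfolding dist_real_def e_def by linarith
  qed
qed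

subsection \<open>The energy inequality\<close>

lemma integrable_bounded_L2_mult:
  fixes f h b :: "'a::euclidean_space \<Rightarrow> real"
  assumes "f \<in> L2" "h \<in> L2" and b[measurable]: "b \<in> borel_measurable lebesgue" and B: "\<And>x. \<bar>b x\<bar> \<le> B"
  shows "integrable lebesgue (\<lambda>x. b x * (f x * h x))"
proof (rule Bochner_Integration.integrable_bound[where f = "\<lambda>x. B * (f x * h x)"])
  have [measurable]: "f \<in> borel_measurable lebesgue" "h \<in> borel_measurable lebesgue"
    using assms by (simp_all add: L2_real_iff)
  show "integrable lebesgue (\<lambda>x. B * (f x * h x))"
    by (intro integrable_mult_right integrable_L2_mult assms)
  show "(\<lambda>x. b x * (f x * h x)) \<in> borel_measurable lebesgue"
    by measurable
  have "B \<ge> 0" using B[of 0] by linarith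
  then show "AE x in lebesgue. norm (b x * (f x * h x)) \<le> norm (B * (f x * h x))"
    using B by (intro always_eventually allI) (auto simp: abs_mult intro!: mult_right_mono)
qed

text \<open>Discrete analogue of $\int g^2 u\,\Delta u \le \int |\nabla g|^2 u^2$.\<close>

lemma integral_second_diff_le:
  fixes u g :: "'a::euclidean_space \<Rightarrow> real"
  assumes u: "u \<in> L2" and g[measurable]: "g \<in> borel_measurable lebesgue" and B: "\<And>x. \<bar>g x\<bar> \<le> B"
  shows "(LINT x|lebesgue. (g x)\<^sup>2 * u x * second_diff d u x) \<le>
    (LINT x|lebesgue. ((g (x + d) - g x)\<^sup>2 + (g (x - d) - g x)\<^sup>2) / 2 * (u x)\<^sup>2)"
proof -
  have gs[measurable]: "(\<lambda>x. g (x + a)) \<in> borel_measurable lebesgue" for a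
    using borel_measurable_lebesgue_shift[OF g] .
  have us: "(\<lambda>x. u (x + a)) \<in> L2" for a
    using L2_shift[OF u] .
  then have [measurable]: "(\<lambda>x. u (x + a)) \<in> borel_measurable lebesgue" for a
    by (simp add: L2_real_iff)
  have [measurable]: "u \<in> borel_measurable lebesgue"
    using u by (simp add: L2_real_iff)
  have sqB: "a\<^sup>2 \<le> C\<^sup>2" if "\<bar>a\<bar> \<le> C" for a C :: real
    using that by (metis abs_ge_zero power2_abs power_mono)
  have i: "integrable lebesgue (\<lambda>x. (g (x + a))\<^sup>2 * (u (x + b) * u (x + c)))" for a b c
    by (rule integrable_bounded_L2_mult[where B = "B\<^sup>2", OF us us]) (use B sqB in auto)
  have "\<bar>g (x + a) - g (x + b)\<bar> \<le> 2 * B" for x a b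
    using B[of "x + a"] B[of "x + b"] by linarith
  then have sq2B: "\<bar>(g (x + a) - g (x + b))\<^sup>2\<bar> \<le> (2 * B)\<^sup>2" for x a b
    using sqB[of "g (x + a) - g (x + b)" "2 * B"] by simp
  have j: "integrable lebesgue (\<lambda>x. (g (x + a) - g (x + b))\<^sup>2 * (u (x + c) * u (x + c)))" for a b c
    by (intro integrable_bounded_L2_mult[where B = "(2 * B)\<^sup>2", OF us us] sq2B) measurable
  let ?A = "\<lambda>a b c. LINT x|lebesgue. (g (x + a))\<^sup>2 * (u (x + b) * u (x + c))"
  \<comment> \<open>Summation by parts: the backward term and one of the two copies of the integral
    of g^2 u^2 are translated by d, so that only values at x and x + d remain.\<close>
  have shA: "?A 0 0 (- d) = ?A d d 0" "?A 0 0 0 = ?A d d d"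
    using integral_lebesgue_shift[OF borel_measurable_integrable[OF i[of 0 0 "- d"]], of d]
      integral_lebesgue_shift[OF borel_measurable_integrable[OF i[of 0 0 0]], of d]
    by simp_all
  let ?B = "\<lambda>a b c. LINT x|lebesgue. (g (x + a) - g (x + b))\<^sup>2 * (u (x + c) * u (x + c))"
  have shB: "?B d 0 d = ?B 0 (- d) 0"
    using integral_lebesgue_shift[OF borel_measurable_integrable[OF j[of 0 "- d" 0]], of d]
    by simp
  have "(LINT x|lebesgue. (g x)\<^sup>2 * u x * second_diff d u x) =
      (LINT x|lebesgue. (g (x + 0))\<^sup>2 * (u (x + 0) * u (x + d)) - 2 * ((g (x + 0))\<^sup>2 * (u (x + 0) * u (x + 0)))
        + (g (x + 0))\<^sup>2 * (u (x + 0) * u (x + - d)))"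
    by (simp add: second_diff_def algebra_simps)
  also have "\<dots> = ?A 0 0 d - 2 * ?A 0 0 0 + ?A 0 0 (- d)"
    using i[of 0 0 d] i[of 0 0 0] i[of 0 0 "- d"] by simp
  also have "\<dots> = ?A 0 0 d - ?A 0 0 0 - ?A d d d + ?A d d 0"
    using shA by simp
  also have "\<dots> = (LINT x|lebesgue. (g (x + 0))\<^sup>2 * (u (x + 0) * u (x + d)) - (g (x + 0))\<^sup>2 * (u (x + 0) * u (x + 0))
      - (g (x + d))\<^sup>2 * (u (x + d) * u (x + d)) + (g (x + d))\<^sup>2 * (u (x + d) * u (x + 0)))"
    using i[of 0 0 d] i[of 0 0 0] i[of d d d] i[of d d 0] by simp
  also have "\<dots> \<le> (LINT x|lebesgue. ((g (x + d) - g (x + 0))\<^sup>2 * (u (x + 0) * u (x + 0)) +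
      (g (x + d) - g (x + 0))\<^sup>2 * (u (x + d) * u (x + d))) / 2)"
  proof (rule integral_mono)
    fix x
    \<comment> \<open>Here a, b are the values of g and p, q those of u at x and x + d. Twice the
      difference of the two sides is exactly the sum of squares below. The square of a p - b q is
      the discrete form of the discarded term |\<nabla>(g u)|^2.\<close>
    have "a\<^sup>2 * (p * q) - a\<^sup>2 * (p * p) - b\<^sup>2 * (q * q) + b\<^sup>2 * (q * p) \<le>
        ((b - a)\<^sup>2 * (p * p) + (b - a)\<^sup>2 * (q * q)) / 2" for a b p q :: real
    proof -
      have "0 \<le> 2 * (a * p - b * q)\<^sup>2 + (b - a)\<^sup>2 * (p - q)\<^sup>2" by simp
      then show ?thesis by (simp add: power2_eq_square algebra_simps)
    qed
    then show "(g (x + 0))\<^sup>2 * (u (x + 0) * u (x + d)) - (g (x + 0))\<^sup>2 * (u (x + 0) * u (x + 0))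
      - (g (x + d))\<^sup>2 * (u (x + d) * u (x + d)) + (g (x + d))\<^sup>2 * (u (x + d) * u (x + 0))
      \<le> ((g (x + d) - g (x + 0))\<^sup>2 * (u (x + 0) * u (x + 0)) +
      (g (x + d) - g (x + 0))\<^sup>2 * (u (x + d) * u (x + d))) / 2" .
  qed (intro Bochner_Integration.integrable_add Bochner_Integration.integrable_diff integrable_divide i j)+
  also have "\<dots> = (?B d 0 0 + ?B d 0 d) / 2"
    using j[of d 0 0] j[of d 0 d] by simp
  also have "\<dots> = (?B d 0 0 + ?B 0 (- d) 0) / 2"
    unfolding shB ..
  also have "\<dots> = (LINT x|lebesgue. ((g (x + d) - g (x + 0))\<^sup>2 * (u (x + 0) * u (x + 0)) +
      (g (x + 0) - g (x + - d))\<^sup>2 * (u (x + 0) * u (x + 0))) / 2)"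
    using j[of d 0 0] j[of 0 "- d" 0] by simp
  also have "\<dots> = (LINT x|lebesgue. ((g (x + d) - g x)\<^sup>2 + (g (x - d) - g x)\<^sup>2) / 2 * (u x)\<^sup>2)"
    by (simp add: power2_eq_square algebra_simps)
  finally show ?thesis .
qed

text \<open>g^2 u is bounded with bounded support, so its pairing with the difference quotients of u
  converges to that with \<open>h i\<close>; the discrete inequality passes to the limit.
  \<open>W\<close> dominates the slope of g along each axis, and adding up the axes costs the factor
  n.\<close>

lemma green_inequality:
  fixes u g W :: "real ^ 'n \<Rightarrow> real" and h :: "'n \<Rightarrow> real ^ 'n \<Rightarrow> real"
  assumes u: "u \<in> L2" and uB: "AE x in lebesgue. \<bar>u x\<bar> \<le> B"
    and h: "\<And>i. h i \<in> L2" "\<And>i. has_weak_pderiv2 u i (h i)"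
    and g: "continuous_on UNIV g" "\<And>x. \<bar>g x\<bar> \<le> C" "\<And>x. g x \<noteq> 0 \<Longrightarrow> norm x \<le> R"
    and W: "integrable lebesgue (\<lambda>x. (W x)\<^sup>2 * (u x)\<^sup>2)"
    and lip: "\<And>i. \<forall>\<^sub>F t in at_right 0. \<forall>x. \<bar>g (x + t *\<^sub>R axis i 1) - g x\<bar> \<le> t * W x \<and>
      \<bar>g (x - t *\<^sub>R axis i 1) - g x\<bar> \<le> t * W x"
  shows "(LINT x|lebesgue. (g x)\<^sup>2 * u x * (\<Sum>i\<in>UNIV. h i x)) \<le>
    real CARD('n) * (LINT x|lebesgue. (W x)\<^sup>2 * (u x)\<^sup>2)"
proof -
  have gm[measurable]: "g \<in> borel_measurable lebesgue"
    using g(1) by (intro measurable_completion) (simp add: borel_measurable_continuous_onI)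
  have [measurable]: "u \<in> borel_measurable lebesgue"
    using u by (simp add: L2_real_iff)
  have "C \<ge> 0" using g(2)[of 0] by linarith
  define R' where "R' = max R 0"
  let ?G = "\<lambda>x. (g x)\<^sup>2 * u x"
  have Gm: "?G \<in> borel_measurable lebesgue" by measurable
  have Gb: "AE x in lebesgue. \<bar>?G x\<bar> \<le> C\<^sup>2 * \<bar>B\<bar>"
    using uB
  proof eventually_elim
    case (elim x)
    have "(g x)\<^sup>2 \<le> C\<^sup>2"
      using g(2)[of x] by (metis abs_ge_zero power2_abs power_mono)
    then show ?case
      unfolding abs_mult using elim by (intro mult_mono) auto
  qed
  have Gs: "norm x \<le> R'" if "?G x \<noteq> 0" for x
    using g(3)[of x] that by (auto simp: R'_def)
  have GL2: "?G \<in> L2"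
    by (rule L2_bounded_support[OF Gm Gb Gs])
  have "(LINT x|lebesgue. ?G x * h i x) \<le> (LINT x|lebesgue. (W x)\<^sup>2 * (u x)\<^sup>2)" for i
  proof (rule tendsto_upperbound)
    show "((\<lambda>t. LINT x|lebesgue. ?G x * (second_diff (t *\<^sub>R axis i 1) u x / t\<^sup>2)) \<longlongrightarrow>
        (LINT x|lebesgue. ?G x * h i x)) (at_right 0)"
      by (rule weak_second_diff_tendsto[OF u h(1) h(2) Gm Gb Gs]) (auto simp: R'_def)
    show "\<forall>\<^sub>F t in at_right 0. (LINT x|lebesgue. ?G x * (second_diff (t *\<^sub>R axis i 1) u x / t\<^sup>2)) \<le>
        (LINT x|lebesgue. (W x)\<^sup>2 * (u x)\<^sup>2)"
      using lip[of i] eventually_at_right_less[of 0]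
    proof eventually_elim
      case (elim t)
      let ?d = "t *\<^sub>R axis i 1 :: real ^ 'n"
      have "(LINT x|lebesgue. ?G x * (second_diff ?d u x / t\<^sup>2)) =
          (LINT x|lebesgue. ?G x * second_diff ?d u x) / t\<^sup>2"
        by simp
      also have "\<dots> \<le> (LINT x|lebesgue. ((g (x + ?d) - g x)\<^sup>2 + (g (x - ?d) - g x)\<^sup>2) / 2 * (u x)\<^sup>2) / t\<^sup>2"
        by (intro divide_right_mono integral_second_diff_le[OF u gm g(2)]) simp
      also have "\<dots> \<le> (LINT x|lebesgue. t\<^sup>2 * ((W x)\<^sup>2 * (u x)\<^sup>2)) / t\<^sup>2"
      proof (intro divide_right_mono integral_mono_AE' AE_I2 integrable_mult_right W)
        fix x
        have sq: "a\<^sup>2 \<le> t\<^sup>2 * (W x)\<^sup>2" if "\<bar>a\<bar> \<le> t * W x" for a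
          using that by (metis abs_ge_zero power2_abs power_mono power_mult_distrib)
        have "((g (x + ?d) - g x)\<^sup>2 + (g (x - ?d) - g x)\<^sup>2) / 2 \<le> t\<^sup>2 * (W x)\<^sup>2"
          using sq[of "g (x + ?d) - g x"] sq[of "g (x - ?d) - g x"] elim by fastforce
        from mult_right_mono[OF this, of "(u x)\<^sup>2"]
        show "((g (x + ?d) - g x)\<^sup>2 + (g (x - ?d) - g x)\<^sup>2) / 2 * (u x)\<^sup>2 \<le> t\<^sup>2 * ((W x)\<^sup>2 * (u x)\<^sup>2)"
          by (simp add: mult.assoc)
      qed auto
      also have "\<dots> = (LINT x|lebesgue. (W x)\<^sup>2 * (u x)\<^sup>2)"
        using elim by simp
      finally show ?case .
    qed
  qed simp
  then have "(\<Sum>i\<in>UNIV. LINT x|lebesgue. ?G x * h i x) \<le> real CARD('n) * (LINT x|lebesgue. (W x)\<^sup>2 * (u x)\<^sup>2)"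
    by (intro sum_bounded_above) simp
  then show ?thesis
    using integrable_L2_mult[OF GL2 h(1)] by (simp add: sum_distrib_left)
qed

section \<open>The eigenvalue equation in tested form\<close>

text \<open>Both sides are limits of pairings with one sequence of uniformly bounded test functions
  with common support; integrability of h and k on balls provides the domination.\<close>

lemma integral_eq_of_test_functions_eq:
  fixes h k G :: "real ^ 'n \<Rightarrow> real"
  assumes [measurable]: "h \<in> borel_measurable lebesgue" "k \<in> borel_measurable lebesgue"
    and int: "\<And>r. set_integrable lebesgue (cball 0 r) h" "\<And>r. set_integrable lebesgue (cball 0 r) k"
    and eq: "\<And>\<eta>. test_function \<eta> \<Longrightarrow> (LINT x|lebesgue. \<eta> x * h x) = (LINT x|lebesgue. \<eta> x * k x)"
    and G[measurable]: "G \<in> borel_measurable lebesgue" and bd: "AE x in lebesgue. \<bar>G x\<bar> \<le> B"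
    and supp: "\<And>x. G x \<noteq> 0 \<Longrightarrow> norm x \<le> R" and BR: "B \<ge> 0" "R \<ge> 0"
  shows "(LINT x|lebesgue. G x * h x) = (LINT x|lebesgue. G x * k x)"
proof -
  obtain \<eta> :: "nat \<Rightarrow> real ^ 'n \<Rightarrow> real" where \<eta>: "\<And>m. test_function (\<eta> m)" "\<And>m x. \<bar>\<eta> m x\<bar> \<le> B + 1"
    "\<And>m x. \<eta> m x \<noteq> 0 \<Longrightarrow> norm x \<le> R + 2" and lim: "AE x in lebesgue. (\<lambda>m. \<eta> m x) \<longlonglongrightarrow> G x"
    by (rule test_function_approx_bounded[OF G bd _ BR]) (rule supp that, assumption+)+
  have [measurable]: "\<eta> m \<in> borel_measurable lebesgue" for m
    using \<eta>(1) by (rule test_function_measurable)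
  have "(\<lambda>m. LINT x|lebesgue. \<eta> m x * w x) \<longlonglongrightarrow> (LINT x|lebesgue. G x * w x)"
    if [measurable]: "w \<in> borel_measurable lebesgue" and "set_integrable lebesgue (cball 0 (R + 2)) w" for w
    by (rule integral_tendsto_bounded_support[where R = "R + 2" and B = "B + 1"]) (use \<eta> lim that in auto)
  from this[of h] this[of k] show ?thesis
    using int eq[OF \<eta>(1)] LIMSEQ_unique by auto
qed

lemma integrable_bounded_support_mult:
  fixes G w :: "'a::euclidean_space \<Rightarrow> real"
  assumes [measurable]: "G \<in> borel_measurable lebesgue" "w \<in> borel_measurable lebesgue"
    and bd: "AE x in lebesgue. \<bar>G x\<bar> \<le> B" and supp: "\<And>x. G x \<noteq> 0 \<Longrightarrow> norm x \<le> R"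
    and w: "set_integrable lebesgue (cball 0 R) w"
  shows "integrable lebesgue (\<lambda>x. G x * w x)"
proof (rule Bochner_Integration.integrable_bound[where f = "\<lambda>x. B * (indicator (cball 0 R) x * w x)"])
  show "integrable lebesgue (\<lambda>x. B * (indicator (cball 0 R) x * w x))"
    using w by (intro integrable_mult_right) (simp add: set_integrable_def)
  show "AE x in lebesgue. norm (G x * w x) \<le> norm (B * (indicator (cball 0 R) x * w x))"
    using bd
  proof eventually_elim
    case (elim x)
    then show ?case
      using supp[of x] by (cases "G x = 0") (auto simp: abs_mult intro!: mult_right_mono)
  qed
qed measurable

lemma locally_integrable_measurable:
  assumes "locally_integrable f"
  shows "f \<in> borel_measurable lebesgue"
proof (rule borel_measurable_LIMSEQ_metric)
  show "(\<lambda>x. indicator (cball 0 (real n)) x *\<^sub>R f x) \<in> borel_measurable lebesgue" for n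
    using assms compact_cball unfolding locally_integrable_def set_integrable_def
    by (blast intro: borel_measurable_integrable)
  show "(\<lambda>n. indicator (cball 0 (real n)) x *\<^sub>R f x) \<longlonglongrightarrow> f x" for x
  proof (rule tendsto_eventually)
    obtain N :: nat where "norm x \<le> real N" using real_arch_simple by blast
    then show "\<forall>\<^sub>F n in sequentially. indicator (cball 0 (real n)) x *\<^sub>R f x = f x"
      by (intro eventually_sequentiallyI[of N]) (auto simp: indicator_def)
  qed
qed

lemma set_integrable_bounded_linear:
  assumes "bounded_linear r" "set_integrable M A f"
  shows "set_integrable M A (\<lambda>x. r (f x))"
  using integrable_bounded_linear[OF assms(1), of M "\<lambda>x. indicator A x *\<^sub>R f x"] assms(2)
    linear_scale[OF bounded_linear.linear[OF assms(1)]]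
  unfolding set_integrable_def by simp

lemma integrable_test_function_scaleR:
  assumes \<eta>: "test_function \<eta>" and f: "locally_integrable f"
  shows "integrable lebesgue (\<lambda>x. \<eta> x *\<^sub>R f x)"
proof -
  obtain B where B: "B \<ge> 0" "\<And>x. \<bar>\<eta> x\<bar> \<le> B"
    using test_function_bounded[OF \<eta>] by blast
  obtain R where R: "\<And>x. \<eta> x \<noteq> 0 \<Longrightarrow> norm x \<le> R"
    using test_function_support[OF \<eta>] by blast
  have [measurable]: "\<eta> \<in> borel_measurable lebesgue" "f \<in> borel_measurable lebesgue"
    using test_function_measurable[OF \<eta>] locally_integrable_measurable[OF f] by auto
  show ?thesis
  proof (rule Bochner_Integration.integrable_bound[where f = "\<lambda>x. B *\<^sub>R (indicator (cball 0 R) x *\<^sub>R f x)"])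
    show "integrable lebesgue (\<lambda>x. B *\<^sub>R (indicator (cball 0 R) x *\<^sub>R f x))"
      using f by (intro integrable_scaleR_right) (auto simp: locally_integrable_def set_integrable_def)
    show "AE x in lebesgue. norm (\<eta> x *\<^sub>R f x) \<le> norm (B *\<^sub>R (indicator (cball 0 R) x *\<^sub>R f x))"
    proof (intro always_eventually allI)
      fix x
      show "norm (\<eta> x *\<^sub>R f x) \<le> norm (B *\<^sub>R (indicator (cball 0 R) x *\<^sub>R f x))"
        using R[of x] B by (cases "\<eta> x = 0") (auto intro!: mult_right_mono)
    qed
  qed measurable
qed

text \<open>A bounded real-linear functional commutes with the integral. With Re and Im this reduces
  everything to real functions.\<close>

lemma has_weak_pderiv_bounded_linear:
  fixes r :: "complex \<Rightarrow> real"
  assumes r: "bounded_linear r" and w: "has_weak_pderiv f i g" and \<eta>: "test_function \<eta>"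
  shows "(LINT x|lebesgue. pderiv_at i \<eta> x * r (f x)) = - (LINT x|lebesgue. \<eta> x * r (g x))"
proof -
  have li: "locally_integrable f" "locally_integrable g"
    and eq: "(LINT x|lebesgue. pderiv_at i \<eta> x *\<^sub>R f x) = - (LINT x|lebesgue. \<eta> x *\<^sub>R g x)"
    using w \<eta> unfolding has_weak_pderiv_def by auto
  have I: "(LINT x|lebesgue. \<zeta> x * r (k x)) = r (LINT x|lebesgue. \<zeta> x *\<^sub>R k x)"
    if "test_function \<zeta>" "locally_integrable k" for \<zeta> k
    using integral_bounded_linear[OF r integrable_test_function_scaleR[OF that]]
    by (simp add: linear_scale[OF bounded_linear.linear[OF r]])
  show ?thesis
    unfolding I[OF \<eta> li(2)] I[OF test_function_pderiv_at[OF \<eta>] li(1)] eq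
    by (simp add: linear_neg[OF bounded_linear.linear[OF r]])
qed

lemma L2_bounded_linear:
  fixes r :: "complex \<Rightarrow> real"
  assumes r: "bounded_linear r" "\<And>z. \<bar>r z\<bar> \<le> norm z" and f: "f \<in> L2"
  shows "(\<lambda>x. r (f x)) \<in> L2"
proof -
  have [measurable]: "r \<in> borel_measurable borel" "f \<in> borel_measurable lebesgue"
    using r f by (auto intro: borel_measurable_continuous_onI linear_continuous_on simp: L2_def)
  have "integrable lebesgue (\<lambda>x. (r (f x))\<^sup>2)"
  proof (rule Bochner_Integration.integrable_bound[where f = "\<lambda>x. (norm (f x))\<^sup>2"])
    show "integrable lebesgue (\<lambda>x. (norm (f x))\<^sup>2)" using f by (simp add: L2_def)
    show "AE x in lebesgue. norm ((r (f x))\<^sup>2) \<le> norm ((norm (f x))\<^sup>2)"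
      using r(2) by (intro always_eventually allI) (auto intro: power2_le_iff_abs_le[THEN iffD2])
  qed measurable
  then show ?thesis
    by (simp add: L2_real_iff)
qed

text \<open>Two versions of the second derivatives have to be reconciled. Membership in the Sobolev
  space yields \<open>hc i\<close>, which are in L2; \<open>laplacian\<close> is built from chosen
  functions \<open>K i\<close>, known only to be locally integrable, and the equation holds for
  these. They agree against test functions, hence against every bounded G of bounded support, which
  is how the equation is transferred to h.\<close>

lemma eigenfunction_weak_second_derivatives:
  fixes \<psi> :: "real ^ 'n \<Rightarrow> complex" and r :: "complex \<Rightarrow> real"
  assumes V[measurable]: "V \<in> borel_measurable lebesgue" and \<psi>: "\<psi> \<in> sobolev_H 2"
    and eig: "AE x in lebesgue. schroedinger V \<psi> x = complex_of_real E * \<psi> x"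
    and r: "bounded_linear r" "\<And>z. \<bar>r z\<bar> \<le> norm z"
  obtains h where "\<And>i. h i \<in> L2" "\<And>i. has_weak_pderiv2 (\<lambda>x. r (\<psi> x)) i (h i)"
    "\<And>G B R. G \<in> borel_measurable lebesgue \<Longrightarrow> AE x in lebesgue. \<bar>G x\<bar> \<le> B \<Longrightarrow>
      (\<And>x. G x \<noteq> 0 \<Longrightarrow> norm x \<le> R) \<Longrightarrow>
      (LINT x|lebesgue. G x * (\<Sum>i\<in>UNIV. h i x)) = (LINT x|lebesgue. G x * ((V x - E) * r (\<psi> x)))"
proof -
  have r_scale: "r (complex_of_real a * z) = a * r z" for a z
    using linear_scale[OF bounded_linear.linear[OF r(1)], of a z] by (simp add: scaleR_conv_of_real)
  have "\<exists>g h. h \<in> L2 \<and> has_weak_pderiv \<psi> i g \<and> has_weak_pderiv g i h" for i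
    using \<psi> by (auto simp: numeral_2_eq_2) metis
  then obtain g hc where hc: "\<And>i. hc i \<in> L2" "\<And>i. has_weak_pderiv \<psi> i (g i)" "\<And>i. has_weak_pderiv (g i) i (hc i)"
    by metis
  define K where "K i = weak_pderiv i (weak_pderiv i \<psi>)" for i
  have G: "has_weak_pderiv \<psi> i (weak_pderiv i \<psi>)" for i
    unfolding weak_pderiv_def using someI[of "has_weak_pderiv \<psi> i", OF hc(2)] .
  have D: "(LINT x|lebesgue. pderiv_at i \<eta> x *\<^sub>R f x) = - (LINT x|lebesgue. \<eta> x *\<^sub>R k x)"
    if "has_weak_pderiv f i k" "test_function \<eta>" for f k \<eta> i
    using that by (simp add: has_weak_pderiv_def)
  \<comment> \<open>The chosen first derivative may differ from the Sobolev witness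
    \<open>g i\<close>, but both give the same pairing with test functions, in particular with
    derivatives of such. So a second derivative exists for the chosen one as well, and the outer
    choice is meaningful.\<close>
  have "has_weak_pderiv (weak_pderiv i \<psi>) i (hc i)" for i
    unfolding has_weak_pderiv_def
  proof (intro conjI allI impI)
    show "locally_integrable (weak_pderiv i \<psi>)" "locally_integrable (hc i)"
      using G hc(3) by (auto simp: has_weak_pderiv_def)
    fix \<eta> :: "real ^ 'n \<Rightarrow> real" assume \<eta>: "test_function \<eta>"
    have "(LINT x|lebesgue. pderiv_at i \<eta> x *\<^sub>R weak_pderiv i \<psi> x) = (LINT x|lebesgue. pderiv_at i \<eta> x *\<^sub>R g i x)"
      using D[OF G test_function_pderiv_at[OF \<eta>]] D[OF hc(2) test_function_pderiv_at[OF \<eta>]]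
      by (simp only: neg_equal_iff_equal)
    then show "(LINT x|lebesgue. pderiv_at i \<eta> x *\<^sub>R weak_pderiv i \<psi> x) = - (LINT x|lebesgue. \<eta> x *\<^sub>R hc i x)"
      using D[OF hc(3) \<eta>] by simp
  qed
  then have K: "has_weak_pderiv (weak_pderiv i \<psi>) i (K i)" for i
    unfolding K_def weak_pderiv_def[of i "weak_pderiv i \<psi>"]
    using someI[of "has_weak_pderiv (weak_pderiv i \<psi>) i"] by blast
  define h where "h i x = r (hc i x)" for i x
  have lK: "locally_integrable (K i)" for i
    using K by (auto simp: has_weak_pderiv_def)
  have r_meas: "r \<in> borel_measurable borel"
    using r by (auto intro: borel_measurable_continuous_onI linear_continuous_on)
  show ?thesis
  proof (rule that[of h])
    show hL2: "h i \<in> L2" for i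
      unfolding h_def[abs_def] by (rule L2_bounded_linear[OF r hc(1)])
    have two: "(LINT x|lebesgue. pderiv_at i (pderiv_at i \<eta>) x * r (\<psi> x)) = (LINT x|lebesgue. \<eta> x * r (k x))"
      if "test_function \<eta>" "has_weak_pderiv \<psi> i g" "has_weak_pderiv g i k" for \<eta> i g k
      using has_weak_pderiv_bounded_linear[OF r(1) that(2) test_function_pderiv_at[OF that(1)]]
        has_weak_pderiv_bounded_linear[OF r(1) that(3,1)] by simp
    show "has_weak_pderiv2 (\<lambda>x. r (\<psi> x)) i (h i)" for i
      unfolding has_weak_pderiv2_def h_def using two[OF _ hc(2,3)] by blast
    fix G :: "real ^ 'n \<Rightarrow> real" and B R :: real
    assume Gm[measurable]: "G \<in> borel_measurable lebesgue" and "AE x in lebesgue. \<bar>G x\<bar> \<le> B"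
      and "\<And>x. G x \<noteq> 0 \<Longrightarrow> norm x \<le> R"
    then have bd: "AE x in lebesgue. \<bar>G x\<bar> \<le> \<bar>B\<bar>" and supp: "\<And>x. G x \<noteq> 0 \<Longrightarrow> norm x \<le> \<bar>R\<bar>"
      by (auto elim!: eventually_mono) fastforce
    have m: "h i \<in> borel_measurable lebesgue" "(\<lambda>x. r (K i x)) \<in> borel_measurable lebesgue" for i
      using hL2[of i] measurable_compose[OF locally_integrable_measurable[OF lK] r_meas]
      by (auto simp: L2_real_iff)
    have s: "set_integrable lebesgue (cball 0 q) (h i)" "set_integrable lebesgue (cball 0 q) (\<lambda>x. r (K i x))" for i q
    proof -
      show "set_integrable lebesgue (cball 0 q) (h i)"
        unfolding set_integrable_def real_scaleR_def by (intro integrable_L2_mult L2_indicator_cball hL2)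
      show "set_integrable lebesgue (cball 0 q) (\<lambda>x. r (K i x))"
        using lK compact_cball by (intro set_integrable_bounded_linear[OF r(1)]) (auto simp: locally_integrable_def)
    qed
    have eqi: "(LINT x|lebesgue. G x * h i x) = (LINT x|lebesgue. G x * r (K i x))" for i
    proof (rule integral_eq_of_test_functions_eq[OF m s _ Gm bd])
      show "(LINT x|lebesgue. \<eta> x * h i x) = (LINT x|lebesgue. \<eta> x * r (K i x))" if "test_function \<eta>" for \<eta>
        using two[OF that hc(2,3), of i] two[OF that G K, of i] unfolding h_def by simp
    qed (use supp in auto)
    have int: "integrable lebesgue (\<lambda>x. G x * h i x)" "integrable lebesgue (\<lambda>x. G x * r (K i x))" for i
      using integrable_bounded_support_mult[OF Gm m(1) bd supp s(1)]
        integrable_bounded_support_mult[OF Gm m(2) bd supp s(2)] by blast+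
    have "(LINT x|lebesgue. G x * (\<Sum>i\<in>UNIV. h i x)) = (\<Sum>i\<in>UNIV. LINT x|lebesgue. G x * h i x)"
      using int(1) by (simp add: sum_distrib_left)
    also have "\<dots> = (\<Sum>i\<in>UNIV. LINT x|lebesgue. G x * r (K i x))"
      by (simp add: eqi)
    also have "\<dots> = (LINT x|lebesgue. G x * (\<Sum>i\<in>UNIV. r (K i x)))"
      using int(2) by (simp add: sum_distrib_left)
    also have "\<dots> = (LINT x|lebesgue. G x * ((V x - E) * r (\<psi> x)))"
    proof (rule Bochner_Integration.integral_cong_AE)
      have AEq: "AE x in lebesgue. (\<Sum>i\<in>UNIV. r (K i x)) = (V x - E) * r (\<psi> x)"
        using eig
      proof eventually_elim
        case (elim x)
        have "(\<Sum>i\<in>UNIV. K i x) = complex_of_real (V x - E) * \<psi> x"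
          using elim by (simp add: schroedinger_def laplacian_def mult_op_def K_def algebra_simps)
        then have "r (\<Sum>i\<in>UNIV. K i x) = (V x - E) * r (\<psi> x)"
          by (simp only: r_scale)
        then show ?case
          by (simp add: bounded_linear.linear linear_sum r(1))
      qed
      then show AEq': "AE x in lebesgue. G x * (\<Sum>i\<in>UNIV. r (K i x)) = G x * ((V x - E) * r (\<psi> x))"
        by eventually_elim simp
      show mG: "(\<lambda>x. G x * (\<Sum>i\<in>UNIV. r (K i x))) \<in> borel_measurable lebesgue"
        using m(2) by measurable
      show "(\<lambda>x. G x * ((V x - E) * r (\<psi> x))) \<in> borel_measurable lebesgue"
        using L2_bounded_linear[OF r, of \<psi>] \<psi> by (auto simp: numeral_2_eq_2 L2_real_iff)
    qed
    finally show "(LINT x|lebesgue. G x * (\<Sum>i\<in>UNIV. h i x)) = (LINT x|lebesgue. G x * ((V x - E) * r (\<psi> x)))" .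
  qed
qed

subsection \<open>Agmon distance\<close>

lemma division_of_real_cases:
  fixes \<D> :: "real set set"
  assumes "\<D> division_of A" "k \<in> \<D>"
  obtains a b where "a \<le> b" "k = {a..b}" "Inf k = a" "Sup k = b" "a \<in> A" "b \<in> A"
proof -
  obtain a b where k: "k = cbox a b" "k \<noteq> {}" "k \<subseteq> A"
    using division_ofD(2-4)[OF assms] by metis
  then have "a \<le> b" by simp
  then show ?thesis
    using k by (intro that[of a b]) auto
qed

lemma abs_continuous_on_imp_continuous_on:
  assumes "abs_continuous_on {0..1::real} f"
  shows "continuous_on {0..1} f"
  unfolding continuous_on_iff
proof (intro ballI allI impI)
  fix s e :: real assume s: "s \<in> {0..1}" and "e > 0"
  then obtain d where "d > 0" and d: "\<And>\<D>. \<D> division_of \<Union>\<D> \<and> \<Union>\<D> \<subseteq> {0..1} \<and>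
      (\<Sum>k\<in>\<D>. Sup k - Inf k) < d \<Longrightarrow> (\<Sum>k\<in>\<D>. norm (f (Sup k) - f (Inf k))) < e"
    using assms unfolding abs_continuous_on_def by blast
  have *: "norm (f b - f a) < e" if "a \<le> b" "a \<in> {0..1}" "b \<in> {0..1}" "b - a < d" for a b
    using d[of "{{a..b}}"] division_of_self[of a b] that by (simp add: box_real)
  have "dist (f t) (f s) < e" if "t \<in> {0..1}" "dist t s < d" for t
    using *[of s t] *[of t s] that s
    by (cases "s \<le> t") (auto simp: dist_norm norm_minus_commute)
  then show "\<exists>d>0. \<forall>t\<in>{0..1}. dist t s < d \<longrightarrow> dist (f t) (f s) < e"
    using \<open>d > 0\<close> by blast
qed

lemma abs_continuous_on_add:
  assumes "abs_continuous_on S f" "abs_continuous_on S g"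
  shows "abs_continuous_on S (\<lambda>t. f t + g t)"
  unfolding abs_continuous_on_def
proof (intro allI impI)
  fix e :: real assume "e > 0"
  then have "e / 2 > 0" by simp
  obtain d1 where d1: "d1 > 0" "\<And>\<D>. \<D> division_of \<Union>\<D> \<and> \<Union>\<D> \<subseteq> S \<and> (\<Sum>k\<in>\<D>. Sup k - Inf k) < d1 \<Longrightarrow>
      (\<Sum>k\<in>\<D>. norm (f (Sup k) - f (Inf k))) < e / 2"
    using assms(1) \<open>e / 2 > 0\<close> unfolding abs_continuous_on_def by blast
  obtain d2 where d2: "d2 > 0" "\<And>\<D>. \<D> division_of \<Union>\<D> \<and> \<Union>\<D> \<subseteq> S \<and> (\<Sum>k\<in>\<D>. Sup k - Inf k) < d2 \<Longrightarrow>
      (\<Sum>k\<in>\<D>. norm (g (Sup k) - g (Inf k))) < e / 2"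
    using assms(2) \<open>e / 2 > 0\<close> unfolding abs_continuous_on_def by blast
  show "\<exists>d>0. \<forall>\<D>. \<D> division_of \<Union>\<D> \<and> \<Union>\<D> \<subseteq> S \<and> (\<Sum>k\<in>\<D>. Sup k - Inf k) < d \<longrightarrow>
      (\<Sum>k\<in>\<D>. norm (f (Sup k) + g (Sup k) - (f (Inf k) + g (Inf k)))) < e"
  proof (intro exI[of _ "min d1 d2"] conjI allI impI)
    fix \<D> :: "real set set"
    assume D: "\<D> division_of \<Union>\<D> \<and> \<Union>\<D> \<subseteq> S \<and> (\<Sum>k\<in>\<D>. Sup k - Inf k) < min d1 d2"
    have "(\<Sum>k\<in>\<D>. norm (f (Sup k) + g (Sup k) - (f (Inf k) + g (Inf k)))) \<le>
        (\<Sum>k\<in>\<D>. norm (f (Sup k) - f (Inf k)) + norm (g (Sup k) - g (Inf k)))"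
      by (intro sum_mono) (simp add: add_diff_add norm_triangle_ineq)
    also have "\<dots> < e"
      using d1(2)[of \<D>] d2(2)[of \<D>] D by (simp add: sum.distrib)
    finally show "(\<Sum>k\<in>\<D>. norm (f (Sup k) + g (Sup k) - (f (Inf k) + g (Inf k)))) < e" .
  qed (use d1 d2 in auto)
qed

lemma abs_continuous_on_lipschitz:
  assumes L: "\<And>s t. s \<in> S \<Longrightarrow> t \<in> S \<Longrightarrow> norm (f t - f s) \<le> L * \<bar>t - s\<bar>" and "L \<ge> 0"
  shows "abs_continuous_on S f"
  unfolding abs_continuous_on_def
proof (intro allI impI)
  fix e :: real assume "e > 0"
  show "\<exists>d>0. \<forall>\<D>. \<D> division_of \<Union>\<D> \<and> \<Union>\<D> \<subseteq> S \<and> (\<Sum>k\<in>\<D>. Sup k - Inf k) < d \<longrightarrow>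
      (\<Sum>k\<in>\<D>. norm (f (Sup k) - f (Inf k))) < e"
  proof (intro exI[of _ "e / (L + 1)"] conjI allI impI)
    fix \<D> :: "real set set"
    assume D: "\<D> division_of \<Union>\<D> \<and> \<Union>\<D> \<subseteq> S \<and> (\<Sum>k\<in>\<D>. Sup k - Inf k) < e / (L + 1)"
    have "norm (f (Sup k) - f (Inf k)) \<le> (L + 1) * (Sup k - Inf k)" if k: "k \<in> \<D>" for k
    proof -
      obtain a b where ab: "a \<le> b" "Inf k = a" "Sup k = b" "a \<in> \<Union>\<D>" "b \<in> \<Union>\<D>"
        using D division_of_real_cases[OF _ k] by metis
      have "norm (f b - f a) \<le> L * \<bar>b - a\<bar>"
        using ab D by (intro L) blast+
      also have "\<dots> \<le> (L + 1) * \<bar>b - a\<bar>"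
        by (intro mult_right_mono) auto
      finally show ?thesis using ab by simp
    qed
    then have "(\<Sum>k\<in>\<D>. norm (f (Sup k) - f (Inf k))) \<le> (\<Sum>k\<in>\<D>. (L + 1) * (Sup k - Inf k))"
      by (rule sum_mono)
    also have "\<dots> = (L + 1) * (\<Sum>k\<in>\<D>. Sup k - Inf k)"
      by (rule sum_distrib_left[symmetric])
    also have "\<dots> < e"
      using D \<open>L \<ge> 0\<close> by (simp add: pos_less_divide_eq mult.commute)
    finally show "(\<Sum>k\<in>\<D>. norm (f (Sup k) - f (Inf k))) < e" .
  qed (use \<open>e > 0\<close> \<open>L \<ge> 0\<close> in auto)
qed

text \<open>The path that rests on [0, 1/2] and then runs at double speed. The time change m is
  monotone and at most doubles lengths, so a division is mapped to a division of at most twice the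
  total length. Intervals collapsed to a point contribute nothing and are left out of
  \<open>\<D>\<^sub>0\<close>, on which taking images is injective.\<close>

lemma abs_continuous_on_delayed:
  assumes \<gamma>: "abs_continuous_on {0..1} \<gamma>"
  shows "abs_continuous_on {0..1} (\<lambda>t. \<gamma> (max (2 * t - 1) 0))"
  unfolding abs_continuous_on_def
proof (intro allI impI)
  define m :: "real \<Rightarrow> real" where "m t = max (2 * t - 1) 0" for t
  fix e :: real assume "e > 0"
  then obtain d where "d > 0" and d: "\<And>\<D>. \<D> division_of \<Union>\<D> \<and> \<Union>\<D> \<subseteq> {0..1} \<and>
      (\<Sum>k\<in>\<D>. Sup k - Inf k) < d \<Longrightarrow> (\<Sum>k\<in>\<D>. norm (\<gamma> (Sup k) - \<gamma> (Inf k))) < e"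
    using \<gamma> unfolding abs_continuous_on_def by blast
  show "\<exists>d>0. \<forall>\<D>. \<D> division_of \<Union>\<D> \<and> \<Union>\<D> \<subseteq> {0..1} \<and> (\<Sum>k\<in>\<D>. Sup k - Inf k) < d \<longrightarrow>
      (\<Sum>k\<in>\<D>. norm (\<gamma> (max (2 * Sup k - 1) 0) - \<gamma> (max (2 * Inf k - 1) 0))) < e"
    unfolding m_def[symmetric]
  proof (intro exI[of _ "d / 2"] conjI allI impI)
    fix \<D> :: "real set set"
    assume "\<D> division_of \<Union>\<D> \<and> \<Union>\<D> \<subseteq> {0..1} \<and> (\<Sum>k\<in>\<D>. Sup k - Inf k) < d / 2"
    then have D: "\<D> division_of \<Union>\<D>" "\<Union>\<D> \<subseteq> {0..1}" "(\<Sum>k\<in>\<D>. Sup k - Inf k) < d / 2" by auto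
    have fin: "finite \<D>" using D(1) by (rule division_of_finite)
    have k: "Inf k \<le> Sup k" "k = {Inf k..Sup k}" "Inf k \<in> {0..1}" "Sup k \<in> {0..1}" if "k \<in> \<D>" for k
      using division_of_real_cases[OF D(1) that] D(2) by (metis subsetD)+
    define \<D>\<^sub>0 where "\<D>\<^sub>0 = {k \<in> \<D>. m (Inf k) < m (Sup k)}"
    define \<Phi> where "\<Phi> k = {m (Inf k)..m (Sup k)}" for k
    have D0: "\<D>\<^sub>0 \<subseteq> \<D>" "finite \<D>\<^sub>0"
      using fin by (auto simp: \<D>\<^sub>0_def)
    have \<Phi>: "Inf (\<Phi> k) = m (Inf k)" "Sup (\<Phi> k) = m (Sup k)" if "k \<in> \<D>\<^sub>0" for k
      using that by (simp_all add: \<Phi>_def \<D>\<^sub>0_def)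
    have disj: "k = l" if kl: "k \<in> \<D>\<^sub>0" "l \<in> \<D>\<^sub>0" and z: "z \<in> interior (\<Phi> k)" "z \<in> interior (\<Phi> l)" for k l z
    proof (rule ccontr)
      assume "k \<noteq> l"
      then have "interior k \<inter> interior l = {}"
        using division_ofD(5)[OF D(1)] kl D0(1) by blast
      \<comment> \<open>(z + 1) / 2 is the only preimage under m of a z > 0, so a common interior
        point of two images comes from a common interior point of the original intervals.\<close>
      moreover have "(z + 1) / 2 \<in> interior j" if j: "j \<in> \<D>\<^sub>0" "z \<in> interior (\<Phi> j)" for j
      proof -
        have "m (Inf j) < z" "z < m (Sup j)"
          using j(2) by (simp_all add: \<Phi>_def)
        then have "Inf j < (z + 1) / 2" "(z + 1) / 2 < Sup j"
          by (auto simp: m_def max_def split: if_splits)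
        then have "(z + 1) / 2 \<in> interior {Inf j..Sup j}" by simp
        then show ?thesis
          using k(2)[of j] j(1) D0(1) by (metis subsetD)
      qed
      ultimately show False using kl z by blast
    qed
    have inj: "inj_on \<Phi> \<D>\<^sub>0"
    proof (rule inj_onI)
      fix k l assume kl: "k \<in> \<D>\<^sub>0" "l \<in> \<D>\<^sub>0" "\<Phi> k = \<Phi> l"
      have "(m (Inf k) + m (Sup k)) / 2 \<in> interior (\<Phi> k)"
        using kl(1) by (simp add: \<Phi>_def \<D>\<^sub>0_def)
      then show "k = l"
        using disj[OF kl(1,2)] kl(3) by simp
    qed
    have "\<Phi> ` \<D>\<^sub>0 division_of \<Union>(\<Phi> ` \<D>\<^sub>0)"
    proof (rule division_ofI)
      show "finite (\<Phi> ` \<D>\<^sub>0)" using D0 by simp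
      fix K assume "K \<in> \<Phi> ` \<D>\<^sub>0"
      then obtain k where k: "k \<in> \<D>\<^sub>0" "K = \<Phi> k" by blast
      then show "K \<subseteq> \<Union>(\<Phi> ` \<D>\<^sub>0)" "K \<noteq> {}" "\<exists>a b. K = cbox a b"
        by (auto simp: \<Phi>_def \<D>\<^sub>0_def)
      fix L assume "L \<in> \<Phi> ` \<D>\<^sub>0" "K \<noteq> L"
      then show "interior K \<inter> interior L = {}"
        using disj k by blast
    qed simp
    moreover have "\<Union>(\<Phi> ` \<D>\<^sub>0) \<subseteq> {0..1}"
      using k(4) D0(1) by (fastforce simp: \<Phi>_def m_def max_def split: if_splits)
    moreover have "(\<Sum>K\<in>\<Phi> ` \<D>\<^sub>0. Sup K - Inf K) < d"
    proof -
      have "(\<Sum>K\<in>\<Phi> ` \<D>\<^sub>0. Sup K - Inf K) = (\<Sum>k\<in>\<D>\<^sub>0. m (Sup k) - m (Inf k))"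
        using \<Phi> by (simp add: sum.reindex[OF inj])
      also have "\<dots> \<le> (\<Sum>k\<in>\<D>\<^sub>0. 2 * (Sup k - Inf k))"
      proof (rule sum_mono)
        fix j assume "j \<in> \<D>\<^sub>0"
        then show "m (Sup j) - m (Inf j) \<le> 2 * (Sup j - Inf j)"
          using k(1)[of j] D0(1) by (auto simp: m_def max_def)
      qed
      also have "\<dots> \<le> (\<Sum>k\<in>\<D>. 2 * (Sup k - Inf k))"
        using D0 fin k(1) by (intro sum_mono2) auto
      also have "\<dots> = 2 * (\<Sum>k\<in>\<D>. Sup k - Inf k)"
        by (rule sum_distrib_left[symmetric])
      also have "\<dots> < d"
        using D(3) by simp
      finally show ?thesis .
    qed
    ultimately have "(\<Sum>K\<in>\<Phi> ` \<D>\<^sub>0. norm (\<gamma> (Sup K) - \<gamma> (Inf K))) < e"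
      by (intro d conjI)
    also have "(\<Sum>K\<in>\<Phi> ` \<D>\<^sub>0. norm (\<gamma> (Sup K) - \<gamma> (Inf K))) = (\<Sum>k\<in>\<D>\<^sub>0. norm (\<gamma> (m (Sup k)) - \<gamma> (m (Inf k))))"
      using \<Phi> by (simp add: sum.reindex[OF inj])
    also have "\<dots> = (\<Sum>k\<in>\<D>. norm (\<gamma> (m (Sup k)) - \<gamma> (m (Inf k))))"
    proof (rule sum.mono_neutral_left[OF fin D0(1)], rule ballI)
      fix j assume j: "j \<in> \<D> - \<D>\<^sub>0"
      then have "m (Inf j) = m (Sup j)"
        using k(1)[of j] by (auto simp: \<D>\<^sub>0_def m_def max_def split: if_splits)
      then show "norm (\<gamma> (m (Sup j)) - \<gamma> (m (Inf j))) = 0" by simp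
    qed
    finally show "(\<Sum>k\<in>\<D>. norm (\<gamma> (m (Sup k)) - \<gamma> (m (Inf k)))) < e" .
  qed (use \<open>d > 0\<close> in auto)
qed

text \<open>By the Cauchy criterion the differentiability set is a countable combination of closed sets.\<close>

lemma sets_borel_has_vector_derivative:
  fixes f :: "real \<Rightarrow> 'a::banach"
  assumes f: "continuous_on UNIV f"
  shows "{t. \<exists>w. (f has_vector_derivative w) (at t)} \<in> sets borel"
proof -
  let ?q = "\<lambda>t h. (f (t + h) - f t) /\<^sub>R h"
  define S where "S e d = {t. \<forall>h h'. 0 < \<bar>h\<bar> \<and> \<bar>h\<bar> < d \<and> 0 < \<bar>h'\<bar> \<and> \<bar>h'\<bar> < d \<longrightarrow> norm (?q t h - ?q t h') \<le> e}"
    for e d :: real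
  have cl[THEN borel_closed, measurable]: "closed (S e d)" for e d
  proof -
    have "continuous_on UNIV (\<lambda>t. f (t + h))" for h
      by (rule continuous_on_compose2[OF f]) (auto intro: continuous_intros)
    then have "closed {t. norm (?q t h - ?q t h') \<le> e}" for h h'
      by (intro closed_Collect_le continuous_intros f)
    then show ?thesis
      unfolding S_def by (intro closed_Collect_all closed_Collect_imp open_Collect_const)
  qed
  have hv: "(f has_vector_derivative w) (at t) \<longleftrightarrow> (?q t \<longlongrightarrow> w) (at 0)" for w t
  proof -
    have "(?q t \<longlongrightarrow> w) (at 0) \<longleftrightarrow> ((\<lambda>h. norm (?q t h - w)) \<longlongrightarrow> 0) (at 0)"
      by (simp only: tendsto_norm_zero_iff LIM_zero_iff)
    also have "\<dots> \<longleftrightarrow> ((\<lambda>h. norm (f (t + h) - f t - h *\<^sub>R w) / norm h) \<longlongrightarrow> 0) (at 0)"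
    proof (rule tendsto_cong)
      have "norm (?q t h - w) = norm (f (t + h) - f t - h *\<^sub>R w) / norm h" if "h \<noteq> 0" for h
      proof -
        have "?q t h - w = (f (t + h) - f t - h *\<^sub>R w) /\<^sub>R h"
          using that by (simp add: scaleR_diff_right)
        then show ?thesis by (simp add: divide_inverse mult.commute)
      qed
      then show "\<forall>\<^sub>F h in at 0. norm (?q t h - w) = norm (f (t + h) - f t - h *\<^sub>R w) / norm h"
        by (auto simp: eventually_at_filter)
    qed
    finally show ?thesis
      by (simp add: has_vector_derivative_def has_derivative_at bounded_linear_scaleR_left)
  qed
  have "{t. \<exists>w. (f has_vector_derivative w) (at t)} =
      (\<Inter>n::nat. \<Union>m::nat. S (inverse (real (Suc n))) (inverse (real (Suc m))))"
  proof (intro set_eqI iffI)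
    fix t assume "t \<in> {t. \<exists>w. (f has_vector_derivative w) (at t)}"
    then obtain w where w: "(?q t \<longlongrightarrow> w) (at 0)"
      by (auto simp: hv)
    show "t \<in> (\<Inter>n::nat. \<Union>m::nat. S (inverse (real (Suc n))) (inverse (real (Suc m))))"
    proof
      fix n :: nat
      have "\<forall>\<^sub>F h in at 0. dist (?q t h) w < inverse (real (Suc n)) / 2"
        using w by (rule tendstoD) simp
      then obtain d where d: "d > 0" "\<And>h. h \<noteq> 0 \<Longrightarrow> \<bar>h\<bar> < d \<Longrightarrow> dist (?q t h) w < inverse (real (Suc n)) / 2"
        by (auto simp: eventually_at dist_real_def)
      obtain m where m: "inverse (real (Suc m)) < d"
        using reals_Archimedean[OF d(1)] by blast
      have "t \<in> S (inverse (real (Suc n))) (inverse (real (Suc m)))"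
        unfolding S_def
      proof (intro CollectI allI impI)
        fix h h' assume "0 < \<bar>h\<bar> \<and> \<bar>h\<bar> < inverse (real (Suc m)) \<and> 0 < \<bar>h'\<bar> \<and> \<bar>h'\<bar> < inverse (real (Suc m))"
        then have "dist (?q t h) w < inverse (real (Suc n)) / 2" "dist (?q t h') w < inverse (real (Suc n)) / 2"
          using d(2)[of h] d(2)[of h'] m by auto
        then have "dist (?q t h) (?q t h') < inverse (real (Suc n))"
          by (rule dist_triangle_half_l)
        then show "norm (?q t h - ?q t h') \<le> inverse (real (Suc n))"
          by (simp add: dist_norm)
      qed
      then show "t \<in> (\<Union>m::nat. S (inverse (real (Suc n))) (inverse (real (Suc m))))" by blast
    qed
  next
    fix t assume t: "t \<in> (\<Inter>n::nat. \<Union>m::nat. S (inverse (real (Suc n))) (inverse (real (Suc m))))"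
    have C: "\<exists>d>0. \<forall>h h'. 0 < \<bar>h\<bar> \<and> \<bar>h\<bar> < d \<and> 0 < \<bar>h'\<bar> \<and> \<bar>h'\<bar> < d \<longrightarrow> norm (?q t h - ?q t h') < e"
      if "e > 0" for e
    proof -
      obtain n where n: "inverse (real (Suc n)) < e"
        using reals_Archimedean[OF \<open>e > 0\<close>] by blast
      obtain m where "t \<in> S (inverse (real (Suc n))) (inverse (real (Suc m)))"
        using t by blast
      then show ?thesis
        using n unfolding S_def
        by (intro exI[of _ "inverse (real (Suc m))"]) (auto intro: le_less_trans)
    qed
    \<comment> \<open>The candidate derivative is the limit along the steps 1/(n+1), which exists by
      completeness; the Cauchy condition then upgrades it to the limit over all small h.\<close>
    define X where "X n = ?q t (inverse (real (Suc n)))" for n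
    have X0: "(\<lambda>n. inverse (real (Suc n))) \<longlonglongrightarrow> 0"
      by (rule LIMSEQ_inverse_real_of_nat)
    have ev: "\<forall>\<^sub>F n in sequentially. inverse (real (Suc n)) < d" if "d > 0" for d
      using order_tendstoD(2)[OF X0 that] .
    have "Cauchy X"
      unfolding Cauchy_def
    proof (intro allI impI)
      fix e :: real assume "e > 0"
      from C[OF this] obtain d where d: "d > 0"
        "\<And>h h'. 0 < \<bar>h\<bar> \<and> \<bar>h\<bar> < d \<and> 0 < \<bar>h'\<bar> \<and> \<bar>h'\<bar> < d \<Longrightarrow> norm (?q t h - ?q t h') < e" by blast
      from ev[OF d(1)] obtain N where N: "\<And>n. n \<ge> N \<Longrightarrow> inverse (real (Suc n)) < d"
        by (auto simp: eventually_sequentially)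
      show "\<exists>M. \<forall>m\<ge>M. \<forall>n\<ge>M. dist (X m) (X n) < e"
      proof (intro exI allI impI)
        fix p q assume "p \<ge> N" "q \<ge> N"
        then show "dist (X p) (X q) < e"
          unfolding X_def dist_norm using N[of p] N[of q] by (intro d(2)) auto
      qed
    qed
    then obtain w where w: "X \<longlonglongrightarrow> w"
      using Cauchy_convergent convergent_def by blast
    have "(?q t \<longlongrightarrow> w) (at 0)"
    proof (rule tendstoI)
      fix e :: real assume "e > 0"
      then have "e / 2 > 0" by simp
      from C[OF this] obtain d where d: "d > 0"
        "\<And>h h'. 0 < \<bar>h\<bar> \<and> \<bar>h\<bar> < d \<and> 0 < \<bar>h'\<bar> \<and> \<bar>h'\<bar> < d \<Longrightarrow> norm (?q t h - ?q t h') < e / 2" by blast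
      have "\<forall>\<^sub>F n in sequentially. dist (X n) w < e / 2"
        using w \<open>e / 2 > 0\<close> by (rule tendstoD)
      with ev[OF d(1)] have "\<forall>\<^sub>F n in sequentially. inverse (real (Suc n)) < d \<and> dist (X n) w < e / 2"
        by eventually_elim simp
      then obtain n where n: "inverse (real (Suc n)) < d" "dist (X n) w < e / 2"
        by (auto simp: eventually_sequentially)
      have "dist (?q t h) w < e" if "h \<noteq> 0" "\<bar>h\<bar> < d" for h
      proof -
        have "dist (?q t h) (X n) < e / 2"
          unfolding X_def dist_norm using n that by (intro d(2)) auto
        then show ?thesis
          using n(2) dist_triangle[of "?q t h" w "X n"] by linarith
      qed
      then show "\<forall>\<^sub>F h in at 0. dist (?q t h) w < e"
        unfolding eventually_at using d(1) by (intro exI[of _ d]) (auto simp: dist_real_def)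
    qed
    then show "t \<in> {t. \<exists>w. (f has_vector_derivative w) (at t)}"
      by (auto simp: hv)
  qed
  moreover have "(\<Inter>n::nat. \<Union>m::nat. S (inverse (real (Suc n))) (inverse (real (Suc m)))) \<in> sets borel"
    using cl by measurable
  ultimately show ?thesis by simp
qed

section \<open>Prefixing a segment to a path\<close>

text \<open>For \<open>\<gamma>\<close> starting at x: the segment from y to x on [0, 1/2], followed
  by \<open>\<gamma>\<close> at double speed. On each half one summand is constant, so absolute
  continuity follows from that of a sum, without a gluing argument at 1/2.\<close>

definition prefix_segment :: "'a::real_normed_vector \<Rightarrow> 'a \<Rightarrow> (real \<Rightarrow> 'a) \<Rightarrow> real \<Rightarrow> 'a" where
  "prefix_segment y x \<gamma> t = (1 - min (2 * t) 1) *\<^sub>R (y - x) + \<gamma> (max (2 * t - 1) 0)"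

lemma prefix_segment_ac_paths:
  assumes "\<gamma> \<in> ac_paths x z"
  shows "prefix_segment y x \<gamma> \<in> ac_paths y z"
proof -
  have "abs_continuous_on {0..1::real} (\<lambda>t. (1 - min (2 * t) 1) *\<^sub>R (y - x))"
  proof (rule abs_continuous_on_lipschitz[where L = "2 * norm (y - x)"])
    fix s t :: real
    have "norm ((1 - min (2 * t) 1) *\<^sub>R (y - x) - (1 - min (2 * s) 1) *\<^sub>R (y - x)) =
        \<bar>min (2 * s) 1 - min (2 * t) 1\<bar> * norm (y - x)"
      by (simp flip: scaleR_diff_left)
    also have "\<dots> \<le> (2 * \<bar>t - s\<bar>) * norm (y - x)"
      by (intro mult_right_mono) (auto simp: min_def abs_if)
    finally show "norm ((1 - min (2 * t) 1) *\<^sub>R (y - x) - (1 - min (2 * s) 1) *\<^sub>R (y - x)) \<le>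
        2 * norm (y - x) * \<bar>t - s\<bar>" by (simp add: mult_ac)
  qed simp
  then have "abs_continuous_on {0..1} (prefix_segment y x \<gamma>)"
    unfolding prefix_segment_def[abs_def] using assms
    by (intro abs_continuous_on_add abs_continuous_on_delayed) (auto simp: ac_paths_def)
  then show ?thesis
    using assms by (simp add: ac_paths_def prefix_segment_def)
qed

lemma prefix_segment_vector_derivative_1:
  assumes "0 < t" "t < 1 / 2"
  shows "vector_derivative (prefix_segment y x \<gamma>) (at t within {0..1}) = - (2 *\<^sub>R (y - x))"
proof -
  have "((\<lambda>t. (1 - 2 * t) *\<^sub>R (y - x) + \<gamma> 0) has_vector_derivative - (2 *\<^sub>R (y - x))) (at t)"
    by (auto intro!: derivative_eq_intros)
  then have "(prefix_segment y x \<gamma> has_vector_derivative - (2 *\<^sub>R (y - x))) (at t)"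
    by (rule has_vector_derivative_transform_within_open[of _ _ _ "{0<..<1/2}"])
      (use assms in \<open>auto simp: prefix_segment_def min_def max_def\<close>)
  moreover have "at t within {0..1} = at t"
    using assms by (auto intro!: at_within_interior)
  ultimately show ?thesis
    by (simp only: vector_derivative_at)
qed

text \<open>Where \<gamma> has a derivative it doubles. Where it has none, the reverse
  reparametrization shows that the new path has none either; then both derivatives are choices from
  the same empty predicate, hence equal, with factor 1.\<close>

lemma prefix_segment_vector_derivative_2:
  assumes "1 / 2 < t" "t < 1"
  shows "vector_derivative (prefix_segment y x \<gamma>) (at t within {0..1}) =
    (if \<exists>w. (\<gamma> has_vector_derivative w) (at (- 1 + 2 * t)) then 2 else 1) *\<^sub>R
      vector_derivative \<gamma> (at (- 1 + 2 * t) within {0..1})"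
proof -
  let ?\<sigma> = "prefix_segment y x \<gamma>" and ?s = "- 1 + 2 * t"
  have fwd: "(?\<sigma> has_vector_derivative 2 *\<^sub>R w) (at t)" if "(\<gamma> has_vector_derivative w) (at ?s)" for w
  proof -
    have "((\<lambda>t. - 1 + 2 * t) has_vector_derivative 2) (at t)"
      by (auto intro!: derivative_eq_intros simp flip: has_real_derivative_iff_has_vector_derivative)
    from vector_diff_chain_at[OF this that]
    have "(\<gamma> \<circ> (\<lambda>t. - 1 + 2 * t) has_vector_derivative 2 *\<^sub>R w) (at t)" .
    then show ?thesis
      by (rule has_vector_derivative_transform_within_open[of _ _ _ "{1/2<..<1}"])
        (use assms in \<open>auto simp: prefix_segment_def min_def max_def algebra_simps\<close>)
  qed
  have bwd: "(\<gamma> has_vector_derivative (1/2) *\<^sub>R w) (at ?s)" if "(?\<sigma> has_vector_derivative w) (at t)" for w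
  proof -
    have "((\<lambda>s. (s + 1) / 2) has_vector_derivative 1/2) (at ?s)"
      by (auto intro!: derivative_eq_intros simp flip: has_real_derivative_iff_has_vector_derivative)
    moreover have "(?\<sigma> has_vector_derivative w) (at ((?s + 1) / 2))"
      using that by simp
    ultimately have "(?\<sigma> \<circ> (\<lambda>s. (s + 1) / 2) has_vector_derivative (1/2) *\<^sub>R w) (at ?s)"
      by (rule vector_diff_chain_at)
    then show ?thesis
      by (rule has_vector_derivative_transform_within_open[of _ _ _ "{0<..<1}"])
        (use assms in \<open>auto simp: prefix_segment_def min_def max_def add_divide_distrib\<close>)
  qed
  have a: "at t within {0..1} = at t" "at ?s within {0..1} = at ?s"
    using assms by (auto intro!: at_within_interior)
  show ?thesis
  proof (cases "\<exists>w. (\<gamma> has_vector_derivative w) (at ?s)")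
    case True
    then obtain w where w: "(\<gamma> has_vector_derivative w) (at ?s)" by blast
    show ?thesis
      unfolding a using True vector_derivative_at[OF w] vector_derivative_at[OF fwd[OF w]] by simp
  next
    case False
    then have "\<not> (?\<sigma> has_vector_derivative w) (at t)" for w
      using bwd by blast
    then have "vector_derivative ?\<sigma> (at t) = vector_derivative \<gamma> (at ?s)"
      using False unfolding vector_derivative_def by simp
    then show ?thesis
      unfolding a using False by simp
  qed
qed

lemma agmon_length_nonneg: "0 \<le> agmon_length V E \<gamma>"
  unfolding agmon_length_def set_lebesgue_integral_def by (intro Bochner_Integration.integral_nonneg) simp

lemma AE_lebesgue_notin_finite: "finite (S :: real set) \<Longrightarrow> AE t in lebesgue. t \<notin> S"
  by (intro AE_not_in null_sets_completionI finite_imp_null_set_lborel)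

text \<open>
  Where a path is not differentiable, \<open>vector_derivative\<close> is a fixed unspecified vector, which does
  not scale under reparametrization; hence the factor \<open>c\<close> and the need for a measurable
  differentiability set. A path with non-integrable speed has length 0, but then so does its
  extension, and the inequality holds without showing that this cannot occur.
\<close>

lemma agmon_length_prefix_segment:
  fixes V :: "real ^ 'n \<Rightarrow> real"
  assumes \<gamma>: "\<gamma> \<in> ac_paths x z"
    and M: "\<And>p. p \<in> closed_segment x y \<Longrightarrow> sqrt (max (V p - E) 0) \<le> M"
  shows "agmon_length V E (prefix_segment y x \<gamma>) \<le> norm (y - x) * M + agmon_length V E \<gamma>"
proof -
  define F where "F \<gamma> t = sqrt (max (V (\<gamma> t) - E) 0) * norm (vector_derivative \<gamma> (at t within {0..1}))"
    for \<gamma> :: "real \<Rightarrow> real ^ 'n" and t :: real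
  have len: "agmon_length V E \<gamma> = (LINT t|lebesgue. indicator {0..1} t * F \<gamma> t)" for \<gamma>
    by (simp add: agmon_length_def set_lebesgue_integral_def F_def)
  have Fnn: "F \<gamma> t \<ge> 0" for \<gamma> t
    by (simp add: F_def)
  have "0 \<le> sqrt (max (V x - E) 0)" by simp
  also have "\<dots> \<le> M" by (intro M) simp
  finally have "M \<ge> 0" .
  let ?\<sigma> = "prefix_segment y x \<gamma>"
  let ?H = "\<lambda>t. indicator {0..1} t * F ?\<sigma> t"
  show ?thesis
  proof (cases "integrable lebesgue ?H")
    case False
    then show ?thesis
      unfolding len[of ?\<sigma>] using agmon_length_nonneg[of V E \<gamma>] \<open>M \<ge> 0\<close>
      by (simp add: not_integrable_integral_eq)
  next
    case H: True
    then have [measurable]: "?H \<in> borel_measurable lebesgue" by simp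
    have cont: "continuous_on {0..1} \<gamma>" and \<gamma>0: "\<gamma> 0 = x"
      using \<gamma> abs_continuous_on_imp_continuous_on by (auto simp: ac_paths_def)
    \<comment> \<open>Constant continuation beyond both endpoints gives a continuous function on the
      whole line, so that its differentiability set is Borel; inside (0, 1) nothing changes.\<close>
    define \<Gamma> where "\<Gamma> s = \<gamma> (max 0 (min 1 s))" for s
    have "continuous_on UNIV \<Gamma>"
      unfolding \<Gamma>_def by (rule continuous_on_compose2[OF cont]) (auto intro!: continuous_intros)
    define D where "D = {s. \<exists>w. (\<Gamma> has_vector_derivative w) (at s)}"
    have D[measurable]: "D \<in> sets borel"
      unfolding D_def by (rule sets_borel_has_vector_derivative) fact
    have D_iff: "s \<in> D \<longleftrightarrow> (\<exists>w. (\<gamma> has_vector_derivative w) (at s))" if "0 < s" "s < 1" for s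
    proof -
      have "(\<Gamma> has_vector_derivative w) (at s) \<longleftrightarrow> (\<gamma> has_vector_derivative w) (at s)" for w
        using that by (auto elim!: has_vector_derivative_transform_within_open[of _ _ _ "{0<..<1}"] simp: \<Gamma>_def)
      then show ?thesis by (simp add: D_def)
    qed
    define c :: "real \<Rightarrow> real" where "c s = (if s \<in> D then 2 else 1)" for s
    define P where "P s = indicator {0<..<1} s * F \<gamma> s" for s
    have Pnn: "P s \<ge> 0" for s
      using Fnn by (simp add: P_def)
    have c: "1 \<le> c s" "c s \<le> 2" for s
      by (auto simp: c_def)
    have "(\<lambda>t. c (- 1 + 2 * t)) \<in> borel_measurable borel"
      unfolding c_def by measurable
    then have [measurable]: "(\<lambda>t. c (- 1 + 2 * t)) \<in> borel_measurable lebesgue"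
      by (intro measurable_completion) simp
    have Heq: "indicator {1/2<..<1} t * ?H t = c (- 1 + 2 * t) * P (- 1 + 2 * t)" for t
    proof (cases "1/2 < t \<and> t < 1")
      case True
      then have "?\<sigma> t = \<gamma> (- 1 + 2 * t)"
        by (simp add: prefix_segment_def min_def max_def algebra_simps)
      then have "F ?\<sigma> t = c (- 1 + 2 * t) * F \<gamma> (- 1 + 2 * t)"
        using True D_iff[of "- 1 + 2 * t"] prefix_segment_vector_derivative_2[of t y x \<gamma>]
        by (auto simp: F_def c_def)
      then show ?thesis
        using True by (simp add: P_def)
    qed (auto simp: P_def indicator_def)
    have iA: "integrable lebesgue (\<lambda>t. indicator {0<..<1/2} t * ?H t)"
      and iB: "integrable lebesgue (\<lambda>t. indicator {1/2<..<1} t * ?H t)"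
      using integrable_mult_indicator[OF _ H] by auto
    \<comment> \<open>Integrability passes from the extended path back to \<gamma>: the integrand of
      the former on the second half is c P with 1 \<le> c, and dividing by the measurable c recovers
      measurability of P.\<close>
    have Psh: "integrable lebesgue (\<lambda>t. P (- 1 + 2 * t))"
    proof (rule Bochner_Integration.integrable_bound[OF iB])
      have "(\<lambda>t. P (- 1 + 2 * t)) = (\<lambda>t. (indicator {1/2<..<1} t * ?H t) / c (- 1 + 2 * t))"
        unfolding Heq by (simp add: c_def)
      moreover have "(\<lambda>t. (indicator {1/2<..<1} t * ?H t) / c (- 1 + 2 * t)) \<in> borel_measurable lebesgue"
        by (intro borel_measurable_divide borel_measurable_integrable[OF iB]) measurable
      ultimately show "(\<lambda>t. P (- 1 + 2 * t)) \<in> borel_measurable lebesgue"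
        by (simp only:)
      have "1 * P s \<le> c s * P s" for s
        by (rule mult_right_mono[OF c(1) Pnn])
      then show "AE t in lebesgue. norm (P (- 1 + 2 * t)) \<le> norm (indicator {1/2<..<1} t * ?H t)"
        unfolding Heq using Pnn by (intro always_eventually allI) (auto intro: order_trans[OF _ abs_ge_self])
    qed
    then have iP: "integrable lebesgue P"
      using lebesgue_integrable_real_affine_iff[of 2 P "- 1"] by simp
    have "(LINT t|lebesgue. P t) = (LINT t|lebesgue. indicator {0..1} t * F \<gamma> t)"
    proof (rule Bochner_Integration.integral_cong_AE)
      have "(\<lambda>t. indicator {0..1} t * F \<gamma> t) = (\<lambda>t. P t + indicator {0} t * F \<gamma> 0 + indicator {1} t * F \<gamma> 1)"
        by (auto simp: fun_eq_iff P_def indicator_def)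
      moreover have "(\<lambda>t. P t + indicator {0} t * F \<gamma> 0 + indicator {1} t * F \<gamma> 1) \<in> borel_measurable lebesgue"
        by (intro borel_measurable_add borel_measurable_times borel_measurable_indicator
            borel_measurable_const borel_measurable_integrable[OF iP]) auto
      ultimately show "(\<lambda>t. indicator {0..1} t * F \<gamma> t) \<in> borel_measurable lebesgue" by simp
      have "AE t in lebesgue. t \<notin> {0, 1 :: real}"
        by (rule AE_lebesgue_notin_finite) simp
      then show "AE t in lebesgue. P t = indicator {0..1} t * F \<gamma> t"
        by eventually_elim (auto simp: P_def indicator_def)
    qed (use iP in auto)
    then have lenP: "(LINT t|lebesgue. P t) = agmon_length V E \<gamma>"
      by (simp add: len)
    \<comment> \<open>Since c \<le> 2, and 2 is the Jacobian of t -> 2 t - 1, the second half is no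
      longer than \<gamma>; points with c = 1 only make it shorter.\<close>
    have B: "(LINT t|lebesgue. indicator {1/2<..<1} t * ?H t) \<le> agmon_length V E \<gamma>"
    proof -
      have "(LINT t|lebesgue. indicator {1/2<..<1} t * ?H t) \<le> (LINT t|lebesgue. 2 * P (- 1 + 2 * t))"
        using iB Psh c Pnn by (intro integral_mono) (auto simp: Heq intro!: mult_right_mono)
      also have "\<dots> = (LINT t|lebesgue. P t)"
        using lebesgue_integral_real_affine[of 2 P "- 1"] by simp
      finally show ?thesis by (simp add: lenP)
    qed
    have A: "(LINT t|lebesgue. indicator {0<..<1/2} t * ?H t) \<le> norm (y - x) * M"
    proof -
      have "(LINT t|lebesgue. indicator {0<..<1/2} t * ?H t) \<le>
          (LINT t|lebesgue. indicator {0<..<1/2 :: real} t * (2 * norm (y - x) * M))"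
      proof (rule integral_mono[OF iA])
        show "integrable lebesgue (\<lambda>t::real. indicator {0<..<1/2} t * (2 * norm (y - x) * M))"
          using lmeasurable_box[of 0 "1/2 :: real"]
          by (intro integrable_mult_left) (simp add: lmeasurable_iff_integrable box_real)
        fix t :: real
        show "indicator {0<..<1/2} t * ?H t \<le> indicator {0<..<1/2} t * (2 * norm (y - x) * M)"
        proof (cases "0 < t \<and> t < 1/2")
          case True
          have "?\<sigma> t = (1 - (1 - 2 * t)) *\<^sub>R x + (1 - 2 * t) *\<^sub>R y"
            using True \<gamma>0 by (simp add: prefix_segment_def min_def max_def algebra_simps)
          then have "?\<sigma> t \<in> closed_segment x y"
            using True unfolding closed_segment_def by (intro CollectI exI[of _ "1 - 2 * t"]) auto
          then have "F ?\<sigma> t \<le> M * (2 * norm (y - x))"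
            unfolding F_def using True \<open>M \<ge> 0\<close> prefix_segment_vector_derivative_1[of t y x \<gamma>]
            by (auto intro!: mult_mono M simp del: max_def)
          then show ?thesis
            using True by (simp add: mult_ac)
        qed (auto simp: indicator_def)
      qed
      also have "\<dots> = norm (y - x) * M" by simp
      finally show ?thesis .
    qed
    have "agmon_length V E ?\<sigma> =
        (LINT t|lebesgue. indicator {0<..<1/2} t * ?H t + indicator {1/2<..<1} t * ?H t)"
      unfolding len
    proof (rule Bochner_Integration.integral_cong_AE)
      have "AE t in lebesgue. t \<notin> {0, 1/2, 1 :: real}"
        by (rule AE_lebesgue_notin_finite) simp
      then show "AE t in lebesgue. ?H t = indicator {0<..<1/2} t * ?H t + indicator {1/2<..<1} t * ?H t"
        by eventually_elim (auto simp: indicator_def)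
    qed (use iA iB H in auto)
    also have "\<dots> = (LINT t|lebesgue. indicator {0<..<1/2} t * ?H t) + (LINT t|lebesgue. indicator {1/2<..<1} t * ?H t)"
      by (rule Bochner_Integration.integral_add[OF iA iB])
    also have "\<dots> \<le> norm (y - x) * M + agmon_length V E \<gamma>"
      by (rule add_mono[OF A B])
    finally show ?thesis .
  qed
qed

section \<open>Local Lipschitz bound for the Agmon distance\<close>

lemma ac_paths_nonempty: "ac_paths x y \<noteq> {}"
proof -
  have "abs_continuous_on {0..1} (linepath x y)"
  proof (rule abs_continuous_on_lipschitz[where L = "norm (y - x)"])
    fix s t :: real
    have "linepath x y t - linepath x y s = (t - s) *\<^sub>R (y - x)"
      by (simp add: linepath_def algebra_simps)
    then show "norm (linepath x y t - linepath x y s) \<le> norm (y - x) * \<bar>t - s\<bar>"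
      by (simp add: mult.commute)
  qed simp
  then have "linepath x y \<in> ac_paths x y"
    by (simp add: ac_paths_def linepath_def)
  then show ?thesis by blast
qed

text \<open>Every path from x to z, prefixed by the segment from y to x, competes in the infimum for
  y and z; the segment costs at most its Euclidean length times M.\<close>

lemma agmon_metric_le:
  fixes V :: "real ^ 'n \<Rightarrow> real"
  assumes "\<And>p. p \<in> closed_segment x y \<Longrightarrow> sqrt (max (V p - E) 0) \<le> M"
  shows "agmon_metric V E y z \<le> norm (y - x) * M + agmon_metric V E x z"
proof -
  have "agmon_metric V E y z - norm (y - x) * M \<le> agmon_length V E \<gamma>" if "\<gamma> \<in> ac_paths x z" for \<gamma>
  proof -
    have "agmon_metric V E y z \<le> agmon_length V E (prefix_segment y x \<gamma>)"
      unfolding agmon_metric_def using prefix_segment_ac_paths[OF that] agmon_length_nonneg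
      by (intro cINF_lower bdd_belowI[of _ 0]) auto
    also have "\<dots> \<le> norm (y - x) * M + agmon_length V E \<gamma>"
      by (rule agmon_length_prefix_segment[OF that assms])
    finally show ?thesis by simp
  qed
  then have "agmon_metric V E y z - norm (y - x) * M \<le> agmon_metric V E x z"
    unfolding agmon_metric_def[of V E x] by (intro cINF_greatest ac_paths_nonempty)
  then show ?thesis by simp
qed

lemma agmon_distance_nonneg: "0 \<le> agmon_distance V E x"
  unfolding agmon_distance_def agmon_metric_def
  by (intro cINF_greatest ac_paths_nonempty agmon_length_nonneg)

lemma agmon_distance_lipschitz:
  fixes V :: "real ^ 'n \<Rightarrow> real"
  assumes "\<And>p. p \<in> closed_segment x y \<Longrightarrow> sqrt (max (V p - E) 0) \<le> M"
  shows "\<bar>agmon_distance V E y - agmon_distance V E x\<bar> \<le> norm (y - x) * M"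
  using agmon_metric_le[of x y V E M 0] agmon_metric_le[of y x V E M 0] assms
  by (auto simp: agmon_distance_def closed_segment_commute norm_minus_commute abs_le_iff)

subsection \<open>Weighted estimate\<close>

text \<open>The cone cuts both height and support, its slope is 1 for every k, and it increases to
  infinity at each point as k grows.\<close>

definition cone_cutoff :: "real \<Rightarrow> ('a::real_normed_vector \<Rightarrow> real) \<Rightarrow> 'a \<Rightarrow> real" where
  "cone_cutoff k f x = min (f x) (max 0 (k - norm x))"

lemma cone_cutoff_bounds:
  assumes "f x \<ge> 0" "k \<ge> 0"
  shows "0 \<le> cone_cutoff k f x" "cone_cutoff k f x \<le> f x" "cone_cutoff k f x \<le> k"
  using assms norm_ge_zero[of x] by (auto simp: cone_cutoff_def min_le_iff_disj)

lemma cone_cutoff_support: "f x \<ge> 0 \<Longrightarrow> cone_cutoff k f x \<noteq> 0 \<Longrightarrow> norm x < k"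
  by (auto simp: cone_cutoff_def min_def max_def split: if_splits)

text \<open>The increment of f enters relative to f and multiplied by the cutoff g, not as such. A
  growth rate \<kappa> f of the weight thus becomes \<kappa> g, whose contribution is integrable and
  can be absorbed.\<close>

lemma cone_cutoff_diff_le:
  assumes f: "f x > 0" "f y > 0"
  shows "\<bar>cone_cutoff k f y - cone_cutoff k f x\<bar> \<le> norm (y - x) + cone_cutoff k f x * \<bar>f y - f x\<bar> / f x"
proof -
  define d b b' where "d = norm (y - x)" and "b = max 0 (k - norm x)" and "b' = max 0 (k - norm y)"
  have bb: "\<bar>b' - b\<bar> \<le> d" "0 \<le> b" "0 \<le> d"
    using norm_triangle_ineq3[of y x] by (auto simp: d_def b_def b'_def max_def)
  define m where "m = min (f x) b"
  have m: "0 \<le> m" "m \<le> f x" "m \<le> b"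
    using f bb by (auto simp: m_def)
  define r where "r = m * \<bar>f y - f x\<bar> / f x"
  have "0 \<le> r" using m f by (simp add: r_def)
  have key: "\<bar>min (f y) b' - m\<bar> \<le> d + r"
  proof (cases "f y \<ge> f x")
    case True
    have "f y * m / f x = m + r"
      using f True by (simp add: r_def field_simps)
    \<comment> \<open>Multiplying f by f y / f x \<ge> 1 raises its minimum with a fixed height by
      at most that factor; changing the height from b to b' adds at most d.\<close>
    moreover have "min (f y) b' \<le> f y * m / f x + d"
    proof (cases "f x \<le> b")
      case True
      then show ?thesis using f bb by (simp add: m_def)
    next
      case False
      then have "m = b" by (simp add: m_def)
      have "b * f x \<le> f y * b"
        using \<open>f y \<ge> f x\<close> bb by (simp add: mult.commute mult_left_mono)
      then have "b \<le> f y * m / f x"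
        using f \<open>m = b\<close> by (simp add: pos_le_divide_eq)
      then show ?thesis using bb by linarith
    qed
    moreover have "m - d \<le> min (f y) b'"
      using True m bb by linarith
    ultimately show ?thesis using \<open>0 \<le> r\<close> by linarith
  next
    case False
    \<comment> \<open>For a factor below 1 the scaled minimum stays below both f y and b, so up to d
      it is a lower bound.\<close>
    have eq: "m - r = f y * (m / f x)"
      using f False by (simp add: r_def field_simps)
    have "m / f x \<le> 1"
      using m f by simp
    then have "f y * (m / f x) \<le> f y * 1"
      using f by (intro mult_left_mono) auto
    moreover have "f y * (m / f x) \<le> f x * (m / f x)"
      using False m f by (intro mult_right_mono) auto
    moreover have "f x * (m / f x) = m"
      using f by simp
    ultimately have "m - r - d \<le> min (f y) b'"
      using bb m unfolding eq by linarith
    moreover have "min (f y) b' \<le> m + d"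
      using False bb by (auto simp: m_def)
    ultimately show ?thesis using \<open>0 \<le> r\<close> by linarith
  qed
  then show ?thesis
    by (simp add: cone_cutoff_def d_def b_def b'_def m_def r_def)
qed

lemma continuous_on_cone_cutoff: "continuous_on S f \<Longrightarrow> continuous_on S (cone_cutoff k f)"
  unfolding cone_cutoff_def[abs_def] by (intro continuous_intros)

text \<open>
  The weight grows like $\exp(o(1)\,\rho)$, so the factor $\kappa$ can be made small at the price of
  the additive constant \<open>M\<close>; this also absorbs the factor $n$ in \<open>green_inequality\<close>, which is
  why partial derivatives suffice.
\<close>

definition slowly_varying :: "(real ^ 'n \<Rightarrow> real) \<Rightarrow> (real ^ 'n \<Rightarrow> real) \<Rightarrow> bool" where
  "slowly_varying v f \<longleftrightarrow> (\<forall>\<kappa>>0. \<exists>M\<ge>0. \<forall>R. \<exists>t>0. \<forall>x d. norm x \<le> R \<and> norm d \<le> t \<longrightarrow>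
     \<bar>f (x + d) - f x\<bar> \<le> norm d * ((2 * \<kappa> * f x + M) * (v x + 1)))"

text \<open>The metric has disappeared: the weight enters through continuity, f \<ge> 1, slow
  variation relative to v and the L2 hypothesis on {V \<le> E + \<delta>}. All constants are fixed
  before the cutoff radius k, so the bound survives monotone convergence.\<close>

lemma weighted_bound:
  fixes V f u :: "real ^ 'n \<Rightarrow> real" and h :: "'n \<Rightarrow> real ^ 'n \<Rightarrow> real"
    and E b \<delta> B :: real
  defines "v \<equiv> \<lambda>x. sqrt (max (V x - E) 0)"
  assumes V: "continuous_on UNIV V" and b: "\<And>x. - b \<le> V x - E" and "b \<ge> 0" and "\<delta> > 0"
    and f: "continuous_on UNIV f" "\<And>x. f x \<ge> 1" "slowly_varying v f"
    and u: "u \<in> L2" and uB: "AE x in lebesgue. \<bar>u x\<bar> \<le> B" and Vu: "(\<lambda>x. V x * u x) \<in> L2"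
    and h: "\<And>i. h i \<in> L2" "\<And>i. has_weak_pderiv2 u i (h i)"
    and eq: "\<And>G B R. G \<in> borel_measurable lebesgue \<Longrightarrow> AE x in lebesgue. \<bar>G x\<bar> \<le> B \<Longrightarrow>
      (\<And>x. G x \<noteq> 0 \<Longrightarrow> norm x \<le> R) \<Longrightarrow>
      (LINT x|lebesgue. G x * (\<Sum>i\<in>UNIV. h i x)) = (LINT x|lebesgue. G x * ((V x - E) * u x))"
    and fL2: "(\<lambda>x. indicator {y. V y \<le> E + \<delta>} x * f x) \<in> L2"
  obtains C where "C \<ge> 0" "(\<integral>\<^sup>+x. ennreal ((f x)\<^sup>2 * (u x)\<^sup>2) \<partial>lebesgue) \<le> ennreal C"
proof -
  let ?A = "{y. V y \<le> E + \<delta>}" and ?n = "real CARD('n)"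
  have meas: "w \<in> borel_measurable lebesgue" if "continuous_on UNIV w" for w :: "real ^ 'n \<Rightarrow> real"
    using that by (intro measurable_completion) (simp add: borel_measurable_continuous_onI)
  have [measurable]: "u \<in> borel_measurable lebesgue" and u2: "integrable lebesgue (\<lambda>x. (u x)\<^sup>2)"
    using u by (auto simp: L2_real_iff)
  have vc: "continuous_on UNIV v"
    unfolding v_def by (intro continuous_intros V)
  have [measurable]: "V \<in> borel_measurable lebesgue" "f \<in> borel_measurable lebesgue" "v \<in> borel_measurable lebesgue"
    using meas V f vc by auto
  have v0: "v x \<ge> 0" for x by (simp add: v_def)
  have v2: "(v x)\<^sup>2 = max (V x - E) 0" for x by (simp add: v_def)
  have Am[measurable]: "?A \<in> sets lebesgue"
    using closed_Collect_le[OF V continuous_on_const] by (intro sets_completionI_sets) auto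
  have f0: "f x \<ge> 0" for x using f(2)[of x] by linarith
  \<comment> \<open>Finite because u and V u are in L2; this unweighted integral receives all
    contributions that do not scale with g.\<close>
  have iv: "integrable lebesgue (\<lambda>x. (1 + (v x)\<^sup>2) * (u x)\<^sup>2)"
  proof (rule Bochner_Integration.integrable_bound[where f = "\<lambda>x. (1 + \<bar>E\<bar>) * (u x)\<^sup>2 + \<bar>(V x * u x) * u x\<bar>"])
    show "integrable lebesgue (\<lambda>x. (1 + \<bar>E\<bar>) * (u x)\<^sup>2 + \<bar>(V x * u x) * u x\<bar>)"
      using u2 integrable_L2_mult[OF Vu u] by auto
    show "AE x in lebesgue. norm ((1 + (v x)\<^sup>2) * (u x)\<^sup>2) \<le> norm ((1 + \<bar>E\<bar>) * (u x)\<^sup>2 + \<bar>(V x * u x) * u x\<bar>)"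
    proof (intro always_eventually allI)
      fix x
      have "(1 + (v x)\<^sup>2) * (u x)\<^sup>2 \<le> (1 + \<bar>E\<bar> + \<bar>V x\<bar>) * (u x)\<^sup>2"
        unfolding v2 by (intro mult_right_mono) auto
      also have "\<dots> = (1 + \<bar>E\<bar>) * (u x)\<^sup>2 + \<bar>(V x * u x) * u x\<bar>"
        by (simp add: abs_mult power2_eq_square algebra_simps)
      finally show "norm ((1 + (v x)\<^sup>2) * (u x)\<^sup>2) \<le> norm ((1 + \<bar>E\<bar>) * (u x)\<^sup>2 + \<bar>(V x * u x) * u x\<bar>)"
        by simp
    qed
  qed measurable
  define I where "I = (LINT x|lebesgue. (1 + (v x)\<^sup>2) * (u x)\<^sup>2)"
  have iA: "integrable lebesgue (\<lambda>x. indicator ?A x * ((f x)\<^sup>2 * (u x)\<^sup>2))"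
  proof (rule Bochner_Integration.integrable_bound[where f = "\<lambda>x. B\<^sup>2 * (indicator ?A x * f x)\<^sup>2"])
    show "integrable lebesgue (\<lambda>x. B\<^sup>2 * (indicator ?A x * f x)\<^sup>2)"
      using fL2 by (auto simp: L2_real_iff)
    show "AE x in lebesgue. norm (indicator ?A x * ((f x)\<^sup>2 * (u x)\<^sup>2)) \<le> norm (B\<^sup>2 * (indicator ?A x * f x)\<^sup>2)"
      using uB
    proof eventually_elim
      case (elim x)
      then have "(u x)\<^sup>2 \<le> B\<^sup>2"
        by (metis abs_ge_zero power2_abs power_mono)
      then have "(f x)\<^sup>2 * (u x)\<^sup>2 \<le> (f x)\<^sup>2 * B\<^sup>2"
        by (intro mult_left_mono) auto
      then show ?case
        by (auto simp: indicator_def mult.commute)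
    qed
  qed measurable
  define J where "J = (LINT x|lebesgue. indicator ?A x * ((f x)\<^sup>2 * (u x)\<^sup>2))"
  have "I \<ge> 0" "J \<ge> 0"
    unfolding I_def J_def by (auto intro!: Bochner_Integration.integral_nonneg)
  \<comment> \<open>Chosen so that q = 16 n \<kappa>^2 satisfies q (1 + \<delta>) = \<delta> / 2;
    then the gradient error takes at most half of V - E where V - E > \<delta>.\<close>
  define \<kappa> where "\<kappa> = sqrt (\<delta> / (32 * ?n * (1 + \<delta>)))"
  have n0: "?n > 0" by simp
  have "\<kappa> > 0" using \<open>\<delta> > 0\<close> n0 by (simp add: \<kappa>_def)
  have \<kappa>2: "?n * (16 * \<kappa>\<^sup>2) * (1 + \<delta>) = \<delta> / 2"
  proof -
    have a: "N * (16 * (d / (32 * N * (1 + d)))) * (1 + d) = d / 2" if "N \<noteq> 0" "1 + d \<noteq> 0" for N d :: real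
      using that by (simp add: divide_simps)
    have k2: "\<kappa>\<^sup>2 = \<delta> / (32 * ?n * (1 + \<delta>))"
      using \<open>\<delta> > 0\<close> by (simp add: \<kappa>_def)
    show ?thesis
      unfolding k2 by (rule a) (use \<open>\<delta> > 0\<close> n0 in auto)
  qed
  obtain M where "M \<ge> 0" and M: "\<And>R. \<exists>t>0. \<forall>x d. norm x \<le> R \<and> norm d \<le> t \<longrightarrow>
     \<bar>f (x + d) - f x\<bar> \<le> norm d * ((2 * \<kappa> * f x + M) * (v x + 1))"
    using f(3) \<open>\<kappa> > 0\<close> unfolding slowly_varying_def by blast
  \<comment> \<open>C0 comes from (1 + p + q)^2 \<le> 4 + 4 p^2 + 2 q^2 with p = M (v + 1), together
    with (v + 1)^2 \<le> 2 (1 + v^2).\<close>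
  define C0 where "C0 = 4 + 8 * M\<^sup>2"
  \<comment> \<open>On {V \<le> E + \<delta>} one has V - E \<ge> - b and a gradient error of at
    most \<delta> / 2, so adding L makes the balance nonnegative. C solves (\<delta> / 2) C = n C0 I
    + (L + \<delta> / 2) J.\<close>
  define L where "L = b + \<delta> / 2"
  define C where "C = J + (2 / \<delta>) * (?n * C0 * I + L * J)"
  have "C0 \<ge> 0" "L \<ge> 0" using \<open>b \<ge> 0\<close> \<open>\<delta> > 0\<close> by (auto simp: C0_def L_def)
  have "C \<ge> 0"
    unfolding C_def using \<open>J \<ge> 0\<close> \<open>I \<ge> 0\<close> \<open>C0 \<ge> 0\<close> \<open>L \<ge> 0\<close> \<open>\<delta> > 0\<close> by (intro add_nonneg_nonneg mult_nonneg_nonneg) auto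
  let ?g = "\<lambda>k. cone_cutoff (real k) f"
  have g: "0 \<le> ?g k x" "?g k x \<le> f x" "?g k x \<le> real k" for k x
    using cone_cutoff_bounds[of f x "real k"] f0 by auto
  have gc: "continuous_on UNIV (?g k)" for k
    by (rule continuous_on_cone_cutoff[OF f(1)])
  have [measurable]: "?g k \<in> borel_measurable lebesgue" for k
    by (rule meas[OF gc])
  have ibd: "integrable lebesgue (\<lambda>x. (?g k x)\<^sup>2 * w x)"
    if "integrable lebesgue w" for k and w :: "real ^ 'n \<Rightarrow> real"
  proof (rule Bochner_Integration.integrable_bound[where f = "\<lambda>x. (real k)\<^sup>2 * w x"])
    have [measurable]: "w \<in> borel_measurable lebesgue" using that by simp
    show "(\<lambda>x. (?g k x)\<^sup>2 * w x) \<in> borel_measurable lebesgue" by measurable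
    show "AE x in lebesgue. norm ((?g k x)\<^sup>2 * w x) \<le> norm ((real k)\<^sup>2 * w x)"
      using g by (intro always_eventually allI) (auto simp: abs_mult intro!: mult_right_mono power_mono)
  qed (use that in auto)
  have main: "(LINT x|lebesgue. (?g k x)\<^sup>2 * (u x)\<^sup>2) \<le> C" for k
  proof -
    \<comment> \<open>The 1 is the slope of the cone; the rest is the slow variation of f, with f
      already replaced by the cutoff.\<close>
    define W where "W x = 1 + (2 * \<kappa> * ?g k x + M) * (v x + 1)" for x
    have W0: "W x \<ge> 0" for x
      unfolding W_def using g(1) v0[of x] \<open>\<kappa> > 0\<close> \<open>M \<ge> 0\<close> by (intro add_nonneg_nonneg mult_nonneg_nonneg) auto
    have [measurable]: "W \<in> borel_measurable lebesgue"
      unfolding W_def[abs_def] by measurable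
    have W2: "(W x)\<^sup>2 \<le> C0 * (1 + (v x)\<^sup>2) + 16 * \<kappa>\<^sup>2 * ((?g k x)\<^sup>2 * (1 + (v x)\<^sup>2))" for x
    proof -
      have sq: "(p + q)\<^sup>2 \<le> 2 * p\<^sup>2 + 2 * q\<^sup>2" for p q :: real
        using zero_le_power2[of "p - q"] by (simp add: power2_eq_square algebra_simps)
      have sq3: "(1 + p + q)\<^sup>2 \<le> 4 + 4 * p\<^sup>2 + 2 * q\<^sup>2" for p q :: real
        using sq[of 1 p] sq[of "1 + p" q] by (simp add: power2_eq_square algebra_simps)
      have s1: "(v x + 1)\<^sup>2 \<le> 2 * (1 + (v x)\<^sup>2)"
        using sq[of "v x" 1] by simp
      have "(W x)\<^sup>2 = ((1 + M * (v x + 1)) + (2 * \<kappa> * ?g k x) * (v x + 1))\<^sup>2"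
        by (simp add: W_def algebra_simps)
      also have "\<dots> \<le> 4 + 4 * (M * (v x + 1))\<^sup>2 + 2 * ((2 * \<kappa> * ?g k x) * (v x + 1))\<^sup>2"
        by (rule sq3)
      also have "\<dots> = 4 + (4 * M\<^sup>2) * (v x + 1)\<^sup>2 + (8 * \<kappa>\<^sup>2 * (?g k x)\<^sup>2) * (v x + 1)\<^sup>2"
        by (simp add: power_mult_distrib)
      also have "\<dots> \<le> 4 + (4 * M\<^sup>2) * (2 * (1 + (v x)\<^sup>2)) + (8 * \<kappa>\<^sup>2 * (?g k x)\<^sup>2) * (2 * (1 + (v x)\<^sup>2))"
        by (intro add_mono mult_left_mono s1) auto
      also have "\<dots> \<le> C0 * (1 + (v x)\<^sup>2) + 16 * \<kappa>\<^sup>2 * ((?g k x)\<^sup>2 * (1 + (v x)\<^sup>2))"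
        by (simp add: C0_def algebra_simps)
      finally show ?thesis .
    qed
    have iW: "integrable lebesgue (\<lambda>x. C0 * ((1 + (v x)\<^sup>2) * (u x)\<^sup>2)
        + 16 * \<kappa>\<^sup>2 * ((?g k x)\<^sup>2 * ((1 + (v x)\<^sup>2) * (u x)\<^sup>2)))"
      by (intro Bochner_Integration.integrable_add integrable_mult_right iv ibd)
    have Wle: "(W x)\<^sup>2 * (u x)\<^sup>2 \<le> C0 * ((1 + (v x)\<^sup>2) * (u x)\<^sup>2)
        + 16 * \<kappa>\<^sup>2 * ((?g k x)\<^sup>2 * ((1 + (v x)\<^sup>2) * (u x)\<^sup>2))" for x
      using mult_right_mono[OF W2[of x], of "(u x)\<^sup>2"] by (simp add: algebra_simps)
    have iWu: "integrable lebesgue (\<lambda>x. (W x)\<^sup>2 * (u x)\<^sup>2)"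
      by (rule Bochner_Integration.integrable_bound[OF iW])
        (use Wle in \<open>auto intro!: always_eventually intro: order_trans[OF _ abs_ge_self]\<close>)
    have "(LINT x|lebesgue. (?g k x)\<^sup>2 * u x * (\<Sum>i\<in>UNIV. h i x)) \<le> ?n * (LINT x|lebesgue. (W x)\<^sup>2 * (u x)\<^sup>2)"
    proof (rule green_inequality[OF u uB h gc])
      show "\<bar>?g k x\<bar> \<le> real k" for x using g[of k x] by simp
      show "norm x \<le> real k" if "?g k x \<noteq> 0" for x
        using cone_cutoff_support[OF f0 that] by simp
      fix i :: 'n
      \<comment> \<open>Radius k + 1 suffices: for a step of length at most 1 from a point farther
        out, both ends lie outside the support of the cutoff.\<close>
      obtain t where t: "t > 0" "\<And>x d. norm x \<le> real k + 1 \<Longrightarrow> norm d \<le> t \<Longrightarrow>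
          \<bar>f (x + d) - f x\<bar> \<le> norm d * ((2 * \<kappa> * f x + M) * (v x + 1))"
        using M[of "real k + 1"] by blast
      have est: "\<bar>?g k (x + d) - ?g k x\<bar> \<le> norm d * W x" if d: "norm d \<le> t" "norm d \<le> 1" for x d
      proof (cases "norm x \<le> real k + 1")
        case True
        have fx: "f x > 0" "f (x + d) > 0" using f(2)[of x] f(2)[of "x + d"] by linarith+
        have r: "0 \<le> ?g k x / f x" "?g k x / f x \<le> 1"
          using g[of k x] fx by auto
        have "?g k x * \<bar>f (x + d) - f x\<bar> / f x = (?g k x / f x) * \<bar>f (x + d) - f x\<bar>" by simp
        also have "\<dots> \<le> (?g k x / f x) * (norm d * ((2 * \<kappa> * f x + M) * (v x + 1)))"
          by (intro mult_left_mono t(2) True d r)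
        also have "\<dots> = norm d * ((2 * \<kappa> * ?g k x + M * (?g k x / f x)) * (v x + 1))"
          using fx by (simp add: field_simps)
        also have "\<dots> \<le> norm d * ((2 * \<kappa> * ?g k x + M * 1) * (v x + 1))"
          using v0[of x] r \<open>M \<ge> 0\<close> by (intro mult_left_mono mult_right_mono add_left_mono) auto
        finally show ?thesis
          using cone_cutoff_diff_le[of f x "x + d" "real k"] fx by (simp add: W_def algebra_simps)
      next
        case False
        have "norm x \<le> norm (x + d) + norm d"
          using norm_triangle_ineq4[of "x + d" d] by simp
        then have "\<not> norm (x + d) < real k" "\<not> norm x < real k"
          using False d by linarith+
        then have "?g k (x + d) = 0" "?g k x = 0"
          using cone_cutoff_support f0 by blast+
        then show ?thesis using W0[of x] by simp
      qed
      have "\<forall>\<^sub>F s in at_right 0. 0 < s \<and> s < min t 1"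
        using t(1) eventually_at_right_real[of 0 "min t 1"] by (auto elim: eventually_mono)
      then show "\<forall>\<^sub>F s in at_right 0. \<forall>x. \<bar>?g k (x + s *\<^sub>R axis i 1) - ?g k x\<bar> \<le> s * W x \<and>
          \<bar>?g k (x - s *\<^sub>R axis i 1) - ?g k x\<bar> \<le> s * W x"
      proof eventually_elim
        case (elim s)
        then show ?case
          using est[of "s *\<^sub>R axis i 1"] est[of "- (s *\<^sub>R axis i 1)"] by simp
      qed
    qed (rule iWu)
    also have "(LINT x|lebesgue. (?g k x)\<^sup>2 * u x * (\<Sum>i\<in>UNIV. h i x)) =
        (LINT x|lebesgue. (?g k x)\<^sup>2 * u x * ((V x - E) * u x))"
    proof (rule eq)
      show "AE x in lebesgue. \<bar>(?g k x)\<^sup>2 * u x\<bar> \<le> (real k)\<^sup>2 * \<bar>B\<bar>"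
        using uB
      proof eventually_elim
        case (elim x)
        have "(?g k x)\<^sup>2 \<le> (real k)\<^sup>2" using g[of k x] by (intro power_mono) auto
        then show ?case unfolding abs_mult using elim by (intro mult_mono) auto
      qed
      show "norm x \<le> real k" if "(?g k x)\<^sup>2 * u x \<noteq> 0" for x
        using cone_cutoff_support[of f x "real k"] f0[of x] that by auto
    qed measurable
    also have "(LINT x|lebesgue. (?g k x)\<^sup>2 * u x * ((V x - E) * u x)) = (LINT x|lebesgue. (?g k x)\<^sup>2 * ((V x - E) * (u x)\<^sup>2))"
      by (simp add: power2_eq_square mult_ac)
    finally have gr: "(LINT x|lebesgue. (?g k x)\<^sup>2 * ((V x - E) * (u x)\<^sup>2)) \<le> ?n * (LINT x|lebesgue. (W x)\<^sup>2 * (u x)\<^sup>2)" .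
    have iVE: "integrable lebesgue (\<lambda>x. (V x - E) * (u x)\<^sup>2)"
    proof -
      have "integrable lebesgue (\<lambda>x. (V x * u x) * u x - E * (u x)\<^sup>2)"
        using u2 integrable_L2_mult[OF Vu u] by auto
      then show ?thesis by (simp add: power2_eq_square algebra_simps)
    qed
    have WI: "(LINT x|lebesgue. (W x)\<^sup>2 * (u x)\<^sup>2) \<le>
        C0 * I + 16 * \<kappa>\<^sup>2 * (LINT x|lebesgue. (?g k x)\<^sup>2 * ((1 + (v x)\<^sup>2) * (u x)\<^sup>2))"
    proof -
      have "(LINT x|lebesgue. (W x)\<^sup>2 * (u x)\<^sup>2) \<le> (LINT x|lebesgue. C0 * ((1 + (v x)\<^sup>2) * (u x)\<^sup>2)
        + 16 * \<kappa>\<^sup>2 * ((?g k x)\<^sup>2 * ((1 + (v x)\<^sup>2) * (u x)\<^sup>2)))"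
        by (intro integral_mono iWu iW Wle)
      also have "\<dots> = C0 * I + 16 * \<kappa>\<^sup>2 * (LINT x|lebesgue. (?g k x)\<^sup>2 * ((1 + (v x)\<^sup>2) * (u x)\<^sup>2))"
        using iv ibd[OF iv] by (simp add: I_def)
      finally show ?thesis .
    qed
    \<comment> \<open>Absorption is done pointwise: where V > E + \<delta> the potential term pays
      for the gradient error with at least \<delta> / 2 to spare, elsewhere the last summand
      pays.\<close>
    have "(\<delta> / 2) * (LINT x|lebesgue. (?g k x)\<^sup>2 * (u x)\<^sup>2) =
        (LINT x|lebesgue. (\<delta> / 2) * ((?g k x)\<^sup>2 * (u x)\<^sup>2))" by simp
    also have "\<dots> \<le> (LINT x|lebesgue. (?g k x)\<^sup>2 * ((V x - E) * (u x)\<^sup>2)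
        - ?n * (16 * \<kappa>\<^sup>2) * ((?g k x)\<^sup>2 * ((1 + (v x)\<^sup>2) * (u x)\<^sup>2))
        + (L + \<delta> / 2) * (indicator ?A x * ((f x)\<^sup>2 * (u x)\<^sup>2)))"
    proof (rule integral_mono)
      fix x
      define q where "q = ?n * (16 * \<kappa>\<^sup>2)"
      have q0: "q \<ge> 0" by (simp add: q_def)
      have qd: "q * (1 + \<delta>) = \<delta> / 2" using \<kappa>2 by (simp add: q_def)
      have "\<delta> / 2 * (?g k x)\<^sup>2 \<le> (?g k x)\<^sup>2 * (V x - E) - q * ((?g k x)\<^sup>2 * (1 + (v x)\<^sup>2))
          + (L + \<delta> / 2) * (indicator ?A x * (f x)\<^sup>2)"
      proof (cases "V x \<le> E + \<delta>")
        case True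
        have "q * (1 + (v x)\<^sup>2) \<le> q * (1 + \<delta>)"
          using True \<open>\<delta> > 0\<close> q0 by (intro mult_left_mono) (auto simp: v2)
        then have "0 \<le> V x - E - q * (1 + (v x)\<^sup>2) + L"
          using b[of x] qd unfolding L_def by linarith
        then have "0 \<le> (?g k x)\<^sup>2 * (V x - E - q * (1 + (v x)\<^sup>2) + L)" by simp
        moreover have "(L + \<delta> / 2) * (?g k x)\<^sup>2 \<le> (L + \<delta> / 2) * (f x)\<^sup>2"
          using g[of k x] \<open>L \<ge> 0\<close> \<open>\<delta> > 0\<close> by (intro mult_left_mono power_mono) auto
        ultimately show ?thesis
          using True by (simp add: algebra_simps)
      next
        case False
        define w where "w = V x - E"
        have w: "w > \<delta>" "(v x)\<^sup>2 = w" using False \<open>\<delta> > 0\<close> by (auto simp: w_def v2)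
        \<comment> \<open>\<delta> (1 + w) \<le> (1 + \<delta>) w because \<delta> \<le> w, so the
          normalization of q at \<delta> covers all larger w.\<close>
        have "\<delta> * (q * (1 + w)) \<le> q * (1 + \<delta>) * w"
          using mult_left_mono[of \<delta> w q] w q0 by (simp add: algebra_simps)
        then have "\<delta> * (q * (1 + w)) \<le> \<delta> * (w / 2)"
          unfolding qd by simp
        then have "q * (1 + w) \<le> w / 2"
          by (simp only: mult_le_cancel_left_pos[OF \<open>\<delta> > 0\<close>])
        then have "0 \<le> w - q * (1 + w) - \<delta> / 2"
          using w by linarith
        then have "0 \<le> (?g k x)\<^sup>2 * (w - q * (1 + w) - \<delta> / 2)" by simp
        then show ?thesis
          using False w by (simp add: algebra_simps flip: w_def)
      qed
      from mult_right_mono[OF this, of "(u x)\<^sup>2"]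
      show "\<delta> / 2 * ((?g k x)\<^sup>2 * (u x)\<^sup>2) \<le> (?g k x)\<^sup>2 * ((V x - E) * (u x)\<^sup>2)
        - ?n * (16 * \<kappa>\<^sup>2) * ((?g k x)\<^sup>2 * ((1 + (v x)\<^sup>2) * (u x)\<^sup>2))
        + (L + \<delta> / 2) * (indicator ?A x * ((f x)\<^sup>2 * (u x)\<^sup>2))"
        unfolding q_def[symmetric] by (simp add: algebra_simps)
    qed (intro Bochner_Integration.integrable_add Bochner_Integration.integrable_diff integrable_mult_right ibd iA iVE iv u2)+
    also have "\<dots> = (LINT x|lebesgue. (?g k x)\<^sup>2 * ((V x - E) * (u x)\<^sup>2))
        - ?n * (16 * \<kappa>\<^sup>2) * (LINT x|lebesgue. (?g k x)\<^sup>2 * ((1 + (v x)\<^sup>2) * (u x)\<^sup>2)) + (L + \<delta> / 2) * J"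
      unfolding J_def using ibd[OF iVE] ibd[OF iv] iA by simp
    also have "\<dots> \<le> ?n * C0 * I + (L + \<delta> / 2) * J"
      using gr mult_left_mono[OF WI, of ?n] by (simp add: algebra_simps)
    also have "\<dots> = (\<delta> / 2) * C"
      using \<open>\<delta> > 0\<close> by (simp add: C_def field_simps)
    finally show ?thesis
      using \<open>\<delta> > 0\<close> by simp
  qed
  have "(\<integral>\<^sup>+x. ennreal ((f x)\<^sup>2 * (u x)\<^sup>2) \<partial>lebesgue) = (\<integral>\<^sup>+x. (SUP k. ennreal ((?g k x)\<^sup>2 * (u x)\<^sup>2)) \<partial>lebesgue)"
  proof (intro nn_integral_cong antisym SUP_least ennreal_leI mult_right_mono power_mono)
    fix x
    \<comment> \<open>Once k - |x| \<ge> f x the cutoff no longer acts at x, so the supremum is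
      attained.\<close>
    obtain k :: nat where k: "f x + norm x \<le> real k" using real_arch_simple by blast
    then have "?g k x = f x" using f0[of x] by (simp add: cone_cutoff_def)
    then show "ennreal ((f x)\<^sup>2 * (u x)\<^sup>2) \<le> (SUP k. ennreal ((?g k x)\<^sup>2 * (u x)\<^sup>2))"
      by (intro SUP_upper2[of k]) auto
  qed (use g in auto)
  also have "\<dots> = (SUP k. \<integral>\<^sup>+x. ennreal ((?g k x)\<^sup>2 * (u x)\<^sup>2) \<partial>lebesgue)"
  proof (rule nn_integral_monotone_convergence_SUP)
    have "?g k x \<le> ?g l x" if "k \<le> l" for k l x
      using that by (auto simp: cone_cutoff_def)
    then show "incseq (\<lambda>k x. ennreal ((?g k x)\<^sup>2 * (u x)\<^sup>2))"
      using g by (auto simp: incseq_def le_fun_def intro!: ennreal_leI mult_right_mono power_mono)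
  qed measurable
  also have "\<dots> \<le> ennreal C"
  proof (rule SUP_least)
    fix k
    have "(\<integral>\<^sup>+x. ennreal ((?g k x)\<^sup>2 * (u x)\<^sup>2) \<partial>lebesgue) = ennreal (LINT x|lebesgue. (?g k x)\<^sup>2 * (u x)\<^sup>2)"
      by (intro nn_integral_eq_integral ibd u2) auto
    also have "\<dots> \<le> ennreal C" using main by (rule ennreal_leI)
    finally show "(\<integral>\<^sup>+x. ennreal ((?g k x)\<^sup>2 * (u x)\<^sup>2) \<partial>lebesgue) \<le> ennreal C" .
  qed
  finally show ?thesis
    using that \<open>C \<ge> 0\<close> by blast
qed

section \<open>The weight built from the Agmon distance\<close>

lemma continuous_on_agmon_distance:
  fixes V :: "real ^ 'n \<Rightarrow> real"
  assumes V: "continuous_on UNIV V"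
  shows "continuous_on UNIV (agmon_distance V E)"
proof (rule continuous_at_imp_continuous_on, rule ballI)
  fix x :: "real ^ 'n"
  have "continuous_on (cball x 1) (\<lambda>x. sqrt (max (V x - E) 0))"
    by (intro continuous_intros continuous_on_subset[OF V]) simp
  then have "compact ((\<lambda>x. sqrt (max (V x - E) 0)) ` cball x 1)"
    by (rule compact_continuous_image) simp
  then have "bdd_above ((\<lambda>x. sqrt (max (V x - E) 0)) ` cball x 1)"
    by (intro bounded_imp_bdd_above compact_imp_bounded)
  then obtain M where M: "\<And>p. p \<in> cball x 1 \<Longrightarrow> sqrt (max (V p - E) 0) \<le> M"
    unfolding bdd_above_def by blast
  have "\<forall>\<^sub>F y in at x. norm (agmon_distance V E y - agmon_distance V E x) \<le> norm (y - x) * M"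
    unfolding eventually_at
  proof (intro exI[of _ 1] conjI ballI impI)
    fix y assume "y \<noteq> x \<and> dist y x < 1"
    then have "closed_segment x y \<subseteq> cball x 1"
      by (intro closed_segment_subset) (auto simp: dist_commute)
    then show "norm (agmon_distance V E y - agmon_distance V E x) \<le> norm (y - x) * M"
      unfolding real_norm_def using M by (intro agmon_distance_lipschitz) blast
  qed simp
  moreover have "((\<lambda>y. norm (y - x) * M) \<longlongrightarrow> 0) (at x)"
    by (intro tendsto_mult_left_zero tendsto_norm_zero LIM_zero tendsto_ident_at)
  ultimately have "((\<lambda>y. agmon_distance V E y - agmon_distance V E x) \<longlongrightarrow> 0) (at x)"
    by (rule Lim_null_comparison)
  then show "isCont (agmon_distance V E) x"
    unfolding isCont_def by (rule LIM_zero_cancel)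
qed

text \<open>The limit of \<phi>' / \<phi> gives the factor \<kappa> on a tail; on the compact
  initial interval the continuous \<phi>' is bounded, which supplies M.\<close>

lemma derivative_le_small_multiple:
  fixes \<phi> \<phi>' :: "real \<Rightarrow> real"
  assumes \<phi>': "continuous_on {0..} \<phi>'" and ge1: "\<And>t. t \<ge> 0 \<Longrightarrow> \<phi> t \<ge> 1"
    and lim: "((\<lambda>t. \<phi>' t / \<phi> t) \<longlongrightarrow> 0) at_top" and "\<kappa> > 0"
  obtains M where "M \<ge> 0" "\<And>s. s \<ge> 0 \<Longrightarrow> \<bar>\<phi>' s\<bar> \<le> \<kappa> * \<phi> s + M"
proof -
  have "\<forall>\<^sub>F t in at_top. dist (\<phi>' t / \<phi> t) 0 < \<kappa>"
    using lim \<open>\<kappa> > 0\<close> by (rule tendstoD)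
  then obtain s0 where s0: "\<And>t. t \<ge> s0 \<Longrightarrow> \<bar>\<phi>' t / \<phi> t\<bar> < \<kappa>"
    by (auto simp: eventually_at_top_linorder)
  have "compact (\<phi>' ` {0..\<bar>s0\<bar>})"
    by (intro compact_continuous_image continuous_on_subset[OF \<phi>']) auto
  then obtain M where M: "\<And>s. s \<in> {0..\<bar>s0\<bar>} \<Longrightarrow> \<bar>\<phi>' s\<bar> \<le> M"
    using compact_imp_bounded bounded_iff by (metis imageI real_norm_def)
  have "M \<ge> 0" using M[of 0] by simp
  moreover have "\<bar>\<phi>' s\<bar> \<le> \<kappa> * \<phi> s + M" if "s \<ge> 0" for s
  proof (cases "s \<le> \<bar>s0\<bar>")
    case True
    have "0 \<le> \<kappa> * \<phi> s"
      using ge1[OF that] \<open>\<kappa> > 0\<close> by simp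
    then show ?thesis using M[of s] True that by simp
  next
    case False
    have "\<bar>\<phi>' s\<bar> / \<phi> s < \<kappa>"
      using s0[of s] False ge1[OF that] by (simp add: abs_divide)
    then have "\<bar>\<phi>' s\<bar> < \<kappa> * \<phi> s"
      using ge1[OF that] by (simp add: pos_divide_less_eq)
    then show ?thesis using \<open>M \<ge> 0\<close> by simp
  qed
  ultimately show ?thesis using that by blast
qed

lemma continuous_on_agmon_weight:
  fixes V :: "real ^ 'n \<Rightarrow> real"
  assumes V: "continuous_on UNIV V" and \<phi>: "continuous_on {0..} \<phi>" and "a \<ge> 0"
  shows "continuous_on UNIV (\<lambda>x. \<phi> (a * agmon_distance V E x))"
  by (rule continuous_on_compose2[OF \<phi>])
    (auto intro!: continuous_intros continuous_on_agmon_distance V mult_nonneg_nonneg \<open>a \<ge> 0\<close> agmon_distance_nonneg)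

text \<open>Combine the growth bound for \<phi> with the Lipschitz bound for \<rho>_E. M depends on
  \<kappa> alone; only the step size t depends on the radius, through uniform continuity of v and f
  on a ball. The allowance v + 1 bounds v along the whole segment.\<close>

lemma slowly_varying_agmon_weight:
  fixes V :: "real ^ 'n \<Rightarrow> real"
  assumes V: "continuous_on UNIV V" and a: "0 \<le> a" "a \<le> 1"
    and deriv: "\<And>t. t \<ge> 0 \<Longrightarrow> (\<phi> has_real_derivative \<phi>' t) (at t within {0..})"
    and \<phi>': "continuous_on {0..} \<phi>'" and mono: "mono_on {0..} \<phi>"
    and ge1: "\<And>t. t \<ge> 0 \<Longrightarrow> \<phi> t \<ge> 1" and lim: "((\<lambda>t. \<phi>' t / \<phi> t) \<longlongrightarrow> 0) at_top"
  shows "slowly_varying (\<lambda>x. sqrt (max (V x - E) 0)) (\<lambda>x. \<phi> (a * agmon_distance V E x))"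
  unfolding slowly_varying_def
proof (intro allI impI)
  fix \<kappa> :: real assume "\<kappa> > 0"
  let ?\<rho> = "agmon_distance V E" and ?v = "\<lambda>x. sqrt (max (V x - E) 0)"
  let ?f = "\<lambda>x. \<phi> (a * ?\<rho> x)"
  obtain M where "M \<ge> 0" and M: "\<And>s. s \<ge> 0 \<Longrightarrow> \<bar>\<phi>' s\<bar> \<le> \<kappa> * \<phi> s + M"
    using derivative_le_small_multiple[OF \<phi>' ge1 lim \<open>\<kappa> > 0\<close>] by blast
  have \<rho>0: "0 \<le> a * ?\<rho> x" for x
    using a agmon_distance_nonneg[of V E x] by simp
  \<comment> \<open>By monotonicity \<phi> is largest at the right endpoint, so the mean value
    inequality closes without a Gronwall argument.\<close>
  have \<phi>lip: "\<bar>\<phi> t - \<phi> s\<bar> \<le> (\<kappa> * max (\<phi> s) (\<phi> t) + M) * \<bar>t - s\<bar>" if "s \<ge> 0" "t \<ge> 0" for s t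
  proof -
    define S where "S = {min s t..max s t}"
    have S: "S \<subseteq> {0..}" using that by (auto simp: S_def)
    have "norm (\<phi> t - \<phi> s) \<le> (\<kappa> * max (\<phi> s) (\<phi> t) + M) * norm (t - s)"
    proof (rule field_differentiable_bound[of S \<phi> \<phi>'])
      show "(\<phi> has_real_derivative \<phi>' z) (at z within S)" if "z \<in> S" for z
        using that S by (intro DERIV_subset[OF deriv]) auto
      show "norm (\<phi>' z) \<le> \<kappa> * max (\<phi> s) (\<phi> t) + M" if z: "z \<in> S" for z
      proof -
        have "\<phi> z \<le> \<phi> (max s t)"
          using z S \<open>s \<ge> 0\<close> by (intro mono_onD[OF mono]) (auto simp: S_def)
        also have "\<dots> \<le> max (\<phi> s) (\<phi> t)" by (simp add: max_def)
        finally have "\<kappa> * \<phi> z \<le> \<kappa> * max (\<phi> s) (\<phi> t)"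
          using \<open>\<kappa> > 0\<close> by simp
        then show ?thesis using M[of z] z S by auto
      qed
    qed (auto simp: S_def)
    then show ?thesis by simp
  qed
  have fc: "continuous_on UNIV ?f"
    using deriv a by (intro continuous_on_agmon_weight V DERIV_continuous_on) auto
  have vc: "continuous_on UNIV ?v"
    by (intro continuous_intros V)
  show "\<exists>M\<ge>0. \<forall>R. \<exists>t>0. \<forall>x d. norm x \<le> R \<and> norm d \<le> t \<longrightarrow>
      \<bar>?f (x + d) - ?f x\<bar> \<le> norm d * ((2 * \<kappa> * ?f x + M) * (?v x + 1))"
  proof (rule exI[of _ M], rule conjI[OF \<open>M \<ge> 0\<close>], rule allI)
    fix R :: real
    have uc: "uniformly_continuous_on (cball 0 (R + 1)) ?v" "uniformly_continuous_on (cball 0 (R + 1)) ?f"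
      using vc fc by (auto intro!: compact_uniformly_continuous intro: continuous_on_subset)
    obtain t1 where t1: "t1 > 0" "\<And>x y. x \<in> cball 0 (R + 1) \<Longrightarrow> y \<in> cball 0 (R + 1) \<Longrightarrow> dist y x < t1 \<Longrightarrow> dist (?v y) (?v x) < 1"
      using uc(1) unfolding uniformly_continuous_on_def by (metis zero_less_one)
    obtain t2 where t2: "t2 > 0" "\<And>x y. x \<in> cball 0 (R + 1) \<Longrightarrow> y \<in> cball 0 (R + 1) \<Longrightarrow> dist y x < t2 \<Longrightarrow> dist (?f y) (?f x) < 1"
      using uc(2) unfolding uniformly_continuous_on_def by (metis zero_less_one)
    define t where "t = min 1 (min t1 t2) / 2"
    have t: "t > 0" "t < 1" "t < t1" "t < t2" using t1(1) t2(1) by (auto simp: t_def)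
    show "\<exists>t>0. \<forall>x d. norm x \<le> R \<and> norm d \<le> t \<longrightarrow>
      \<bar>?f (x + d) - ?f x\<bar> \<le> norm d * ((2 * \<kappa> * ?f x + M) * (?v x + 1))"
    proof (intro exI[of _ t] conjI allI impI)
      fix x d :: "real ^ 'n" assume "norm x \<le> R \<and> norm d \<le> t"
      then have x: "norm x \<le> R" and d: "norm d \<le> t" by auto
      have near: "y \<in> cball 0 (R + 1)" "dist y x < t1" "dist y x < t2" if "y \<in> closed_segment x (x + d)" for y
      proof -
        have "norm (y - x) \<le> norm d"
          using segment_bound(1)[OF that] by simp
        then show "dist y x < t1" "dist y x < t2" "y \<in> cball 0 (R + 1)"
          using d t x norm_triangle_sub[of y x] by (auto simp: dist_norm)
      qed
      have x': "x \<in> cball 0 (R + 1)" using x by simp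
      have "?v p \<le> ?v x + 1" if "p \<in> closed_segment x (x + d)" for p
        using t1(2)[OF x' near(1)[OF that] near(2)[OF that]] by (auto simp: dist_real_def)
      then have "\<bar>?\<rho> (x + d) - ?\<rho> x\<bar> \<le> norm (x + d - x) * (?v x + 1)"
        by (rule agmon_distance_lipschitz)
      then have \<rho>: "\<bar>?\<rho> (x + d) - ?\<rho> x\<bar> \<le> norm d * (?v x + 1)" by simp
      have "\<bar>a * ?\<rho> (x + d) - a * ?\<rho> x\<bar> = a * \<bar>?\<rho> (x + d) - ?\<rho> x\<bar>"
        using a by (simp add: abs_mult flip: right_diff_distrib)
      also have "\<dots> \<le> 1 * \<bar>?\<rho> (x + d) - ?\<rho> x\<bar>"
        using a by (intro mult_right_mono) auto
      finally have a\<rho>: "\<bar>a * ?\<rho> (x + d) - a * ?\<rho> x\<bar> \<le> norm d * (?v x + 1)"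
        using \<rho> by simp
      have f1: "?f x \<ge> 1" by (rule ge1[OF \<rho>0])
      have "\<bar>?f (x + d) - ?f x\<bar> < 1"
        using t2(2)[OF x' near(1,3), of "x + d"] by (simp add: dist_real_def)
      \<comment> \<open>An increment below 1 is at most \<open>?f x\<close>, since the weight is at
        least 1; this is the origin of the factor 2 in 2 \<kappa>.\<close>
      then have "max (?f x) (?f (x + d)) \<le> 2 * ?f x"
        using f1 by auto
      then have k: "\<kappa> * max (?f x) (?f (x + d)) + M \<le> 2 * \<kappa> * ?f x + M"
        using mult_left_mono[of "max (?f x) (?f (x + d))" "2 * ?f x" \<kappa>] \<open>\<kappa> > 0\<close> by simp
      have "\<bar>?f (x + d) - ?f x\<bar> \<le> (\<kappa> * max (?f x) (?f (x + d)) + M) * \<bar>a * ?\<rho> (x + d) - a * ?\<rho> x\<bar>"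
        by (rule \<phi>lip[OF \<rho>0 \<rho>0])
      also have "\<dots> \<le> (2 * \<kappa> * ?f x + M) * (norm d * (?v x + 1))"
        using k a\<rho> f1 \<open>\<kappa> > 0\<close> \<open>M \<ge> 0\<close> by (intro mult_mono add_nonneg_nonneg mult_nonneg_nonneg) auto
      finally show "\<bar>?f (x + d) - ?f x\<bar> \<le> norm d * ((2 * \<kappa> * ?f x + M) * (?v x + 1))"
        by (simp add: mult_ac)
    qed (rule t)
  qed
qed

text \<open>The integral is taken in the extended nonnegative reals, so the bound asserts
  finiteness; a Bochner integral would be 0 for a non-integrable function and the estimate would
  lose its content.\<close>

theorem theorem2p4:
  fixes V :: "real ^ 'n \<Rightarrow> real"
    and \<psi> :: "real ^ 'n \<Rightarrow> complex"
    and E :: real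
    and \<phi> \<phi>' :: "real \<Rightarrow> real"
  assumes "continuous_on UNIV V"
    and "bdd_below (range V)"
    and "relatively_bounded (sobolev_H 2) (\<lambda>f x. - laplacian f x) (mult_dom V) (mult_op V)"
    and "relative_bound (sobolev_H 2) (\<lambda>f x. - laplacian f x) (mult_op V) < 1"
    and "eigenfunction (sobolev_H 2) (schroedinger V) (complex_of_real E) \<psi>"
    and "\<psi> \<in> Linfty"
    and "filterlim (agmon_distance V E) at_top at_infinity"
    and "\<And>t. t \<ge> 0 \<Longrightarrow> (\<phi> has_real_derivative \<phi>' t) (at t within {0..})"
    and "continuous_on {0..} \<phi>'"
    and "mono_on {0..} \<phi>"
    and "\<And>t. t \<ge> 0 \<Longrightarrow> \<phi> t \<ge> 1"
    and "filterlim \<phi> at_top at_top"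
    and "bdd_above ((\<lambda>t. \<bar>\<phi>' t / \<phi> t\<bar>) ` {0..})"
    and "0 < (SUP t\<in>{0..}. \<bar>\<phi>' t / \<phi> t\<bar>)"
    and "((\<lambda>t. \<phi>' t / \<phi> t) \<longlongrightarrow> 0) at_top"
  shows "\<forall>\<epsilon> \<delta>. 0 < \<epsilon> \<and> \<epsilon> < 1 \<and> 0 < \<delta> \<and>
      (\<lambda>x. indicator {y. V y \<le> E + \<delta>} x * \<phi> ((1 - \<epsilon>) * agmon_distance V E x)) \<in> L2 \<longrightarrow>
      (\<exists>c::real. 0 < c \<and>
        (\<integral>\<^sup>+ x. ennreal ((\<phi> ((1 - \<epsilon>) * agmon_distance V E x))\<^sup>2 * (norm (\<psi> x))\<^sup>2) \<partial>lebesgue) \<le> ennreal c)"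
proof (intro allI impI)
  fix \<epsilon> \<delta> :: real
  define f where "f x = \<phi> ((1 - \<epsilon>) * agmon_distance V E x)" for x
  assume "0 < \<epsilon> \<and> \<epsilon> < 1 \<and> 0 < \<delta> \<and>
      (\<lambda>x. indicator {y. V y \<le> E + \<delta>} x * \<phi> ((1 - \<epsilon>) * agmon_distance V E x)) \<in> L2"
  then have \<epsilon>: "0 < \<epsilon>" "\<epsilon> < 1" and \<delta>: "0 < \<delta>"
    and fL2: "(\<lambda>x. indicator {y. V y \<le> E + \<delta>} x * f x) \<in> L2"
    by (auto simp: f_def)
  have \<psi>: "\<psi> \<in> sobolev_H 2" "AE x in lebesgue. schroedinger V \<psi> x = complex_of_real E * \<psi> x"
    using assms(5) by (auto simp: eigenfunction_def)
  then have \<psi>L2: "\<psi> \<in> L2" by (simp add: numeral_2_eq_2)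
  have "\<psi> \<in> mult_dom V"
    using \<psi> assms(3) by (auto simp: relatively_bounded_def)
  then have V\<psi>: "mult_op V \<psi> \<in> L2" by (simp add: mult_dom_def)
  obtain B where B: "AE x in lebesgue. norm (\<psi> x) \<le> B"
    using assms(6) by (auto simp: Linfty_def)
  obtain m where m: "\<And>x. m \<le> V x"
    using assms(2) by (auto simp: bdd_below_def)
  have Vm: "V \<in> borel_measurable lebesgue"
    using assms(1) by (intro measurable_completion) (simp add: borel_measurable_continuous_onI)
  have fc: "continuous_on UNIV f"
    unfolding f_def using assms(8) \<epsilon>
    by (intro continuous_on_agmon_weight assms(1) DERIV_continuous_on) auto
  have f1: "f x \<ge> 1" for x
    unfolding f_def using \<epsilon> agmon_distance_nonneg[of V E x] by (intro assms(11)) auto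
  have sv: "slowly_varying (\<lambda>x. sqrt (max (V x - E) 0)) f"
    unfolding f_def[abs_def] by (rule slowly_varying_agmon_weight[of V "1 - \<epsilon>" \<phi> \<phi>'])
      (use assms \<epsilon> in auto)
  \<comment> \<open>Applied to Re and Im: V and E are real, so each part of \<psi> satisfies the
    tested equation by itself.\<close>
  have part: "\<exists>C\<ge>0. (\<integral>\<^sup>+x. ennreal ((f x)\<^sup>2 * (r (\<psi> x))\<^sup>2) \<partial>lebesgue) \<le> ennreal C"
    if r: "bounded_linear r" "\<And>z. \<bar>r z\<bar> \<le> norm z" for r :: "complex \<Rightarrow> real"
  proof -
    obtain h where h: "\<And>i. h i \<in> L2" "\<And>i. has_weak_pderiv2 (\<lambda>x. r (\<psi> x)) i (h i)"
      and eq: "\<And>G B R. G \<in> borel_measurable lebesgue \<Longrightarrow> AE x in lebesgue. \<bar>G x\<bar> \<le> B \<Longrightarrow>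
        (\<And>x. G x \<noteq> 0 \<Longrightarrow> norm x \<le> R) \<Longrightarrow>
        (LINT x|lebesgue. G x * (\<Sum>i\<in>UNIV. h i x)) = (LINT x|lebesgue. G x * ((V x - E) * r (\<psi> x)))"
      using eigenfunction_weak_second_derivatives[OF Vm \<psi> r] by blast
    have uB: "AE x in lebesgue. \<bar>r (\<psi> x)\<bar> \<le> B"
      using B by eventually_elim (use r(2) order_trans in blast)
    have "r (complex_of_real t * z) = t * r z" for t z
      using linear_scale[OF bounded_linear.linear[OF r(1)], of t z] by (simp add: scaleR_conv_of_real)
    then have Vu: "(\<lambda>x. V x * r (\<psi> x)) \<in> L2"
      using L2_bounded_linear[OF r V\<psi>] by (simp add: mult_op_def)
    \<comment> \<open>The absolute value makes the depth b nonnegative also when V stays above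
      E.\<close>
    have b: "- \<bar>m - E\<bar> \<le> V x - E" for x using m[of x] by linarith
    show ?thesis
      by (rule weighted_bound[OF assms(1) b _ \<delta> fc f1 sv L2_bounded_linear[OF r \<psi>L2] uB Vu h eq fL2]) auto
  qed
  obtain C1 where C1: "C1 \<ge> 0" "(\<integral>\<^sup>+x. ennreal ((f x)\<^sup>2 * (Re (\<psi> x))\<^sup>2) \<partial>lebesgue) \<le> ennreal C1"
    using part[OF bounded_linear_Re abs_Re_le_cmod] by blast
  obtain C2 where C2: "C2 \<ge> 0" "(\<integral>\<^sup>+x. ennreal ((f x)\<^sup>2 * (Im (\<psi> x))\<^sup>2) \<partial>lebesgue) \<le> ennreal C2"
    using part[OF bounded_linear_Im abs_Im_le_cmod] by blast
  have [measurable]: "f \<in> borel_measurable lebesgue" "(\<lambda>x. Re (\<psi> x)) \<in> borel_measurable lebesgue"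
    "(\<lambda>x. Im (\<psi> x)) \<in> borel_measurable lebesgue"
    using fc L2_bounded_linear[OF bounded_linear_Re abs_Re_le_cmod \<psi>L2]
      L2_bounded_linear[OF bounded_linear_Im abs_Im_le_cmod \<psi>L2]
    by (auto simp: L2_real_iff intro!: measurable_completion borel_measurable_continuous_onI)
  have "(\<integral>\<^sup>+x. ennreal ((f x)\<^sup>2 * (norm (\<psi> x))\<^sup>2) \<partial>lebesgue) =
      (\<integral>\<^sup>+x. ennreal ((f x)\<^sup>2 * (Re (\<psi> x))\<^sup>2) + ennreal ((f x)\<^sup>2 * (Im (\<psi> x))\<^sup>2) \<partial>lebesgue)"
    by (simp add: cmod_power2 distrib_left flip: ennreal_plus)
  also have "\<dots> = (\<integral>\<^sup>+x. ennreal ((f x)\<^sup>2 * (Re (\<psi> x))\<^sup>2) \<partial>lebesgue)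
      + (\<integral>\<^sup>+x. ennreal ((f x)\<^sup>2 * (Im (\<psi> x))\<^sup>2) \<partial>lebesgue)"
    by (rule nn_integral_add) measurable
  also have "\<dots> \<le> ennreal C1 + ennreal C2"
    by (rule add_mono[OF C1(2) C2(2)])
  \<comment> \<open>The added 1 makes the constant strictly positive.\<close>
  also have "\<dots> \<le> ennreal (C1 + C2 + 1)"
    using C1(1) C2(1) by (simp add: ennreal_leI flip: ennreal_plus)
  finally show "\<exists>c>0. (\<integral>\<^sup>+ x. ennreal ((\<phi> ((1 - \<epsilon>) * agmon_distance V E x))\<^sup>2 * (norm (\<psi> x))\<^sup>2) \<partial>lebesgue) \<le> ennreal c"
    unfolding f_def using C1(1) C2(1) by (intro exI[of _ "C1 + C2 + 1"]) auto
qed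

end
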